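(* The map $\vdash\;\mapsto\;\vdash^{\circ}$ is an embedding (that is, an injective homomorphism) of the lattice of super-Belnap logics into the lattice of extensions of $\mathcal{PP}_{\leq}$. Thus, the latter lattice has (at least) the cardinality of the continuum.
   Context: $\Sigma^{\mathsf{DM}}$ is the signature $\{\land,\lor,\sim,\top,\bot\}$ and $\Sigma^{\mathsf{PP}}=\Sigma^{\mathsf{DM}}\cup\{\circ\}$, $\circ$ unary; formulas are over a denumerable set of variables. A (Set-Fmla) logic is a substitution-invariant consequence relation on formulas. The extensions of a given logic (logics over the same signature containing it), ordered by inclusion, form a complete lattice. A matrix is $\mathfrak M=\langle\mathbf A,D\rangle$ with $\mathbf A$ an algebra and $D\subseteq A$; it is trivial if $D=A$. $\Phi\vdash_{\mathfrak M}\psi$ iff every homomorphism $h$ from the formula algebra to $\mathbf A$ with $h(\Phi)\subseteq D$ has $h(\psi)\in D$. The logic determined by a class of matrices is the intersection of the $\vdash_{\mathfrak M}$. $\mathfrak M$ is a model of $\vdash$ if $\vdash\,\subseteq\,\vdash_{\mathfrak M}$. $\mathcal B$ (Dunn–Belnap logic) is the logic over $\Sigma^{\mathsf{DM}}$ determined by $\langle\mathbf{DM}_4,\{\mathbf b,\mathbf t\}\rangle$, where $\mathbf{DM}_4$ is the lattice $\mathbf f<\mathbf n,\mathbf b<\mathbf t$ ($\mathbf n,\mathbf b$ incomparable), $\top=\mathbf t$, $\bot=\mathbf f$, ${\sim}$ swaps $\mathbf f,\mathbf t$ and fixes $\mathbf n,\mathbf b$. Super-Belnap logics are the extensions of $\mathcal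 B$ over $\Sigma^{\mathsf{DM}}$. For a $\Sigma^{\mathsf{DM}}$-algebra $\mathbf A$ and distinct $\hat{\mathbf f},\hat{\mathbf t}\notin A$, the $\Sigma^{\mathsf{PP}}$-algebra $\mathbf A^{\circ}$ has carrier $A\cup\{\hat{\mathbf f},\hat{\mathbf t}\}$; $\land,\lor,\sim$ extend those of $\mathbf A$ with $\hat{\mathbf f}\land a=a\land\hat{\mathbf f}=\hat{\mathbf f}$, $\hat{\mathbf t}\land a=a\land\hat{\mathbf t}=a$, $\hat{\mathbf t}\lor a=a\lor\hat{\mathbf t}=\hat{\mathbf t}$, $\hat{\mathbf f}\lor a=a\lor\hat{\mathbf f}=a$ for all $a$, ${\sim}\hat{\mathbf t}=\hat{\mathbf f}$, ${\sim}\hat{\mathbf f}=\hat{\mathbf t}$; $\top=\hat{\mathbf t}$, $\bot=\hat{\mathbf f}$; $\circ a=\hat{\mathbf t}$ if $a\in\{\hat{\mathbf f},\hat{\mathbf t}\}$, $\circ a=\hat{\mathbf f}$ if $a\in A$. For $\mathfrak M=\langle\mathbf A,D\rangle$, $\mathfrak M^{\circ}:=\langle\mathbf A^{\circ},D\cup\{\hat{\mathbf t}\}\rangle$. For a super-Belnap logic $\vdash$, $\vdash^{\circ}$ is the logic over $\Sigma^{\mathsf{PP}}$ determined by $\{\mathfrak M^{\circ}:\mathfrak M\text{ a non-trivial model of }\vdash\}$. $\mathcal{PP}_\leq$ is the order-preserving logic of PP-algebras: $\Phi\vdash\psi$ iff for some finite $\Phi'\subseteq\Phi$ the equation $\bigwedge\Phi'\approx\bigwedge\Phi'\land\psi$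 is valid in all PP-algebras ($\bigwedge\varnothing=\top$), where a PP-algebra is a De Morgan algebra (bounded distributive lattice with ${\sim}{\sim}x\approx x$, ${\sim}(x\land y)\approx{\sim}x\lor{\sim}y$) with unary $\circ$ satisfying $\circ\circ x\approx\top$, $\circ x\approx\circ{\sim}x$, $\circ\top\approx\top$, $x\land{\sim}x\land\circ x\approx\bot$, $\circ(x\land y)\approx(\circ x\lor\circ y)\land(\circ x\lor{\sim}y)\land(\circ y\lor{\sim}x)$.
   Formalization: Preservation of joins is claimed only for finitary logics (between the lattices of finitary extensions), since it fails for some non-finitary super-Belnap logics; injectivity and preservation of meets hold for all super-Belnap logics, and continuum many finitary extensions are obtained. *)

theory Defs
  imports "HOL-Algebra.Lattice" "HOL-Library.Equipollence" "HOL.Real"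
begin

section \<open>Formulas, algebras, homomorphisms\<close>

datatype dm_form =
    DVar nat | DAnd dm_form dm_form | DOr dm_form dm_form | DNeg dm_form | DTop | DBot

datatype pp_form =
    PVar nat | PAnd pp_form pp_form | POr pp_form pp_form | PNeg pp_form | PTop | PBot
  | PCirc pp_form

record 'a dm_alg = "'a partial_object" +
  con :: "'a \<Rightarrow> 'a \<Rightarrow> 'a"
  dis :: "'a \<Rightarrow> 'a \<Rightarrow> 'a"
  neg :: "'a \<Rightarrow> 'a"
  tru :: 'a
  fls :: 'a

record 'a pp_alg = "'a dm_alg" +
  cir :: "'a \<Rightarrow> 'a"

text \<open>An algebra of the respective signature: the operations are only required to be
  closed on the carrier.\<close>

definition dm_algebra :: "('a, 'm) dm_alg_scheme \<Rightarrow> bool" where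
  "dm_algebra A \<longleftrightarrow>
     (\<forall>x \<in> carrier A. \<forall>y \<in> carrier A. con A x y \<in> carrier A \<and> dis A x y \<in> carrier A) \<and>
     (\<forall>x \<in> carrier A. neg A x \<in> carrier A) \<and> tru A \<in> carrier A \<and> fls A \<in> carrier A"

definition pp_algebra :: "('a, 'm) pp_alg_scheme \<Rightarrow> bool" where
  "pp_algebra A \<longleftrightarrow> dm_algebra A \<and> (\<forall>x \<in> carrier A. cir A x \<in> carrier A)"

definition dm_hom :: "('a, 'm) dm_alg_scheme \<Rightarrow> ('b, 'n) dm_alg_scheme \<Rightarrow> ('a \<Rightarrow> 'b) set" where
  "dm_hom A B = {h. h \<in> carrier A \<rightarrow> carrier B \<and>
     (\<forall>x \<in> carrier A. \<forall>y \<in> carrier A. h (con A x y) = con B (h x) (h y)) \<and>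
     (\<forall>x \<in> carrier A. \<forall>y \<in> carrier A. h (dis A x y) = dis B (h x) (h y)) \<and>
     (\<forall>x \<in> carrier A. h (neg A x) = neg B (h x)) \<and>
     h (tru A) = tru B \<and> h (fls A) = fls B}"

definition pp_hom :: "('a, 'm) pp_alg_scheme \<Rightarrow> ('b, 'n) pp_alg_scheme \<Rightarrow> ('a \<Rightarrow> 'b) set" where
  "pp_hom A B = {h \<in> dm_hom A B. \<forall>x \<in> carrier A. h (cir A x) = cir B (h x)}"

definition dm_Fm :: "dm_form dm_alg" where
  "dm_Fm = \<lparr>carrier = UNIV, con = DAnd, dis = DOr, neg = DNeg, tru = DTop, fls = DBot\<rparr>"

definition pp_Fm :: "pp_form pp_alg" where
  "pp_Fm = \<lparr>carrier = UNIV, con = PAnd, dis = POr, neg = PNeg, tru = PTop, fls = PBot,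
            cir = PCirc\<rparr>"

section \<open>Logics and matrices\<close>

type_synonym 'f conseq = "'f set \<Rightarrow> 'f \<Rightarrow> bool"

definition consequence_relation :: "'f conseq \<Rightarrow> bool" where
  "consequence_relation L \<longleftrightarrow>
     (\<forall>\<Phi> \<psi>. \<psi> \<in> \<Phi> \<longrightarrow> L \<Phi> \<psi>) \<and>
     (\<forall>\<Phi> \<Phi>' \<psi>. L \<Phi> \<psi> \<and> \<Phi> \<subseteq> \<Phi>' \<longrightarrow> L \<Phi>' \<psi>) \<and>
     (\<forall>\<Phi> \<Psi> \<chi>. (\<forall>\<psi> \<in> \<Psi>. L \<Phi> \<psi>) \<and> L \<Psi> \<chi> \<longrightarrow> L \<Phi> \<chi>)"

text \<open>Substitutions are the endomorphisms of the formula algebra.\<close>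

definition dm_logic :: "dm_form conseq \<Rightarrow> bool" where
  "dm_logic L \<longleftrightarrow> consequence_relation L \<and>
     (\<forall>\<sigma> \<in> dm_hom dm_Fm dm_Fm. \<forall>\<Phi> \<psi>. L \<Phi> \<psi> \<longrightarrow> L (\<sigma> ` \<Phi>) (\<sigma> \<psi>))"

definition pp_logic :: "pp_form conseq \<Rightarrow> bool" where
  "pp_logic L \<longleftrightarrow> consequence_relation L \<and>
     (\<forall>\<sigma> \<in> pp_hom pp_Fm pp_Fm. \<forall>\<Phi> \<psi>. L \<Phi> \<psi> \<longrightarrow> L (\<sigma> ` \<Phi>) (\<sigma> \<psi>))"

definition finitary :: "'f conseq \<Rightarrow> bool" where
  "finitary L \<longleftrightarrow> (\<forall>\<Phi> \<psi>. L \<Phi> \<psi> \<longrightarrow> (\<exists>\<Phi>' \<subseteq> \<Phi>. finite \<Phi>' \<and> L \<Phi>' \<psi>))"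

type_synonym 'a dm_matrix = "'a dm_alg \<times> 'a set"
type_synonym 'a pp_matrix = "'a pp_alg \<times> 'a set"

definition dm_matrix_conseq :: "'a dm_matrix \<Rightarrow> dm_form conseq" where
  "dm_matrix_conseq M \<Phi> \<psi> \<longleftrightarrow>
     (\<forall>h \<in> dm_hom dm_Fm (fst M). h ` \<Phi> \<subseteq> snd M \<longrightarrow> h \<psi> \<in> snd M)"

definition pp_matrix_conseq :: "'a pp_matrix \<Rightarrow> pp_form conseq" where
  "pp_matrix_conseq M \<Phi> \<psi> \<longleftrightarrow>
     (\<forall>h \<in> pp_hom pp_Fm (fst M). h ` \<Phi> \<subseteq> snd M \<longrightarrow> h \<psi> \<in> snd M)"

definition nontrivial_model :: "dm_form conseq \<Rightarrow> 'a dm_matrix \<Rightarrow> bool" where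
  "nontrivial_model L M \<longleftrightarrow> dm_algebra (fst M) \<and> snd M \<subseteq> carrier (fst M) \<and>
     snd M \<noteq> carrier (fst M) \<and> L \<le> dm_matrix_conseq M"

section \<open>Dunn--Belnap logic\<close>

datatype four = FF | NN | BB | TT

fun four_and :: "four \<Rightarrow> four \<Rightarrow> four" where
  "four_and TT y = y"
| "four_and x TT = x"
| "four_and x y = (if x = y then x else FF)"

fun four_neg :: "four \<Rightarrow> four" where
  "four_neg TT = FF"
| "four_neg FF = TT"
| "four_neg NN = NN"
| "four_neg BB = BB"

fun four_or :: "four \<Rightarrow> four \<Rightarrow> four" where
  "four_or FF y = y"
| "four_or x FF = x"
| "four_or x y = (if x = y then x else TT)"

definition DM4 :: "four dm_alg" where
  "DM4 = \<lparr>carrier = UNIV, con = four_and, dis = four_or, neg = four_neg, tru = TT, fls = FF\<rparr>"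

definition belnap :: "dm_form conseq" where
  "belnap = dm_matrix_conseq (DM4, {BB, TT})"

section \<open>The construction adding a classical top and bottom\<close>

datatype 'a hat = El 'a | Fhat | That

fun hat_con :: "('a \<Rightarrow> 'a \<Rightarrow> 'a) \<Rightarrow> 'a hat \<Rightarrow> 'a hat \<Rightarrow> 'a hat" where
  "hat_con f (El a) (El b) = El (f a b)"
| "hat_con f Fhat y = Fhat"
| "hat_con f That y = y"
| "hat_con f (El a) Fhat = Fhat"
| "hat_con f (El a) That = El a"

fun hat_dis :: "('a \<Rightarrow> 'a \<Rightarrow> 'a) \<Rightarrow> 'a hat \<Rightarrow> 'a hat \<Rightarrow> 'a hat" where
  "hat_dis f (El a) (El b) = El (f a b)"
| "hat_dis f That y = That"
| "hat_dis f Fhat y = y"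
| "hat_dis f (El a) That = That"
| "hat_dis f (El a) Fhat = El a"

fun hat_neg :: "('a \<Rightarrow> 'a) \<Rightarrow> 'a hat \<Rightarrow> 'a hat" where
  "hat_neg f (El a) = El (f a)"
| "hat_neg f Fhat = That"
| "hat_neg f That = Fhat"

fun hat_cir :: "'a hat \<Rightarrow> 'a hat" where
  "hat_cir (El a) = Fhat"
| "hat_cir Fhat = That"
| "hat_cir That = That"

definition circ_alg :: "'a dm_alg \<Rightarrow> 'a hat pp_alg" where
  "circ_alg A = \<lparr>carrier = El ` carrier A \<union> {Fhat, That},
     con = hat_con (con A), dis = hat_dis (dis A), neg = hat_neg (neg A),
     tru = That, fls = Fhat, cir = hat_cir\<rparr>"

definition circ_matrix :: "'a dm_matrix \<Rightarrow> 'a hat pp_matrix" where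
  "circ_matrix M = (circ_alg (fst M), El ` snd M \<union> {That})"

text \<open>HOL cannot quantify over the algebras of all types at once, so the class of models is
  taken over a type \<^typ>\<open>'a\<close>, the carriers being arbitrary subsets of it. For infinite
  \<^typ>\<open>'a\<close> this is no restriction, see \<open>circ_le_any_type\<close> and \<open>pp_leq_any_type\<close> below.\<close>

definition circ :: "'a itself \<Rightarrow> dm_form conseq \<Rightarrow> pp_form conseq" where
  "circ _ L \<Phi> \<psi> \<longleftrightarrow>
     (\<forall>M :: 'a dm_matrix. nontrivial_model L M \<longrightarrow> pp_matrix_conseq (circ_matrix M) \<Phi> \<psi>)"

section \<open>PP-algebras and their order-preserving logic\<close>

definition de_morgan_algebra :: "('a, 'm) dm_alg_scheme \<Rightarrow> bool" where
  "de_morgan_algebra A \<longleftrightarrow> dm_algebra A \<and>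
     (\<forall>x \<in> carrier A. \<forall>y \<in> carrier A. \<forall>z \<in> carrier A.
        con A (con A x y) z = con A x (con A y z) \<and>
        dis A (dis A x y) z = dis A x (dis A y z) \<and>
        con A x (dis A y z) = dis A (con A x y) (con A x z)) \<and>
     (\<forall>x \<in> carrier A. \<forall>y \<in> carrier A.
        con A x y = con A y x \<and> dis A x y = dis A y x \<and>
        con A x (dis A x y) = x \<and> dis A x (con A x y) = x \<and>
        neg A (con A x y) = dis A (neg A x) (neg A y)) \<and>
     (\<forall>x \<in> carrier A. con A x (tru A) = x \<and> dis A x (fls A) = x \<and> neg A (neg A x) = x)"

definition PP_algebra :: "('a, 'm) pp_alg_scheme \<Rightarrow> bool" where
  "PP_algebra A \<longleftrightarrow> pp_algebra A \<and> de_morgan_algebra A \<and>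
     (\<forall>x \<in> carrier A.
        cir A (cir A x) = tru A \<and> cir A x = cir A (neg A x) \<and>
        con A (con A x (neg A x)) (cir A x) = fls A) \<and>
     cir A (tru A) = tru A \<and>
     (\<forall>x \<in> carrier A. \<forall>y \<in> carrier A.
        cir A (con A x y) =
          con A (con A (dis A (cir A x) (cir A y)) (dis A (cir A x) (neg A y)))
                (dis A (cir A y) (neg A x)))"

definition PP_valid :: "'a itself \<Rightarrow> pp_form \<Rightarrow> pp_form \<Rightarrow> bool" where
  "PP_valid _ \<alpha> \<beta> \<longleftrightarrow>
     (\<forall>A :: 'a pp_alg. PP_algebra A \<longrightarrow> (\<forall>h \<in> pp_hom pp_Fm A. h \<alpha> = h \<beta>))"

fun PBigAnd :: "pp_form list \<Rightarrow> pp_form" where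
  "PBigAnd [] = PTop"
| "PBigAnd (\<phi> # \<phi>s) = PAnd \<phi> (PBigAnd \<phi>s)"

text \<open>The finite set of premises is given by a list enumerating it; by associativity,
  commutativity and idempotence the order and multiplicity are irrelevant.\<close>

definition pp_leq :: "'a itself \<Rightarrow> pp_form conseq" where
  "pp_leq T \<Phi> \<psi> \<longleftrightarrow>
     (\<exists>\<phi>s. set \<phi>s \<subseteq> \<Phi> \<and> PP_valid T (PBigAnd \<phi>s) (PAnd (PBigAnd \<phi>s) \<psi>))"

section \<open>Lattices of extensions\<close>

definition extensions :: "('f conseq \<Rightarrow> bool) \<Rightarrow> 'f conseq \<Rightarrow> 'f conseq gorder" where
  "extensions logic L\<^sub>0 = \<lparr>carrier = {L. logic L \<and> L\<^sub>0 \<le> L}, eq = (=), le = (\<le>)\<rparr>"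

text \<open>For arbitrary consequence relations the map
  \<^term>\<open>circ TYPE('a)\<close> does not preserve joins: see \<open>no_lattice_embedding_of_nonfinitary\<close> at
  the end of this theory. It does so on finitary logics.\<close>

definition fin_extensions :: "('f conseq \<Rightarrow> bool) \<Rightarrow> 'f conseq \<Rightarrow> 'f conseq gorder" where
  "fin_extensions logic = extensions (\<lambda>L. logic L \<and> finitary L)"

definition meet_embedding :: "('a, 'm) gorder_scheme \<Rightarrow> ('b, 'n) gorder_scheme \<Rightarrow> ('a \<Rightarrow> 'b) \<Rightarrow> bool"
  where "meet_embedding X Y f \<longleftrightarrow> f \<in> carrier X \<rightarrow> carrier Y \<and> inj_on f (carrier X) \<and>
     (\<forall>x \<in> carrier X. \<forall>y \<in> carrier X. f (x \<sqinter>\<^bsub>X\<^esub> y) = f x \<sqinter>\<^bsub>Y\<^esub> f y)"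

definition lattice_embedding :: "('a, 'm) gorder_scheme \<Rightarrow> ('b, 'n) gorder_scheme \<Rightarrow> ('a \<Rightarrow> 'b) \<Rightarrow> bool"
  where "lattice_embedding X Y f \<longleftrightarrow> f \<in> carrier X \<rightarrow> carrier Y \<and> inj_on f (carrier X) \<and>
     (\<forall>x \<in> carrier X. \<forall>y \<in> carrier X.
        f (x \<sqinter>\<^bsub>X\<^esub> y) = f x \<sqinter>\<^bsub>Y\<^esub> f y \<and> f (x \<squnion>\<^bsub>X\<^esub> y) = f x \<squnion>\<^bsub>Y\<^esub> f y)"

section \<open>Independence of the universe of the algebras\<close>

instance dm_form :: countable by countable_datatype
instance pp_form :: countable by countable_datatype

lemma dm_hom_Fm_iff:
  "h \<in> dm_hom dm_Fm A \<longleftrightarrow> (\<forall>\<phi>. h \<phi> \<in> carrier A) \<and>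
     (\<forall>\<phi> \<psi>. h (DAnd \<phi> \<psi>) = con A (h \<phi>) (h \<psi>)) \<and>
     (\<forall>\<phi> \<psi>. h (DOr \<phi> \<psi>) = dis A (h \<phi>) (h \<psi>)) \<and>
     (\<forall>\<phi>. h (DNeg \<phi>) = neg A (h \<phi>)) \<and> h DTop = tru A \<and> h DBot = fls A"
  unfolding dm_hom_def dm_Fm_def by (auto simp: Pi_iff)

lemma pp_hom_Fm_iff:
  "h \<in> pp_hom pp_Fm A \<longleftrightarrow> (\<forall>\<phi>. h \<phi> \<in> carrier A) \<and>
     (\<forall>\<phi> \<psi>. h (PAnd \<phi> \<psi>) = con A (h \<phi>) (h \<psi>)) \<and>
     (\<forall>\<phi> \<psi>. h (POr \<phi> \<psi>) = dis A (h \<phi>) (h \<psi>)) \<and>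
     (\<forall>\<phi>. h (PNeg \<phi>) = neg A (h \<phi>)) \<and> h PTop = tru A \<and> h PBot = fls A \<and>
     (\<forall>\<phi>. h (PCirc \<phi>) = cir A (h \<phi>))"
  unfolding pp_hom_def dm_hom_def pp_Fm_def by (auto simp: Pi_iff)

primrec dm_ev :: "('a, 'm) dm_alg_scheme \<Rightarrow> (nat \<Rightarrow> 'a) \<Rightarrow> dm_form \<Rightarrow> 'a" where
  "dm_ev A v (DVar n) = v n"
| "dm_ev A v (DAnd \<phi> \<psi>) = con A (dm_ev A v \<phi>) (dm_ev A v \<psi>)"
| "dm_ev A v (DOr \<phi> \<psi>) = dis A (dm_ev A v \<phi>) (dm_ev A v \<psi>)"
| "dm_ev A v (DNeg \<phi>) = neg A (dm_ev A v \<phi>)"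
| "dm_ev A v DTop = tru A"
| "dm_ev A v DBot = fls A"

lemma dm_ev_closed:
  assumes "dm_algebra A" "range v \<subseteq> carrier A"
  shows "dm_ev A v \<phi> \<in> carrier A"
  using assms by (induction \<phi>) (auto simp: dm_algebra_def)

lemma dm_ev_hom:
  "dm_algebra A \<Longrightarrow> range v \<subseteq> carrier A \<Longrightarrow> dm_ev A v \<in> dm_hom dm_Fm A"
  by (auto simp: dm_hom_Fm_iff dm_ev_closed)

lemma inj_of_countable:
  assumes "countable C" "infinite (UNIV :: 'a set)"
  obtains e :: "'b \<Rightarrow> 'a" where "inj_on e C"
proof -
  obtain f :: "nat \<Rightarrow> 'a" where "inj f"
    using infinite_countable_subset[OF assms(2)] by auto
  then have "inj_on (f \<circ> to_nat_on C) C"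
    using inj_on_to_nat_on[OF assms(1)] by (auto intro: comp_inj_on inj_on_subset)
  then show ?thesis using that by blast
qed

theorem circ_le_any_type:
  fixes M :: "'b dm_matrix"
  assumes inf: "infinite (UNIV :: 'a set)" and M: "nontrivial_model L M"
  shows "circ TYPE('a) L \<le> pp_matrix_conseq (circ_matrix M)"
proof (intro le_funI le_boolI)
  fix \<Phi> \<psi> assume L: "circ TYPE('a) L \<Phi> \<psi>"
  obtain A D where MAD: "M = (A, D)" by (cases M)
  from M have A: "dm_algebra A" and D: "D \<subseteq> carrier A" "D \<noteq> carrier A"
    and mod: "L \<le> dm_matrix_conseq (A, D)"
    by (auto simp: nontrivial_model_def MAD)
  from D obtain d where d: "d \<in> carrier A" "d \<notin> D" by blast
  show "pp_matrix_conseq (circ_matrix M) \<Phi> \<psi>"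
    unfolding pp_matrix_conseq_def
  proof (intro ballI impI)
    fix g assume g: "g \<in> pp_hom pp_Fm (fst (circ_matrix M))"
      and g\<Phi>: "g ` \<Phi> \<subseteq> snd (circ_matrix M)"
    define S where "S = insert d {a. El a \<in> range g}"
    have "El ` {a. El a \<in> range g} \<subseteq> range g" by auto
    then have "countable (El ` {a. El a \<in> range g})"
      by (rule countable_subset) simp
    then have "countable {a. El a \<in> range g}"
      by (rule countable_image_inj_on) (auto simp: inj_on_def)
    then have "countable S" by (simp add: S_def)
    have gc: "g \<phi> \<in> El ` carrier A \<union> {Fhat, That}" for \<phi>
      using g by (auto simp: pp_hom_Fm_iff circ_matrix_def circ_alg_def MAD)
    have SA: "S \<subseteq> carrier A"
    proof
      fix x assume "x \<in> S"
      then consider "x = d" | \<phi> where "El x = g \<phi>" by (auto simp: S_def)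
      then show "x \<in> carrier A"
      proof cases
        case 2
        then show ?thesis using gc[of \<phi>] by auto
      qed (use d in simp)
    qed
    obtain v :: "nat \<Rightarrow> 'b" where v: "range v = S"
      using range_from_nat_into[OF _ \<open>countable S\<close>] by (metis S_def insert_not_empty)
    define C where "C = range (dm_ev A v)"
    have SC: "S \<subseteq> C"
    proof
      fix x assume "x \<in> S"
      then obtain n where "x = v n" using v by blast
      then have "x = dm_ev A v (DVar n)" by simp
      then show "x \<in> C" unfolding C_def by blast
    qed
    have CA: "C \<subseteq> carrier A"
      using dm_ev_closed[OF A, of v] v SA by (auto simp: C_def)
    have Ccl: "con A x y \<in> C" "dis A x y \<in> C" "neg A x \<in> C" "tru A \<in> C" "fls A \<in> C"
      if "x \<in> C" "y \<in> C" for x y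
    proof -
      from that obtain \<alpha> \<beta> where "x = dm_ev A v \<alpha>" "y = dm_ev A v \<beta>"
        by (auto simp: C_def)
      then have "con A x y = dm_ev A v (DAnd \<alpha> \<beta>)" "dis A x y = dm_ev A v (DOr \<alpha> \<beta>)"
        "neg A x = dm_ev A v (DNeg \<alpha>)" "tru A = dm_ev A v DTop" "fls A = dm_ev A v DBot"
        by simp_all
      then show "con A x y \<in> C" "dis A x y \<in> C" "neg A x \<in> C" "tru A \<in> C" "fls A \<in> C"
        unfolding C_def by blast+
    qed
    have dC: "d \<in> C" using SC by (auto simp: S_def)
    note Ctf = Ccl(4,5)[OF dC dC]
    have "countable C" by (simp add: C_def)
    then obtain e :: "'b \<Rightarrow> 'a" where e: "inj_on e C"
      using inj_of_countable inf by blast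
    define i where "i = inv_into C e"
    have ie: "i (e x) = x" if "x \<in> C" for x
      using e that by (simp add: i_def)
    define A' where "A' = \<lparr>carrier = e ` C, con = \<lambda>x y. e (con A (i x) (i y)),
       dis = \<lambda>x y. e (dis A (i x) (i y)), neg = \<lambda>x. e (neg A (i x)),
       tru = e (tru A), fls = e (fls A)\<rparr>"
    define D' where "D' = e ` (C \<inter> D)"
    have A': "dm_algebra A'"
      using Ccl(1-3) Ctf by (auto simp: dm_algebra_def A'_def ie)
    have mem: "e x \<in> D' \<longleftrightarrow> x \<in> D" if "x \<in> C" for x
      using that e by (auto simp: D'_def inj_on_def)
    have "L \<le> dm_matrix_conseq (A', D')"
    proof (intro le_funI le_boolI)
      fix \<Phi> \<psi> assume "L \<Phi> \<psi>"
      with mod have *: "dm_matrix_conseq (A, D) \<Phi> \<psi>" by (auto simp: le_fun_def)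
      show "dm_matrix_conseq (A', D') \<Phi> \<psi>"
        unfolding dm_matrix_conseq_def
      proof (intro ballI impI)
        fix h assume h: "h \<in> dm_hom dm_Fm (fst (A', D'))" and h\<Phi>: "h ` \<Phi> \<subseteq> snd (A', D')"
        have hc: "h \<phi> \<in> e ` C" for \<phi> using h by (simp add: dm_hom_Fm_iff A'_def)
        have iC: "i (h \<phi>) \<in> C" and ei: "e (i (h \<phi>)) = h \<phi>" for \<phi>
          using hc[of \<phi>] by (auto simp: ie)
        have "i \<circ> h \<in> dm_hom dm_Fm A"
          using h iC CA Ccl(1-3) Ctf by (auto simp: dm_hom_Fm_iff A'_def ie)
        moreover have "(i \<circ> h) ` \<Phi> \<subseteq> D"
          using h\<Phi> mem iC ei by fastforce
        ultimately have "i (h \<psi>) \<in> D"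
          using * unfolding dm_matrix_conseq_def by (metis comp_apply fst_conv snd_conv)
        then show "h \<psi> \<in> snd (A', D')" using mem iC ei by fastforce
      qed
    qed
    moreover have "D' \<noteq> carrier A'"
    proof -
      have "e d \<in> carrier A'" "e d \<notin> D'" using dC d mem by (auto simp: A'_def)
      then show ?thesis by blast
    qed
    ultimately have "nontrivial_model L (A', D')"
      using A' by (auto simp: nontrivial_model_def D'_def A'_def)
    then have c: "pp_matrix_conseq (circ_matrix (A', D')) \<Phi> \<psi>"
      using L by (auto simp: circ_def)
    have gS: "g \<phi> \<in> El ` C \<union> {Fhat, That}" for \<phi>
    proof (cases "g \<phi>")
      case (El a)
      then have "El a \<in> range g" by (metis rangeI)
      then show ?thesis using El SC by (auto simp: S_def)
    qed auto
    have g_simps: "g (PAnd \<alpha> \<beta>) = hat_con (con A) (g \<alpha>) (g \<beta>)"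
      "g (POr \<alpha> \<beta>) = hat_dis (dis A) (g \<alpha>) (g \<beta>)" "g (PNeg \<alpha>) = hat_neg (neg A) (g \<alpha>)"
      "g PTop = That" "g PBot = Fhat" "g (PCirc \<alpha>) = hat_cir (g \<alpha>)" for \<alpha> \<beta>
      using g by (auto simp: pp_hom_Fm_iff circ_matrix_def circ_alg_def MAD)
    have mc: "map_hat e (hat_con (con A) x y) = hat_con (con A') (map_hat e x) (map_hat e y)"
      "map_hat e (hat_dis (dis A) x y) = hat_dis (dis A') (map_hat e x) (map_hat e y)"
      "map_hat e (hat_neg (neg A) x) = hat_neg (neg A') (map_hat e x)"
      "map_hat e (hat_cir x) = hat_cir (map_hat e x)"
      if "x \<in> El ` C \<union> {Fhat, That}" "y \<in> El ` C \<union> {Fhat, That}" for x y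
      using that by (auto simp: A'_def ie)
    have "map_hat e (g \<phi>) \<in> carrier (circ_alg A')" for \<phi>
      using gS[of \<phi>] by (auto simp: circ_alg_def A'_def)
    moreover have "map_hat e (hat_con (con A) (g \<alpha>) (g \<beta>)) = hat_con (con A') (map_hat e (g \<alpha>)) (map_hat e (g \<beta>))"
      "map_hat e (hat_dis (dis A) (g \<alpha>) (g \<beta>)) = hat_dis (dis A') (map_hat e (g \<alpha>)) (map_hat e (g \<beta>))"
      "map_hat e (hat_neg (neg A) (g \<alpha>)) = hat_neg (neg A') (map_hat e (g \<alpha>))"
      "map_hat e (hat_cir (g \<alpha>)) = hat_cir (map_hat e (g \<alpha>))" for \<alpha> \<beta>
      using mc[OF gS[of \<alpha>] gS[of \<beta>]] by blast+
    ultimately have "map_hat e \<circ> g \<in> pp_hom pp_Fm (circ_alg A')"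
      by (simp add: pp_hom_Fm_iff g_simps) (simp add: circ_alg_def)
    moreover have mem': "map_hat e x \<in> El ` D' \<union> {That} \<longleftrightarrow> x \<in> El ` D \<union> {That}"
      if "x \<in> El ` C \<union> {Fhat, That}" for x
      using that mem by (auto simp: image_iff)
    have "(map_hat e \<circ> g) ` \<Phi> \<subseteq> El ` D' \<union> {That}"
    proof
      fix y assume "y \<in> (map_hat e \<circ> g) ` \<Phi>"
      then obtain \<phi> where "\<phi> \<in> \<Phi>" "y = map_hat e (g \<phi>)" by auto
      moreover from this have "g \<phi> \<in> El ` D \<union> {That}"
        using g\<Phi> by (auto simp: circ_matrix_def MAD)
      ultimately show "y \<in> El ` D' \<union> {That}" using mem'[OF gS] by simp
    qed
    ultimately have "map_hat e (g \<psi>) \<in> El ` D' \<union> {That}"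
      using c unfolding pp_matrix_conseq_def circ_matrix_def by force
    then show "g \<psi> \<in> snd (circ_matrix M)"
      using mem'[OF gS] by (simp add: circ_matrix_def MAD)
  qed
qed

theorem pp_leq_any_type:
  assumes inf: "infinite (UNIV :: 'a set)" and "PP_valid TYPE('a) \<alpha> \<beta>"
  shows "PP_valid TYPE('b) \<alpha> \<beta>"
  unfolding PP_valid_def
proof (intro allI ballI impI)
  fix A :: "'b pp_alg" and h assume A: "PP_algebra A" and h: "h \<in> pp_hom pp_Fm A"
  define C where "C = range h"
  have CA: "C \<subseteq> carrier A" using h by (auto simp: C_def pp_hom_Fm_iff)
  have h_simps: "h (PAnd \<alpha> \<beta>) = con A (h \<alpha>) (h \<beta>)"
    "h (POr \<alpha> \<beta>) = dis A (h \<alpha>) (h \<beta>)" "h (PNeg \<alpha>) = neg A (h \<alpha>)"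
    "h PTop = tru A" "h PBot = fls A" "h (PCirc \<alpha>) = cir A (h \<alpha>)" for \<alpha> \<beta>
    using h by (auto simp: pp_hom_Fm_iff)
  have Ccl: "con A x y \<in> C" "dis A x y \<in> C" "neg A x \<in> C" "tru A \<in> C" "fls A \<in> C" "cir A x \<in> C"
    if "x \<in> C" "y \<in> C" for x y
    using that unfolding C_def by (auto simp: image_iff) (metis h_simps)+
  have hC: "h \<phi> \<in> C" for \<phi> by (simp add: C_def)
  note Ctf = Ccl(4,5)[OF hC hC]
  have "countable C" by (simp add: C_def)
  then obtain e :: "'b \<Rightarrow> 'a" where e: "inj_on e C"
    using inj_of_countable inf by blast
  define i where "i = inv_into C e"
  have ie: "i (e x) = x" if "x \<in> C" for x
    using e that by (simp add: i_def)
  define A' where "A' = \<lparr>carrier = e ` C, con = \<lambda>x y. e (con A (i x) (i y)),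
     dis = \<lambda>x y. e (dis A (i x) (i y)), neg = \<lambda>x. e (neg A (i x)),
     tru = e (tru A), fls = e (fls A), cir = \<lambda>x. e (cir A (i x))\<rparr>"
  have "dm_algebra A'"
    using Ccl(1-3) Ctf by (auto simp: dm_algebra_def A'_def ie)
  moreover have "cir A' x \<in> carrier A'" if "x \<in> carrier A'" for x
    using that Ccl(6) by (auto simp: A'_def ie)
  moreover have "de_morgan_algebra A'"
  proof -
    from A have dA: "de_morgan_algebra A" by (simp add: PP_algebra_def)
    have "\<forall>x\<in>C. \<forall>y\<in>C. \<forall>z\<in>C.
        con A (con A x y) z = con A x (con A y z) \<and>
        dis A (dis A x y) z = dis A x (dis A y z) \<and>
        con A x (dis A y z) = dis A (con A x y) (con A x z)"
      using dA CA unfolding de_morgan_algebra_def by blast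
    moreover have "\<forall>x\<in>C. \<forall>y\<in>C. con A x y = con A y x \<and> dis A x y = dis A y x \<and>
        con A x (dis A x y) = x \<and> dis A x (con A x y) = x \<and>
        neg A (con A x y) = dis A (neg A x) (neg A y)"
      using dA CA unfolding de_morgan_algebra_def by blast
    moreover have "\<forall>x\<in>C. con A x (tru A) = x \<and> dis A x (fls A) = x \<and> neg A (neg A x) = x"
      using dA CA unfolding de_morgan_algebra_def by blast
    ultimately show ?thesis
      using Ccl(1-3) Ctf \<open>dm_algebra A'\<close> by (simp add: de_morgan_algebra_def A'_def ie)
  qed
  moreover have "\<forall>x\<in>C. cir A (cir A x) = tru A \<and> cir A (neg A x) = cir A x \<and>
        con A (con A x (neg A x)) (cir A x) = fls A"
    using A CA unfolding PP_algebra_def by (metis subsetD)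
  moreover have "cir A (tru A) = tru A" using A unfolding PP_algebra_def by blast
  moreover have "\<forall>x\<in>C. \<forall>y\<in>C. cir A (con A x y) =
          con A (con A (dis A (cir A x) (cir A y)) (dis A (cir A x) (neg A y)))
                (dis A (cir A y) (neg A x))"
    using A CA unfolding PP_algebra_def by blast
  ultimately have "PP_algebra A'"
    using Ccl(1-3,6) Ctf by (simp add: PP_algebra_def pp_algebra_def A'_def ie)
  moreover have "e \<circ> h \<in> pp_hom pp_Fm A'"
    using hC by (simp add: pp_hom_Fm_iff h_simps A'_def ie)
  ultimately have "e (h \<alpha>) = e (h \<beta>)"
    using assms(2) unfolding PP_valid_def by (metis comp_apply)
  then show "h \<alpha> = h \<beta>" using e hC by (auto simp: inj_on_def)
qed

section \<open>Joins of non-finitary logics need not be preserved\<close>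

text \<open>
  The logic \<open>gen R1\<close> has the infinitary rule \<open>\<gamma> 0, \<gamma> 1, \<dots> / w \<or> \<sim>w\<close>, where \<open>\<gamma> n\<close> is
  satisfiable on the De Morgan algebra of a graph (with the top as only designated element) iff
  the graph maps homomorphically to the cycle of length \<open>2n+3\<close>, and \<open>w\<close> occurs in \<open>\<gamma> 0\<close>.
  The logic \<open>gen R2\<close> has the rule \<open>\<gamma> 0 \<and> (w \<or> \<sim>w) / q\<close>. Hence the join has the rule
  \<open>\<gamma> 0, \<gamma> 1, \<dots> / q\<close>. The premises \<open>\<Delta>\<close> use classical variables \<open>p\<^sub>0, p\<^sub>1, \<dots>\<close> to choose
  between the cases \<open>i < \<omega>\<close>, in which they amount to \<open>\<gamma> 0, \<dots>, \<gamma> i, q\<close>, and the case in which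
  no \<open>p\<^sub>i\<close> is true, in which they amount to all \<open>\<gamma> n\<close>. A formula derived from \<open>\<Delta>\<close> takes the same
  value in the last case as in almost all others, and therefore the intermediate conclusion
  \<open>w \<or> \<sim>w\<close> cannot be expressed.
\<close>


subsection \<open>Logics given by theories\<close>

abbreviation ev :: "(nat \<Rightarrow> four) \<Rightarrow> dm_form \<Rightarrow> four" where
  "ev \<equiv> dm_ev DM4"

lemma dm_algebra_DM4: "dm_algebra DM4" by (simp add: dm_algebra_def DM4_def)
lemma dm_algebra_Fm: "dm_algebra dm_Fm" by (simp add: dm_algebra_def dm_Fm_def)

lemma hom_DM4_ev:
  assumes "h \<in> dm_hom dm_Fm DM4" shows "h \<phi> = ev (\<lambda>x. h (DVar x)) \<phi>"
  using assms by (induction \<phi>) (auto simp: dm_hom_Fm_iff)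

lemma belnap_iff:
  "belnap \<Phi> \<psi> \<longleftrightarrow> (\<forall>v. (\<forall>\<phi>\<in>\<Phi>. ev v \<phi> \<in> {BB, TT}) \<longrightarrow> ev v \<psi> \<in> {BB, TT})"
proof
  assume L: "belnap \<Phi> \<psi>"
  show "\<forall>v. (\<forall>\<phi>\<in>\<Phi>. ev v \<phi> \<in> {BB, TT}) \<longrightarrow> ev v \<psi> \<in> {BB, TT}"
  proof (intro allI impI)
    fix v assume "\<forall>\<phi>\<in>\<Phi>. ev v \<phi> \<in> {BB, TT}"
    moreover have "ev v \<in> dm_hom dm_Fm DM4"
      by (rule dm_ev_hom[OF dm_algebra_DM4]) (simp add: DM4_def)
    ultimately show "ev v \<psi> \<in> {BB, TT}"
      using L unfolding belnap_def dm_matrix_conseq_def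
      by (metis (no_types, lifting) fst_conv image_subsetI snd_conv)
  qed
next
  assume R: "\<forall>v. (\<forall>\<phi>\<in>\<Phi>. ev v \<phi> \<in> {BB, TT}) \<longrightarrow> ev v \<psi> \<in> {BB, TT}"
  show "belnap \<Phi> \<psi>" unfolding belnap_def dm_matrix_conseq_def
  proof (intro ballI impI)
    fix h assume h: "h \<in> dm_hom dm_Fm (fst (DM4, {BB, TT}))" "h ` \<Phi> \<subseteq> snd (DM4, {BB, TT})"
    then have "h \<phi> = ev (\<lambda>x. h (DVar x)) \<phi>" for \<phi> using hom_DM4_ev[of h \<phi>] by simp
    then show "h \<psi> \<in> snd (DM4, {BB, TT})"
      using R h(2) by (metis (no_types, lifting) image_subset_iff snd_conv)
  qed
qed

definition conj_four :: "four \<Rightarrow> four" where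
  "conj_four x = (case x of NN \<Rightarrow> BB | BB \<Rightarrow> NN | _ \<Rightarrow> x)"

lemma conj_four_simps:
  "conj_four (four_and x y) = four_and (conj_four x) (conj_four y)"
  "conj_four (four_or x y) = four_or (conj_four x) (conj_four y)"
  "conj_four (four_neg x) = four_neg (conj_four x)" "conj_four TT = TT" "conj_four FF = FF"
  by (cases x; cases y; simp add: conj_four_def)+

lemma ev_conj: "ev (conj_four \<circ> v) \<phi> = conj_four (ev v \<phi>)"
  by (induction \<phi>) (auto simp: DM4_def conj_four_simps)

lemma belnap_TT:
  assumes "belnap \<Phi> \<psi>" "\<forall>\<phi>\<in>\<Phi>. ev v \<phi> = TT" shows "ev v \<psi> = TT"
proof -
  have "\<forall>\<phi>\<in>\<Phi>. ev (conj_four \<circ> v) \<phi> \<in> {BB, TT}" "\<forall>\<phi>\<in>\<Phi>. ev v \<phi> \<in> {BB, TT}"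
    using assms(2) by (auto simp: ev_conj conj_four_simps)
  then have "conj_four (ev v \<psi>) \<in> {BB, TT}" "ev v \<psi> \<in> {BB, TT}"
    using assms(1) by (metis belnap_iff ev_conj)+
  then show ?thesis by (cases "ev v \<psi>") (auto simp: conj_four_def)
qed

abbreviation subs :: "(dm_form \<Rightarrow> dm_form) set" where "subs \<equiv> dm_hom dm_Fm dm_Fm"

lemma ev_subs: "\<sigma> \<in> subs \<Longrightarrow> ev v (\<sigma> \<phi>) = ev (\<lambda>x. ev v (\<sigma> (DVar x))) \<phi>"
  by (induction \<phi>) (auto simp: dm_hom_Fm_iff, simp_all add: dm_Fm_def)

lemma subs_comp: "\<sigma> \<in> subs \<Longrightarrow> \<tau> \<in> subs \<Longrightarrow> \<sigma> \<circ> \<tau> \<in> subs"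
  unfolding dm_hom_Fm_iff by (simp add: dm_Fm_def)

lemma belnap_subs: "belnap \<Phi> \<psi> \<Longrightarrow> \<sigma> \<in> subs \<Longrightarrow> belnap (\<sigma> ` \<Phi>) (\<sigma> \<psi>)"
  unfolding belnap_iff
proof (intro allI impI)
  fix v assume b: "\<forall>v. (\<forall>\<phi>\<in>\<Phi>. ev v \<phi> \<in> {BB, TT}) \<longrightarrow> ev v \<psi> \<in> {BB, TT}" and \<sigma>: "\<sigma> \<in> subs"
    and v: "\<forall>\<phi>\<in>\<sigma> ` \<Phi>. ev v \<phi> \<in> {BB, TT}"
  define w where "w x = ev v (\<sigma> (DVar x))" for x
  have w: "ev v (\<sigma> \<phi>) = ev w \<phi>" for \<phi> unfolding w_def by (rule ev_subs[OF \<sigma>])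
  then show "ev v (\<sigma> \<psi>) \<in> {BB, TT}" using b v by auto
qed

type_synonym rules = "(dm_form set \<times> dm_form) set"

definition thy :: "rules \<Rightarrow> dm_form set \<Rightarrow> bool" where
  "thy R T \<longleftrightarrow> (\<forall>\<Phi> \<psi>. belnap \<Phi> \<psi> \<longrightarrow> \<Phi> \<subseteq> T \<longrightarrow> \<psi> \<in> T) \<and>
     (\<forall>\<sigma>\<in>subs. \<forall>(\<Phi>, \<psi>)\<in>R. \<sigma> ` \<Phi> \<subseteq> T \<longrightarrow> \<sigma> \<psi> \<in> T)"

definition gen :: "rules \<Rightarrow> dm_form conseq" where
  "gen R \<Phi> \<psi> \<longleftrightarrow> (\<forall>T. thy R T \<longrightarrow> \<Phi> \<subseteq> T \<longrightarrow> \<psi> \<in> T)"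

lemma thy_preimage:
  assumes "thy R T" "\<sigma> \<in> subs" shows "thy R {\<phi>. \<sigma> \<phi> \<in> T}"
  unfolding thy_def
proof (intro conjI allI ballI impI)
  fix \<Phi> \<psi> assume "belnap \<Phi> \<psi>" "\<Phi> \<subseteq> {\<phi>. \<sigma> \<phi> \<in> T}"
  then have "belnap (\<sigma> ` \<Phi>) (\<sigma> \<psi>)" "\<sigma> ` \<Phi> \<subseteq> T" using assms belnap_subs by auto
  then show "\<psi> \<in> {\<phi>. \<sigma> \<phi> \<in> T}" using assms unfolding thy_def by blast
next
  fix \<tau> r assume \<tau>: "\<tau> \<in> subs" and r: "r \<in> R"
  have R: "\<forall>\<sigma>\<in>subs. \<forall>(\<Phi>, \<psi>)\<in>R. \<sigma> ` \<Phi> \<subseteq> T \<longrightarrow> \<sigma> \<psi> \<in> T"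
    using assms(1) by (simp add: thy_def)
  show "case r of (\<Phi>, \<psi>) \<Rightarrow> \<tau> ` \<Phi> \<subseteq> {\<phi>. \<sigma> \<phi> \<in> T} \<longrightarrow> \<tau> \<psi> \<in> {\<phi>. \<sigma> \<phi> \<in> T}"
  proof (cases r)
    case (Pair \<Phi> \<psi>)
    have "(\<sigma> \<circ> \<tau>) ` \<Phi> \<subseteq> T \<longrightarrow> (\<sigma> \<circ> \<tau>) \<psi> \<in> T"
      using bspec[OF bspec[OF R subs_comp[OF assms(2) \<tau>]] r] unfolding Pair prod.case .
    then show ?thesis unfolding Pair prod.case by (simp only: image_subset_iff o_apply mem_Collect_eq)
  qed
qed

lemma consequence_relation_closed_sets:
  "consequence_relation (\<lambda>\<Phi> \<psi>. \<forall>T. C T \<longrightarrow> \<Phi> \<subseteq> T \<longrightarrow> \<psi> \<in> T)"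
  unfolding consequence_relation_def by (intro conjI allI impI; blast)

lemma gen_logic: "dm_logic (gen R)"
proof -
  have "gen R (\<sigma> ` \<Phi>) (\<sigma> \<psi>)" if "\<sigma> \<in> subs" "gen R \<Phi> \<psi>" for \<sigma> \<Phi> \<psi>
    unfolding gen_def
  proof (intro allI impI)
    fix T assume "thy R T" "\<sigma> ` \<Phi> \<subseteq> T"
    moreover from this(1) have "thy R {\<phi>. \<sigma> \<phi> \<in> T}" using thy_preimage that(1) by blast
    moreover have "\<Phi> \<subseteq> {\<phi>. \<sigma> \<phi> \<in> T}" using \<open>\<sigma> ` \<Phi> \<subseteq> T\<close> by auto
    ultimately show "\<sigma> \<psi> \<in> T" using that(2) by (auto simp: gen_def)
  qed
  moreover have "gen R = (\<lambda>\<Phi> \<psi>. \<forall>T. thy R T \<longrightarrow> \<Phi> \<subseteq> T \<longrightarrow> \<psi> \<in> T)"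
    by (intro ext) (simp add: gen_def)
  ultimately show ?thesis
    using consequence_relation_closed_sets[of "thy R"] by (simp add: dm_logic_def)
qed

lemma gen_belnap: "belnap \<le> gen R"
  unfolding gen_def thy_def by auto

lemma gen_rule: "(\<Phi>, \<psi>) \<in> R \<Longrightarrow> gen R \<Phi> \<psi>"
proof -
  assume r: "(\<Phi>, \<psi>) \<in> R"
  have id: "id \<in> subs" unfolding dm_hom_Fm_iff by (simp add: dm_Fm_def)
  show ?thesis unfolding gen_def
  proof (intro allI impI)
    fix T assume "thy R T" "\<Phi> \<subseteq> T"
    then have "\<forall>\<sigma>\<in>subs. \<forall>(\<Phi>, \<psi>)\<in>R. \<sigma> ` \<Phi> \<subseteq> T \<longrightarrow> \<sigma> \<psi> \<in> T"
      by (simp add: thy_def)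
    from bspec[OF bspec[OF this id] r] show "\<psi> \<in> T" using \<open>\<Phi> \<subseteq> T\<close> by simp
  qed
qed

lemma gen_mono: "R \<subseteq> S \<Longrightarrow> gen R \<le> gen S"
proof (intro le_funI le_boolI)
  fix \<Phi> \<psi> assume "R \<subseteq> S" "gen R \<Phi> \<psi>"
  moreover have "thy R T" if "thy S T" for T
    using that \<open>R \<subseteq> S\<close> unfolding thy_def by (meson subsetD)
  ultimately show "gen S \<Phi> \<psi>" by (simp add: gen_def)
qed

lemma gen_least:
  assumes L: "dm_logic L" "belnap \<le> L" and R: "\<And>\<Phi> \<psi>. (\<Phi>, \<psi>) \<in> R \<Longrightarrow> L \<Phi> \<psi>"
  shows "gen R \<le> L"
proof (intro le_funI le_boolI)
  fix \<Phi> \<psi> assume g: "gen R \<Phi> \<psi>"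
  have cr: "consequence_relation L" using L by (simp add: dm_logic_def)
  have cut: "L \<Phi> \<chi>" if "L \<Psi> \<chi>" "\<Psi> \<subseteq> {\<chi>. L \<Phi> \<chi>}" for \<Psi> \<chi>
  proof -
    have "\<forall>\<psi>\<in>\<Psi>. L \<Phi> \<psi>" using that(2) by auto
    with that(1) cr[unfolded consequence_relation_def, THEN conjunct2, THEN conjunct2]
    show ?thesis by metis
  qed
  have "thy R {\<chi>. L \<Phi> \<chi>}" unfolding thy_def
  proof (intro conjI allI ballI impI)
    fix \<Psi> \<chi> assume "belnap \<Psi> \<chi>" "\<Psi> \<subseteq> {\<chi>. L \<Phi> \<chi>}"
    moreover from this(1) L(2) have "L \<Psi> \<chi>" by (auto simp: le_fun_def)
    ultimately show "\<chi> \<in> {\<chi>. L \<Phi> \<chi>}" using cut[of \<Psi> \<chi>] by simp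
  next
    fix \<sigma> r assume "\<sigma> \<in> subs" "r \<in> R"
    then show "case r of (\<Psi>, \<chi>) \<Rightarrow> \<sigma> ` \<Psi> \<subseteq> {\<chi>. L \<Phi> \<chi>} \<longrightarrow> \<sigma> \<chi> \<in> {\<chi>. L \<Phi> \<chi>}"
    proof (cases r)
      case (Pair \<Psi> \<chi>)
      then have "L (\<sigma> ` \<Psi>) (\<sigma> \<chi>)"
        using L(1) R \<open>\<sigma> \<in> subs\<close> \<open>r \<in> R\<close> unfolding dm_logic_def by simp
      then show ?thesis unfolding Pair prod.case using cut by blast
    qed
  qed
  moreover have "\<Phi> \<subseteq> {\<chi>. L \<Phi> \<chi>}" using conjunct1[OF cr[unfolded consequence_relation_def]] by blast
  ultimately show "L \<Phi> \<psi>" using g by (auto simp: gen_def)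
qed

lemma thy_model:
  assumes "thy R T" "\<chi> \<notin> T" shows "nontrivial_model (gen R) (dm_Fm, T)"
proof -
  have "gen R \<le> dm_matrix_conseq (dm_Fm, T)"
  proof (intro le_funI le_boolI)
    fix \<Phi> \<psi> assume g: "gen R \<Phi> \<psi>"
    show "dm_matrix_conseq (dm_Fm, T) \<Phi> \<psi>" unfolding dm_matrix_conseq_def
    proof (intro ballI impI)
      fix h assume h: "h \<in> dm_hom dm_Fm (fst (dm_Fm, T))" "h ` \<Phi> \<subseteq> snd (dm_Fm, T)"
      then have "thy R {\<phi>. h \<phi> \<in> T}" "\<Phi> \<subseteq> {\<phi>. h \<phi> \<in> T}"
        using thy_preimage[OF assms(1)] by auto
      then show "h \<psi> \<in> snd (dm_Fm, T)" using g by (auto simp: gen_def)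
    qed
  qed
  then show ?thesis using assms(2) dm_algebra_Fm
    by (auto simp: nontrivial_model_def dm_Fm_def)
qed

subsection \<open>Colouring formulas of odd cycles\<close>

definition adj :: "nat \<Rightarrow> nat \<Rightarrow> nat \<Rightarrow> bool" where
  "adj m c d \<longleftrightarrow> d = (c + 1) mod m \<or> c = (d + 1) mod m"

definition u :: "nat \<Rightarrow> nat \<Rightarrow> nat" where "u n c = Suc (prod_encode (n, c))"

definition tile :: "nat \<Rightarrow> nat \<Rightarrow> dm_form" where
  "tile n c = foldr DAnd (map (\<lambda>d. DNeg (DVar (u n d))) (filter (\<lambda>d. \<not> adj (2*n+3) c d) [0..<2*n+3]))
     (DVar (u n c))"

definition \<gamma> :: "nat \<Rightarrow> dm_form" where
  "\<gamma> n = foldr DOr (map (tile n) [0..<2*n+3]) (tile n 0)"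

definition plus :: "four \<Rightarrow> bool" where "plus x \<longleftrightarrow> x \<in> {TT, NN}"
definition minus :: "four \<Rightarrow> bool" where "minus x \<longleftrightarrow> x \<in> {TT, BB}"

lemma pm_four:
  "plus (four_and x y) \<longleftrightarrow> plus x \<and> plus y" "minus (four_and x y) \<longleftrightarrow> minus x \<and> minus y"
  "plus (four_or x y) \<longleftrightarrow> plus x \<or> plus y" "minus (four_or x y) \<longleftrightarrow> minus x \<or> minus y"
  "plus (four_neg x) \<longleftrightarrow> \<not> minus x" "minus (four_neg x) \<longleftrightarrow> \<not> plus x"
  "plus TT" "minus TT" "\<not> plus FF" "\<not> minus FF" "minus BB" "\<not> plus BB" "plus NN" "\<not> minus NN"
  by (cases x; cases y; simp add: plus_def minus_def)+

lemma TT_iff: "x = TT \<longleftrightarrow> plus x \<and> minus x"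
  by (cases x) (auto simp: plus_def minus_def)

lemma ev_simps:
  "ev v (DAnd \<phi> \<psi>) = four_and (ev v \<phi>) (ev v \<psi>)" "ev v (DOr \<phi> \<psi>) = four_or (ev v \<phi>) (ev v \<psi>)"
  "ev v (DNeg \<phi>) = four_neg (ev v \<phi>)" "ev v DTop = TT" "ev v DBot = FF"
  by (simp_all add: DM4_def)

lemma pm_foldr:
  "plus (ev v (foldr DAnd xs y)) \<longleftrightarrow> (\<forall>x\<in>set xs. plus (ev v x)) \<and> plus (ev v y)"
  "minus (ev v (foldr DAnd xs y)) \<longleftrightarrow> (\<forall>x\<in>set xs. minus (ev v x)) \<and> minus (ev v y)"
  "plus (ev v (foldr DOr xs y)) \<longleftrightarrow> (\<exists>x\<in>set xs. plus (ev v x)) \<or> plus (ev v y)"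
  "minus (ev v (foldr DOr xs y)) \<longleftrightarrow> (\<exists>x\<in>set xs. minus (ev v x)) \<or> minus (ev v y)"
  by (induction xs) (auto simp: ev_simps pm_four simp del: dm_ev.simps)

lemma ev_tile:
  "plus (ev v (tile n c)) \<longleftrightarrow>
     plus (v (u n c)) \<and> (\<forall>d<2*n+3. \<not> adj (2*n+3) c d \<longrightarrow> \<not> minus (v (u n d)))"
  "minus (ev v (tile n c)) \<longleftrightarrow>
     minus (v (u n c)) \<and> (\<forall>d<2*n+3. \<not> adj (2*n+3) c d \<longrightarrow> \<not> plus (v (u n d)))"
  unfolding tile_def pm_foldr by (auto simp: ev_simps(3) pm_four simp del: dm_ev.simps(4))

lemma ev_\<gamma>:
  "plus (ev v (\<gamma> n)) \<longleftrightarrow> (\<exists>c<2*n+3. plus (ev v (tile n c)))"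
  "minus (ev v (\<gamma> n)) \<longleftrightarrow> (\<exists>c<2*n+3. minus (ev v (tile n c)))"
  unfolding \<gamma>_def pm_foldr set_map set_upt by (auto, (rule exI[of _ 0], simp)+)

subsection \<open>Valuations on odd cycles\<close>

definition good :: "nat \<Rightarrow> (int \<Rightarrow> nat \<Rightarrow> four) \<Rightarrow> bool" where
  "good N e \<longleftrightarrow> (\<forall>k. e (k + int N) = e k) \<and>
     (\<forall>k x. minus (e k x) \<longrightarrow> plus (e (k + 1) x)) \<and> (\<forall>k x. minus (e (k + 1) x) \<longrightarrow> plus (e k x))"

definition Th :: "(int \<Rightarrow> nat \<Rightarrow> four) \<Rightarrow> dm_form set" where
  "Th e = {\<phi>. \<forall>k. ev (e k) \<phi> = TT}"

lemma good_ev: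
  assumes "good N e"
  shows "(minus (ev (e k) \<phi>) \<longrightarrow> plus (ev (e (k + 1)) \<phi>)) \<and>
         (minus (ev (e (k + 1)) \<phi>) \<longrightarrow> plus (ev (e k) \<phi>))"
proof (induction \<phi>)
  case (DVar x)
  then show ?case using assms by (auto simp: good_def)
qed (auto simp: ev_simps pm_four simp del: dm_ev.simps)

lemma good_subs:
  assumes "good N e" shows "good N (\<lambda>k x. ev (e k) (\<sigma> (DVar x)))"
  using assms good_ev[OF assms] by (auto simp: good_def)

lemma good_walk:
  assumes e: "good N e" and \<gamma>: "\<And>k. ev (e k) (\<gamma> n) = TT"
  obtains f where "\<And>k. f k < 2*n+3" "\<And>k. adj (2*n+3) (f (k + 1)) (f k)" "\<And>k. f (k + int N) = f k"
    "\<And>k. minus (e k (u n (f k)))" "\<And>k. \<not> plus (e k (u n (f k))) \<or> adj (2*n+3) (f k) (f k)"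
proof -
  define P where "P v c \<longleftrightarrow> c < 2*n+3 \<and> minus (ev v (tile n c))" for v c
  define f where "f k = (SOME c. P (e k) c)" for k
  have P: "P (e k) (f k)" for k
    unfolding f_def by (rule someI_ex) (use \<gamma>[of k] in \<open>auto simp: TT_iff ev_\<gamma> P_def\<close>)
  have "f (k + int N) = f k" for k using e by (simp add: f_def good_def)
  moreover have "adj (2*n+3) (f (k + 1)) (f k)" for k
  proof (rule ccontr)
    assume "\<not> ?thesis"
    then have "\<not> plus (e (k + 1) (u n (f k)))"
      using P[of k] P[of "k + 1"] by (auto simp: P_def ev_tile)
    moreover have "minus (e k (u n (f k)))" using P[of k] by (auto simp: P_def ev_tile)
    ultimately show False using e by (auto simp: good_def)
  qed
  ultimately show ?thesis using that[of f] P by (auto simp: P_def ev_tile)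
qed

lemma no_short_odd_walk:
  fixes f :: "int \<Rightarrow> nat"
  assumes f: "\<And>k. f k < m" "\<And>k. adj m (f (k + 1)) (f k)" "\<And>k. f (k + int N) = f k"
    and N: "odd N" "N < m"
  shows False
proof -
  have "\<exists>\<delta>\<in>{1, -1}. int m dvd int (f (k + 1)) - int (f k) - \<delta>" for k
  proof -
    consider "f k = (f (k + 1) + 1) mod m" | "f (k + 1) = (f k + 1) mod m"
      using f(2)[of k] by (auto simp: adj_def)
    then show ?thesis
    proof cases
      case 1
      then have "int (f k) = (int (f (k + 1)) + 1) mod int m" by (simp add: zmod_int add.commute)
      then have "int m dvd (int (f (k + 1)) + 1) - int (f k)"
        by (metis dvd_minus_mod)
      then have "int m dvd int (f (k + 1)) - int (f k) - (-1)" by (simp add: algebra_simps)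
      then show ?thesis by blast
    next
      case 2
      then have "int (f (k + 1)) = (int (f k) + 1) mod int m" by (simp add: zmod_int add.commute)
      then have "int m dvd (int (f k) + 1) - int (f (k + 1))"
        by (metis dvd_minus_mod)
      then have "int m dvd - ((int (f k) + 1) - int (f (k + 1)))" by (rule dvd_minus_iff[THEN iffD2])
      then have "int m dvd int (f (k + 1)) - int (f k) - 1" by (simp add: algebra_simps)
      then show ?thesis by blast
    qed
  qed
  then obtain \<delta> where \<delta>: "\<And>k. \<delta> k \<in> {1, -1 :: int}"
    "\<And>k. int m dvd int (f (k + 1)) - int (f k) - \<delta> k" by metis
  define S where "S j = (\<Sum>k<j. \<delta> (int k))" for j
  have "int m dvd int (f (int j)) - int (f 0) - S j \<and> \<bar>S j\<bar> \<le> int j \<and> (odd (S j) \<longleftrightarrow> odd j)" for j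
  proof (induction j)
    case (Suc j)
    have "int m dvd (int (f (int j)) - int (f 0) - S j) + (int (f (int j + 1)) - int (f (int j)) - \<delta> (int j))"
      using Suc \<delta>(2)[of "int j"] by (intro dvd_add) auto
    moreover have "int (Suc j) = int j + 1" by simp
    ultimately have "int m dvd int (f (int (Suc j))) - int (f 0) - S (Suc j)"
      by (simp add: S_def algebra_simps)
    then show ?case using Suc \<delta>(1)[of "int j"] by (auto simp: S_def)
  qed (simp add: S_def)
  from this[of N] have S: "int m dvd S N" "\<bar>S N\<bar> \<le> int N" "odd (S N)"
    using f(3)[of 0] N by (auto simp: dvd_diff_commute)
  have "S N = 0" by (rule ccontr) (use S(1,2) N dvd_imp_le_int[of "S N" "int m"] in auto)
  then show False using S by simp
qed

lemma no_\<gamma>: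
  assumes "good (2*i+3) e" "n > i" shows "\<not> (\<forall>k. ev (e k) (\<gamma> n) = TT)"
proof
  assume "\<forall>k. ev (e k) (\<gamma> n) = TT"
  then obtain f where "\<And>k. f k < 2*n+3" "\<And>k. adj (2*n+3) (f (k + 1)) (f k)"
    "\<And>k. f (k + int (2*i+3)) = f k"
    using good_walk[OF assms(1)] by metis
  then show False using no_short_odd_walk[of f "2*n+3" "2*i+3"] assms(2) by simp
qed

lemma adj_irrefl: "c < 2*n+3 \<Longrightarrow> \<not> adj (2*n+3) c c"
proof -
  assume c: "c < 2*n+3"
  show ?thesis
  proof (cases "c + 1 = 2*n+3")
    case True
    then have e: "(c + 1) mod (2*n+3) = 0" by (metis mod_self)
    show ?thesis unfolding adj_def e using True by simp
  next
    case False
    then have e: "(c + 1) mod (2*n+3) = c + 1" using c by (intro mod_less) linarith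
    show ?thesis unfolding adj_def e by simp
  qed
qed

definition prem2 :: dm_form where
  "prem2 = DAnd (\<gamma> 0) (DOr (DVar (u 0 0)) (DNeg (DVar (u 0 0))))"

lemma no_prem2:
  assumes e: "good (2*i+3) e" shows "\<not> (\<forall>k. ev (e k) prem2 = TT)"
proof
  assume p: "\<forall>k. ev (e k) prem2 = TT"
  have g: "ev (e k) (\<gamma> 0) = TT" for k
    using p by (simp add: prem2_def TT_iff ev_simps pm_four del: dm_ev.simps)
  obtain f where f: "\<And>k. f k < 2*0+3" "\<And>k. adj (2*0+3) (f (k + 1)) (f k)"
    "\<And>k. f (k + int (2*i+3)) = f k" "\<And>k. minus (e k (u 0 (f k)))"
    "\<And>k. \<not> plus (e k (u 0 (f k))) \<or> adj (2*0+3) (f k) (f k)"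
    by (rule good_walk[OF e g]) (rule that)
  have irr: "\<not> adj 3 c c" if "c < 3" for c
    using that adj_irrefl[of c 0] by simp
  have nz: "f k \<noteq> 0" for k
  proof
    assume "f k = 0"
    then have "minus (e k (u 0 0))" "\<not> plus (e k (u 0 0))" using f(4,5)[of k] irr by auto
    moreover have "ev (e k) (DOr (DVar (u 0 0)) (DNeg (DVar (u 0 0)))) = TT"
      using p by (simp add: prem2_def TT_iff ev_simps pm_four del: dm_ev.simps)
    ultimately show False by (simp add: TT_iff ev_simps pm_four del: dm_ev.simps(3,4))
  qed
  have ne: "f (k + 1) \<noteq> f k" for k using f(1,2)[of k] irr[of "f k"] by (metis add_0 mult_0_right)
  have step: "f (k + 1) = 3 - f k" for k
  proof -
    have "f (k + 1) < 3" "f k < 3" using f(1)[of k] f(1)[of "k + 1"] by simp_all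
    then show ?thesis using nz[of k] nz[of "k + 1"] ne[of k] by arith
  qed
  have "f (int (2*j)) = f 0" for j
  proof (induction j)
    case (Suc j)
    have "f (int (2 * Suc j)) = f ((int (2*j) + 1) + 1)" by (simp add: algebra_simps)
    also have "\<dots> = 3 - (3 - f (int (2*j)))" by (simp only: step)
    also have "\<dots> = f (int (2*j))" using f(1)[of "int (2*j)"] by simp
    finally show ?case using Suc by simp
  qed simp
  then have "f (int (2*(i+1)) + 1) = 3 - f 0" by (simp only: step)
  moreover have "int (2*(i+1)) + 1 = 0 + int (2*i+3)" by simp
  ultimately have "f 0 = 3 - f 0" using f(3)[of 0] by metis
  then show False by presburger
qed

definition cyc :: "nat \<Rightarrow> nat \<Rightarrow> int \<Rightarrow> nat" where
  "cyc i n k = (let j = nat (k mod (2 * int i + 3)) in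
     if j \<le> 2*n+2 then j else if even j then 2*n+2 else 2*n+1)"

definition ex :: "nat \<Rightarrow> int \<Rightarrow> nat \<Rightarrow> four" where
  "ex i k x = (case x of 0 \<Rightarrow> TT | Suc y \<Rightarrow> (case prod_decode y of (n, c) \<Rightarrow>
     if n \<le> i then
       if cyc i n k = c then BB else if adj (2*n+3) c (cyc i n k) then NN else FF
     else TT))"

lemma ex_u: "ex i k (u n c) = (if n \<le> i then
     if cyc i n k = c then BB else if adj (2*n+3) c (cyc i n k) then NN else FF else TT)"
  by (simp add: ex_def u_def)

lemma cyc_lt: "cyc i n k < 2*n+3" by (simp add: cyc_def Let_def)

lemma adj_sym: "adj m c d = adj m d c" by (auto simp: adj_def)

lemma cyc_adj:
  assumes "n \<le> i" shows "adj (2*n+3) (cyc i n k) (cyc i n (k + 1))"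
proof -
  define M where "M = 2 * int i + 3"
  define j where "j = nat (k mod M)"
  have M: "M > 0" by (simp add: M_def)
  have j: "int j = k mod M" "int j < M" using M by (simp_all add: j_def)
  have c1: "cyc i n (k + 1) = (let j = nat ((k + 1) mod M) in
     if j \<le> 2*n+2 then j else if even j then 2*n+2 else 2*n+1)" by (simp add: cyc_def M_def)
  have c0: "cyc i n k = (if j \<le> 2*n+2 then j else if even j then 2*n+2 else 2*n+1)"
    by (simp add: cyc_def M_def j_def)
  have s: "(k + 1) mod M = (int j + 1) mod M" by (simp add: j mod_simps)
  show ?thesis
  proof (cases "int j + 1 = M")
    case True
    then have "cyc i n (k + 1) = 0" using c1 s by simp
    moreover have "j = 2*i+2" using True by (simp add: M_def)
    then have "cyc i n k = 2*n+2" using c0 assms by auto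
    moreover have "(2*n+2+1) mod (2*n+3) = 0"
    proof -
      have "2*n+2+1 = 2*n+3" by simp
      then show ?thesis by (metis mod_self)
    qed
    ultimately show ?thesis unfolding adj_def by metis
  next
    case False
    then have "nat ((k + 1) mod M) = j + 1" using s j by simp
    then have c1: "cyc i n (k + 1) = (if j + 1 \<le> 2*n+2 then j + 1 else if even (j+1) then 2*n+2 else 2*n+1)"
      using c1 by (simp only: Let_def)
    have e: "(2*n+1+1) mod (2*n+3) = 2*n+2" by (subst mod_less) simp_all
    consider "j + 1 \<le> 2*n+2" | "j = 2*n+2" | "j > 2*n+2" by linarith
    then show ?thesis
    proof cases
      case 1
      then have "(j + 1) mod (2*n+3) = j + 1" by (intro mod_less) linarith
      moreover have "cyc i n k = j" "cyc i n (k + 1) = j + 1" using 1 c0 c1 by simp_all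
      ultimately show ?thesis unfolding adj_def by metis
    next
      case 2
      then have "cyc i n k = 2*n+2" "cyc i n (k + 1) = 2*n+1" using c0 c1 by simp_all
      then show ?thesis unfolding adj_def using e by metis
    next
      case 3
      then have "cyc i n k = 2*n+2 \<and> cyc i n (k + 1) = 2*n+1 \<or>
        cyc i n k = 2*n+1 \<and> cyc i n (k + 1) = 2*n+2" using c0 c1 by simp
      then show ?thesis unfolding adj_def using e by metis
    qed
  qed
qed

lemma good_ex: "good (2*i+3) (ex i)"
proof -
  have c: "cyc i n (k + int (2*i+3)) = cyc i n k" for n k
    by (simp add: cyc_def algebra_simps)
  have "ex i (k + int (2*i+3)) = ex i k" for k
    unfolding ex_def c by simp
  moreover have "minus (ex i k x) \<longrightarrow> plus (ex i k' x)" if "k' = k + 1 \<or> k = k' + 1" for k k' x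
  proof (cases x)
    case 0
    then show ?thesis by (simp add: ex_def pm_four)
  next
    case (Suc y)
    obtain n c where nc: "prod_decode y = (n, c)" by fastforce
    then have x: "x = u n c" using Suc by (metis prod_decode_inverse u_def)
    show ?thesis
    proof (cases "n \<le> i")
      case True
      then have "adj (2*n+3) (cyc i n k) (cyc i n k')"
        using that cyc_adj adj_sym by blast
      moreover have "\<not> adj (2*n+3) (cyc i n k) (cyc i n k)" by (rule adj_irrefl[OF cyc_lt])
      ultimately show ?thesis using True by (auto simp: x ex_u pm_four)
    qed (simp add: x ex_u pm_four)
  qed
  ultimately show ?thesis unfolding good_def by blast
qed

lemma ex_\<gamma>:
  assumes "n \<le> i" shows "ev (ex i k) (\<gamma> n) = TT"
proof -
  let ?c = "cyc i n k" and ?d = "cyc i n (k + 1)"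
  have a: "adj (2*n+3) ?c ?d" using cyc_adj assms by simp
  have "?d \<noteq> ?c" using a adj_irrefl[OF cyc_lt] by metis
  then have "plus (ev (ex i k) (tile n ?d))"
    using assms a by (auto simp: ev_tile ex_u pm_four adj_sym)
  moreover have "minus (ev (ex i k) (tile n ?c))"
    using assms by (auto simp: ev_tile ex_u pm_four adj_sym)
  ultimately show ?thesis using cyc_lt by (auto simp: TT_iff ev_\<gamma>)
qed

subsection \<open>Two logics and their theories\<close>

definition R1 :: rules where
  "R1 = {(range \<gamma>, DOr (DVar (u 0 0)) (DNeg (DVar (u 0 0))))}"
definition R2 :: rules where "R2 = {({prem2}, DVar 0)}"

lemma Th_subs: "\<sigma> \<in> subs \<Longrightarrow> \<sigma> \<phi> \<in> Th e \<longleftrightarrow> (\<forall>k. ev (\<lambda>x. ev (e k) (\<sigma> (DVar x))) \<phi> = TT)"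
proof -
  assume "\<sigma> \<in> subs"
  then have "ev v (\<sigma> \<phi>) = ev (\<lambda>x. ev v (\<sigma> (DVar x))) \<phi>" for v by (rule ev_subs)
  then show ?thesis unfolding Th_def mem_Collect_eq by simp
qed

lemma Th_no_prem2: "good (2*i+3) e \<Longrightarrow> \<sigma> \<in> subs \<Longrightarrow> \<sigma> prem2 \<notin> Th e"
  unfolding Th_subs using no_prem2[OF good_subs] by blast

lemma thy_Th:
  assumes "good (2*i+3) e" shows "thy (R1 \<union> R2) (Th e)"
  unfolding thy_def
proof (intro conjI allI ballI impI)
  fix \<Phi> \<psi> assume b: "belnap \<Phi> \<psi>" "\<Phi> \<subseteq> Th e"
  have "ev (e k) \<psi> = TT" for k
    by (rule belnap_TT[OF b(1)]) (use b(2) in \<open>auto simp: Th_def\<close>)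
  then show "\<psi> \<in> Th e" by (simp add: Th_def)
next
  fix \<sigma> r assume \<sigma>: "\<sigma> \<in> subs" and r: "r \<in> R1 \<union> R2"
  have "\<not> \<sigma> ` range \<gamma> \<subseteq> Th e"
  proof
    assume "\<sigma> ` range \<gamma> \<subseteq> Th e"
    then have "\<sigma> (\<gamma> (Suc i)) \<in> Th e" by blast
    then show False using no_\<gamma>[OF good_subs[OF assms]] Th_subs[OF \<sigma>] by blast
  qed
  moreover have "\<sigma> prem2 \<notin> Th e" using Th_no_prem2 assms \<sigma> by blast
  ultimately show "case r of (\<Phi>, \<psi>) \<Rightarrow> \<sigma> ` \<Phi> \<subseteq> Th e \<longrightarrow> \<sigma> \<psi> \<in> Th e"
    using r by (auto simp: R1_def R2_def)
qed

definition lp :: "nat \<Rightarrow> four" where "lp x = (if x = 0 then FF else BB)"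

definition Tlp :: "dm_form set" where "Tlp = {\<phi>. ev lp \<phi> \<in> {BB, TT}}"

lemma ev_not_NN: "(\<And>x. v x \<noteq> NN) \<Longrightarrow> ev v \<phi> \<noteq> NN"
proof (induction \<phi>)
  case (DAnd \<phi> \<psi>)
  then show ?case by (cases "ev v \<phi>"; cases "ev v \<psi>") (simp_all add: DM4_def)
next
  case (DOr \<phi> \<psi>)
  then show ?case by (cases "ev v \<phi>"; cases "ev v \<psi>") (simp_all add: DM4_def)
next
  case (DNeg \<phi>)
  then show ?case by (cases "ev v \<phi>") (simp_all add: DM4_def)
qed (simp_all add: DM4_def)

lemma thy_Tlp: "thy R1 Tlp"
  unfolding thy_def
proof (intro conjI allI ballI impI)
  fix \<Phi> \<psi> assume "belnap \<Phi> \<psi>" "\<Phi> \<subseteq> Tlp"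
  then show "\<psi> \<in> Tlp" unfolding belnap_iff Tlp_def by blast
next
  fix \<sigma> r assume \<sigma>: "\<sigma> \<in> subs" and r: "r \<in> R1"
  have "ev lp (\<sigma> (DVar (u 0 0))) \<noteq> NN" by (rule ev_not_NN) (simp add: lp_def)
  then have "\<sigma> (DOr (DVar (u 0 0)) (DNeg (DVar (u 0 0)))) \<in> Tlp"
    using \<sigma> unfolding dm_hom_Fm_iff Tlp_def
    by (cases "ev lp (\<sigma> (DVar (u 0 0)))") (simp_all add: dm_Fm_def DM4_def)
  then show "case r of (\<Phi>, \<psi>) \<Rightarrow> \<sigma> ` \<Phi> \<subseteq> Tlp \<longrightarrow> \<sigma> \<psi> \<in> Tlp"
    using r by (auto simp: R1_def)
qed

definition Z :: "dm_form set" where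
  "Z = Tlp \<inter> {\<phi>. \<exists>N. \<forall>i\<ge>N. \<phi> \<in> Th (ex i)}"

lemma limit_valuation:
  fixes v :: "nat \<Rightarrow> nat \<Rightarrow> four"
  assumes "infinite I"
  obtains w where "\<And>N. infinite {i \<in> I. \<forall>x<N. v i x = w x}"
proof -
  define pick where "pick J n = (SOME a. infinite {i \<in> J. v i n = a})" for J n
  define J where "J = rec_nat I (\<lambda>n J. {i \<in> J. v i n = pick J n})"
  have J: "J 0 = I" "J (Suc n) = {i \<in> J n. v i n = pick (J n) n}" for n
    by (simp_all add: J_def)
  have fin: "finite (UNIV :: four set)"
  proof -
    have "(UNIV :: four set) = {FF, NN, BB, TT}" by (auto intro: four.exhaust)
    then show ?thesis by (metis finite.emptyI finite_insert)
  qed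
  have infJ: "infinite (J n)" for n
  proof (induction n)
    case (Suc n)
    have "\<exists>k\<in>J n. infinite {i \<in> J n. v i n = v k n}"
      by (rule pigeonhole_infinite[OF Suc finite_subset[OF subset_UNIV fin]])
    then have "\<exists>a. infinite {i \<in> J n. v i n = a}" by blast
    then show ?case unfolding J(2) pick_def by (rule someI_ex)
  qed (simp add: J assms)
  have sub: "J n \<subseteq> {i \<in> I. \<forall>x<n. v i x = pick (J x) x}" for n
    by (induction n) (auto simp: J less_Suc_eq)
  show ?thesis
    by (rule that[of "\<lambda>x. pick (J x) x"]) (rule infinite_super[OF sub infJ])
qed

lemma ev_bounded: "\<exists>N. \<forall>v w. (\<forall>x<N. v x = w x) \<longrightarrow> ev v \<phi> = ev w \<phi>"
proof (induction \<phi>)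
  case (DAnd \<phi> \<psi>)
  then obtain N M where "\<forall>v w. (\<forall>x<N. v x = w x) \<longrightarrow> ev v \<phi> = ev w \<phi>"
    "\<forall>v w. (\<forall>x<M. v x = w x) \<longrightarrow> ev v \<psi> = ev w \<psi>" by blast
  then show ?case by (intro exI[of _ "max N M"] allI impI) (simp, metis less_max_iff_disj)
next
  case (DOr \<phi> \<psi>)
  then obtain N M where "\<forall>v w. (\<forall>x<N. v x = w x) \<longrightarrow> ev v \<phi> = ev w \<phi>"
    "\<forall>v w. (\<forall>x<M. v x = w x) \<longrightarrow> ev v \<psi> = ev w \<psi>" by blast
  then show ?case by (intro exI[of _ "max N M"] allI impI) (simp, metis less_max_iff_disj)
next
  case (DNeg \<phi>)
  then show ?case by (metis dm_ev.simps(4))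
next
  case (DVar x)
  show ?case by (rule exI[of _ "Suc x"]) simp
qed simp_all

lemma thy_Z: "thy R2 Z"
  unfolding thy_def
proof (intro conjI allI ballI impI)
  fix \<Phi> \<psi> assume b: "belnap \<Phi> \<psi>" "\<Phi> \<subseteq> Z"
  have "\<psi> \<in> Tlp" using b thy_Tlp unfolding thy_def Z_def by blast
  moreover have "\<exists>N. \<forall>i\<ge>N. \<psi> \<in> Th (ex i)"
  proof (rule ccontr)
    assume a: "\<not> ?thesis"
    define I where "I = {i. \<psi> \<notin> Th (ex i)}"
    have "infinite I" using a unfolding I_def infinite_nat_iff_unbounded_le by blast
    have "\<forall>i\<in>I. \<exists>k. ev (ex i k) \<psi> \<noteq> TT" by (auto simp: I_def Th_def)
    then obtain k where k: "\<And>i. i \<in> I \<Longrightarrow> ev (ex i (k i)) \<psi> \<noteq> TT" by metis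
    obtain w where w: "\<And>N. infinite {i \<in> I. \<forall>x<N. ex i (k i) x = w x}"
      by (rule limit_valuation[OF \<open>infinite I\<close>, of "\<lambda>i. ex i (k i)"]) (rule that)
    have lim: "\<exists>i\<ge>n. i \<in> I \<and> ev (ex i (k i)) \<phi> = ev w \<phi>" for \<phi> n
    proof -
      obtain N where N: "\<forall>v w. (\<forall>x<N. v x = w x) \<longrightarrow> ev v \<phi> = ev w \<phi>"
        using ev_bounded[of \<phi>] by blast
      obtain i where "i \<ge> n" "i \<in> I" "\<forall>x<N. ex i (k i) x = w x"
        using w[of N] unfolding infinite_nat_iff_unbounded_le by blast
      moreover have "ev (ex i (k i)) \<phi> = ev w \<phi>" using N[rule_format, of "ex i (k i)" w] calculation(3) by blast
      ultimately show ?thesis by blast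
    qed
    have "ev w \<phi> = TT" if \<phi>: "\<phi> \<in> \<Phi>" for \<phi>
    proof -
      obtain N where "\<forall>i\<ge>N. \<phi> \<in> Th (ex i)" using b(2) \<phi> unfolding Z_def by blast
      then show ?thesis using lim[of N \<phi>] by (auto simp: Th_def)
    qed
    then have "ev w \<psi> = TT" using belnap_TT b by blast
    then show False using lim[of 0 \<psi>] k by auto
  qed
  ultimately show "\<psi> \<in> Z" by (simp add: Z_def)
next
  fix \<sigma> r assume \<sigma>: "\<sigma> \<in> subs" and r: "r \<in> R2"
  have "\<sigma> prem2 \<notin> Z" using Th_no_prem2[OF good_ex \<sigma>] unfolding Z_def by blast
  then show "case r of (\<Phi>, \<psi>) \<Rightarrow> \<sigma> ` \<Phi> \<subseteq> Z \<longrightarrow> \<sigma> \<psi> \<in> Z"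
    using r by (auto simp: R2_def)
qed

lemma DBot_notin: "DBot \<notin> Th (ex i)" "DBot \<notin> Tlp" "DVar 0 \<notin> Tlp" "DBot \<notin> Z"
  by (auto simp: Th_def Tlp_def Z_def lp_def DM4_def)

subsection \<open>The failure of join preservation\<close>

primrec tr :: "dm_form \<Rightarrow> pp_form" where
  "tr (DVar x) = PVar (2*x+1)"
| "tr (DAnd \<phi> \<psi>) = PAnd (tr \<phi>) (tr \<psi>)"
| "tr (DOr \<phi> \<psi>) = POr (tr \<phi>) (tr \<psi>)"
| "tr (DNeg \<phi>) = PNeg (tr \<phi>)"
| "tr DTop = PTop"
| "tr DBot = PBot"

text \<open>\<open>guard j\<close> says that one of the first \<open>j\<close> even variables is the classical truth.\<close>

primrec guard :: "nat \<Rightarrow> pp_form" where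
  "guard 0 = PBot"
| "guard (Suc j) = POr (guard j) (PAnd (PCirc (PVar (2*j))) (PVar (2*j)))"

definition prem :: "nat \<Rightarrow> pp_form" where
  "prem j = POr (PAnd (PNeg (guard j)) (tr (\<gamma> j))) (PAnd (guard j) (PVar 1))"

definition \<Delta> :: "pp_form set" where
  "\<Delta> = range prem \<union> range (\<lambda>x. PNeg (PCirc (PVar (2*x+1))))"

primrec const_free :: "dm_form \<Rightarrow> bool" where
  "const_free (DVar x) \<longleftrightarrow> True"
| "const_free (DAnd \<phi> \<psi>) \<longleftrightarrow> const_free \<phi> \<and> const_free \<psi>"
| "const_free (DOr \<phi> \<psi>) \<longleftrightarrow> const_free \<phi> \<and> const_free \<psi>"
| "const_free (DNeg \<phi>) \<longleftrightarrow> const_free \<phi>"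
| "const_free DTop \<longleftrightarrow> False"
| "const_free DBot \<longleftrightarrow> False"

lemma const_free_foldr:
  "const_free (foldr DAnd xs y) \<longleftrightarrow> (\<forall>x\<in>set xs. const_free x) \<and> const_free y"
  "const_free (foldr DOr xs y) \<longleftrightarrow> (\<forall>x\<in>set xs. const_free x) \<and> const_free y"
  by (induction xs) auto

lemma const_free_\<gamma>: "const_free (\<gamma> n)"
  unfolding \<gamma>_def tile_def const_free_foldr by (auto simp: const_free_foldr)

lemma guard_hat:
  assumes h: "h \<in> pp_hom pp_Fm (circ_alg A)"
  shows "h (guard j) = (if \<exists>i<j. h (PVar (2*i)) = That then That else Fhat)"
proof (induction j)
  case (Suc j)
  have "h (guard (Suc j)) =
     hat_dis (dis A) (h (guard j)) (hat_con (con A) (hat_cir (h (PVar (2*j)))) (h (PVar (2*j))))"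
    using h by (simp add: pp_hom_Fm_iff circ_alg_def)
  then show ?case using Suc by (cases "h (PVar (2*j))") (auto simp: less_Suc_eq)
qed (use h in \<open>simp add: pp_hom_Fm_iff circ_alg_def\<close>)

lemma prem_hat:
  assumes h: "h \<in> pp_hom pp_Fm (circ_alg A)"
  shows "h (prem j) = (if \<exists>i<j. h (PVar (2*i)) = That then h (PVar 1) else h (tr (\<gamma> j)))"
proof -
  have "h (prem j) = hat_dis (dis A) (hat_con (con A) (hat_neg (neg A) (h (guard j))) (h (tr (\<gamma> j))))
     (hat_con (con A) (h (guard j)) (h (PVar 1)))"
    using h by (simp add: prem_def pp_hom_Fm_iff circ_alg_def)
  then show ?thesis using guard_hat[OF h, of j]
    by (cases "h (PVar 1)"; cases "h (tr (\<gamma> j))") (auto split: if_splits)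
qed

lemma tr_hat:
  assumes h: "h \<in> pp_hom pp_Fm (circ_alg A)" and v: "\<And>x. h (PVar (2*x+1)) = El (v x)"
  shows "const_free \<phi> \<Longrightarrow> h (tr \<phi>) = El (dm_ev A v \<phi>)"
proof (induction \<phi>)
  case (DVar x)
  then show ?case using v[of x] by simp
qed (use h in \<open>simp_all add: pp_hom_Fm_iff circ_alg_def\<close>)

abbreviation J :: "dm_form conseq" where "J \<equiv> gen (R1 \<union> R2)"

lemma J_q: "J (range \<gamma>) (DVar 0)"
  unfolding gen_def
proof (intro allI impI)
  fix T assume T: "thy (R1 \<union> R2) T" "range \<gamma> \<subseteq> T"
  have "gen (R1 \<union> R2) (range \<gamma>) (DOr (DVar (u 0 0)) (DNeg (DVar (u 0 0))))"
    "gen (R1 \<union> R2) {prem2} (DVar 0)"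
    by (rule gen_rule, simp add: R1_def R2_def)+
  then have *: "DOr (DVar (u 0 0)) (DNeg (DVar (u 0 0))) \<in> T" "prem2 \<in> T \<Longrightarrow> DVar 0 \<in> T"
    using T unfolding gen_def by auto
  have "belnap {\<gamma> 0, DOr (DVar (u 0 0)) (DNeg (DVar (u 0 0)))} prem2"
    unfolding belnap_iff
  proof (intro allI impI)
    fix v assume "\<forall>\<phi>\<in>{\<gamma> 0, DOr (DVar (u 0 0)) (DNeg (DVar (u 0 0)))}. ev v \<phi> \<in> {BB, TT}"
    then have "ev v (\<gamma> 0) \<in> {BB, TT}" "ev v (DOr (DVar (u 0 0)) (DNeg (DVar (u 0 0)))) \<in> {BB, TT}"
      by blast+
    then show "ev v prem2 \<in> {BB, TT}"
      unfolding prem2_def ev_simps(1) by auto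
  qed
  moreover have "{\<gamma> 0, DOr (DVar (u 0 0)) (DNeg (DVar (u 0 0)))} \<subseteq> T" using T(2) *(1) by blast
  ultimately have "prem2 \<in> T" using T(1) unfolding thy_def by blast
  then show "DVar 0 \<in> T" by (rule *(2))
qed

lemma circ_J: "circ TYPE('a) J \<Delta> (PVar 1)"
  unfolding circ_def pp_matrix_conseq_def
proof (intro allI impI ballI)
  fix M :: "'a dm_matrix" and h
  assume M: "nontrivial_model J M" and h: "h \<in> pp_hom pp_Fm (fst (circ_matrix M))"
    and h\<Delta>: "h ` \<Delta> \<subseteq> snd (circ_matrix M)"
  obtain A D where [simp]: "M = (A, D)" by (cases M)
  have h: "h \<in> pp_hom pp_Fm (circ_alg A)" using h by (simp add: circ_matrix_def)
  have h\<Delta>: "h \<delta> \<in> El ` D \<union> {That}" if "\<delta> \<in> \<Delta>" for \<delta>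
    using h\<Delta> that by (auto simp: circ_matrix_def)
  have pr: "h (prem j) \<in> El ` D \<union> {That}" for j using h\<Delta> by (simp add: \<Delta>_def)
  show "h (PVar 1) \<in> snd (circ_matrix M)"
  proof (cases "\<exists>i. h (PVar (2*i)) = That")
    case True
    then obtain i where "h (PVar (2*i)) = That" by blast
    then have "h (prem (Suc i)) = h (PVar 1)" using prem_hat[OF h] by auto
    then show ?thesis using pr[of "Suc i"] by (simp add: circ_matrix_def)
  next
    case False
    have "\<exists>a \<in> carrier A. h (PVar (2*x+1)) = El a" for x
    proof -
      have "h (PNeg (PCirc (PVar (2*x+1)))) \<in> El ` D \<union> {That}" by (rule h\<Delta>) (simp add: \<Delta>_def)
      then have "hat_neg (neg A) (hat_cir (h (PVar (2*x+1)))) \<in> El ` D \<union> {That}"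
        using h by (simp add: pp_hom_Fm_iff circ_alg_def)
      moreover have "h (PVar (2*x+1)) \<in> El ` carrier A \<union> {Fhat, That}"
        using h by (auto simp: pp_hom_Fm_iff circ_alg_def)
      ultimately show ?thesis by (cases "h (PVar (2*x+1))") auto
    qed
    then obtain v where v: "\<And>x. v x \<in> carrier A" "\<And>x. h (PVar (2*x+1)) = El (v x)" by metis
    have "h (prem j) = El (dm_ev A v (\<gamma> j))" for j
      using prem_hat[OF h, of j] False tr_hat[OF h v(2) const_free_\<gamma>] by auto
    then have "dm_ev A v ` range \<gamma> \<subseteq> D" using pr by force
    moreover have "dm_ev A v \<in> dm_hom dm_Fm A"
      using M v(1) by (intro dm_ev_hom) (auto simp: nontrivial_model_def)
    moreover have "dm_matrix_conseq (A, D) (range \<gamma>) (DVar 0)"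
      using J_q M by (auto simp: nontrivial_model_def le_fun_def)
    ultimately have "dm_ev A v (DVar 0) \<in> D"
      unfolding dm_matrix_conseq_def fst_conv snd_conv by blast
    then show ?thesis using v(2)[of 0] by (simp add: circ_matrix_def)
  qed
qed

primrec G :: "nat set \<Rightarrow> pp_form \<Rightarrow> dm_form hat" where
  "G S (PVar x) = (if even x then if x div 2 \<in> S then That else Fhat else El (DVar (x div 2)))"
| "G S (PAnd \<phi> \<psi>) = hat_con DAnd (G S \<phi>) (G S \<psi>)"
| "G S (POr \<phi> \<psi>) = hat_dis DOr (G S \<phi>) (G S \<psi>)"
| "G S (PNeg \<phi>) = hat_neg DNeg (G S \<phi>)"
| "G S PTop = That"
| "G S PBot = Fhat"
| "G S (PCirc \<phi>) = hat_cir (G S \<phi>)"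

lemma G_hom: "G S \<in> pp_hom pp_Fm (circ_alg dm_Fm)"
proof -
  have "x \<in> carrier (circ_alg dm_Fm)" for x by (cases x) (auto simp: circ_alg_def dm_Fm_def)
  then show ?thesis by (simp add: pp_hom_Fm_iff) (simp add: circ_alg_def dm_Fm_def)
qed

lemma G_eventually: "\<exists>N. \<forall>i\<ge>N. G {i} \<phi> = G {} \<phi>"
proof (induction \<phi>)
  case (PVar x)
  show ?case by (rule exI[of _ "Suc x"]) auto
next
  case (PAnd \<phi> \<psi>)
  then obtain N M where "\<forall>i\<ge>N. G {i} \<phi> = G {} \<phi>" "\<forall>i\<ge>M. G {i} \<psi> = G {} \<psi>" by blast
  then show ?case by (intro exI[of _ "max N M"]) simp
next
  case (POr \<phi> \<psi>)
  then obtain N M where "\<forall>i\<ge>N. G {i} \<phi> = G {} \<phi>" "\<forall>i\<ge>M. G {i} \<psi> = G {} \<psi>" by blast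
  then show ?case by (intro exI[of _ "max N M"]) simp
qed (metis G.simps)+

definition desig :: "dm_form set \<Rightarrow> dm_form hat set" where "desig T = El ` T \<union> {That}"

definition TT0 :: "pp_form set" where
  "TT0 = {\<tau>. (\<forall>i. G {i} \<tau> \<in> desig (Th (ex i))) \<and> G {} \<tau> \<in> desig Tlp}"

lemma circ_gen_desig:
  assumes c: "circ TYPE(dm_form) (gen R) \<Phi> \<psi>" and T: "thy R T" "\<chi> \<notin> T"
    and \<Phi>: "\<And>\<phi>. \<phi> \<in> \<Phi> \<Longrightarrow> G S \<phi> \<in> desig T"
  shows "G S \<psi> \<in> desig T"
proof -
  have "pp_matrix_conseq (circ_matrix (dm_Fm, T)) \<Phi> \<psi>"
    using c thy_model[OF T] by (auto simp: circ_def)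
  then show ?thesis using G_hom[of S] \<Phi>
    unfolding pp_matrix_conseq_def circ_matrix_def desig_def by auto
qed

lemma thy_mono: "R \<subseteq> S \<Longrightarrow> thy S T \<Longrightarrow> thy R T"
  unfolding thy_def by (meson subsetD)

lemma TT0_closed1:
  assumes c: "circ TYPE(dm_form) (gen R1) \<Phi> \<psi>" and \<Phi>: "\<Phi> \<subseteq> TT0"
  shows "\<psi> \<in> TT0"
proof -
  have "G {i} \<psi> \<in> desig (Th (ex i))" for i
    by (rule circ_gen_desig[OF c thy_mono[OF _ thy_Th[OF good_ex]] DBot_notin(1)])
      (use \<Phi> in \<open>auto simp: TT0_def\<close>)
  moreover have "G {} \<psi> \<in> desig Tlp"
    by (rule circ_gen_desig[OF c thy_Tlp DBot_notin(2)]) (use \<Phi> in \<open>auto simp: TT0_def\<close>)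
  ultimately show ?thesis by (simp add: TT0_def)
qed

lemma TT0_closed2:
  assumes c: "circ TYPE(dm_form) (gen R2) \<Phi> \<psi>" and \<Phi>: "\<Phi> \<subseteq> TT0"
  shows "\<psi> \<in> TT0"
proof -
  have "G {i} \<psi> \<in> desig (Th (ex i))" for i
    by (rule circ_gen_desig[OF c thy_mono[OF _ thy_Th[OF good_ex]] DBot_notin(1)])
      (use \<Phi> in \<open>auto simp: TT0_def\<close>)
  moreover have "G {} \<psi> \<in> desig Z"
  proof (rule circ_gen_desig[OF c thy_Z DBot_notin(4)])
    fix \<phi> assume "\<phi> \<in> \<Phi>"
    then have a: "G {i} \<phi> \<in> desig (Th (ex i))" "G {} \<phi> \<in> desig Tlp" for i
      using \<Phi> by (auto simp: TT0_def)
    obtain N where "\<forall>i\<ge>N. G {i} \<phi> = G {} \<phi>" using G_eventually by blast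
    then have "\<forall>i\<ge>N. G {} \<phi> \<in> desig (Th (ex i))" using a(1) by metis
    then show "G {} \<phi> \<in> desig Z" using a(2)
      by (cases "G {} \<phi>") (auto simp: desig_def Z_def)
  qed
  then have "G {} \<psi> \<in> desig Tlp" by (auto simp: desig_def Z_def)
  ultimately show ?thesis by (simp add: TT0_def)
qed

subsection \<open>The order-preserving logic\<close>

abbreviation H4 :: "four hat pp_alg" where "H4 \<equiv> circ_alg DM4"

lemma UNIV_hat: "(x :: four hat) \<in> {Fhat, That, El FF, El NN, El BB, El TT}"
proof (cases x)
  case (El a)
  then show ?thesis by (cases a) auto
qed auto

lemma all_hat: "(\<forall>x :: four hat. P x) \<longleftrightarrow>
    P Fhat \<and> P That \<and> P (El FF) \<and> P (El NN) \<and> P (El BB) \<and> P (El TT)"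
proof (intro iffI allI)
  fix x :: "four hat"
  assume "P Fhat \<and> P That \<and> P (El FF) \<and> P (El NN) \<and> P (El BB) \<and> P (El TT)"
  then show "P x" using UNIV_hat[of x] by auto
qed simp

lemma PP_H4: "PP_algebra H4"
proof -
  have c: "carrier H4 = UNIV" using UNIV_hat by (auto simp: circ_alg_def DM4_def)
  show ?thesis
    unfolding PP_algebra_def de_morgan_algebra_def pp_algebra_def dm_algebra_def c ball_UNIV
    by (simp add: all_hat circ_alg_def DM4_def)
qed

lemma map_hat_hom:
  assumes "g \<in> pp_hom pp_Fm (circ_alg dm_Fm)"
  shows "map_hat (ev v) \<circ> g \<in> pp_hom pp_Fm H4"
proof -
  have c: "x \<in> carrier H4" for x using UNIV_hat[of x] by (auto simp: circ_alg_def DM4_def)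
  have m: "map_hat (ev v) (hat_con DAnd x y) = hat_con four_and (map_hat (ev v) x) (map_hat (ev v) y)"
    "map_hat (ev v) (hat_dis DOr x y) = hat_dis four_or (map_hat (ev v) x) (map_hat (ev v) y)"
    "map_hat (ev v) (hat_neg DNeg x) = hat_neg four_neg (map_hat (ev v) x)"
    "map_hat (ev v) (hat_cir x) = hat_cir (map_hat (ev v) x)" for x y
    by (cases x; cases y; simp add: DM4_def)+
  show ?thesis using assms c
    by (simp add: pp_hom_Fm_iff) (simp add: circ_alg_def dm_Fm_def DM4_def m[unfolded DM4_def])
qed

lemma infinite_dm_form: "infinite (UNIV :: dm_form set)"
proof -
  have "inj DVar" by (simp add: inj_def)
  then show ?thesis by (rule infinite_super[OF subset_UNIV range_inj_infinite])
qed

lemma pp_leq_filter: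
  assumes l: "pp_leq TYPE(dm_form) \<Phi> \<psi>" and h: "h \<in> pp_hom pp_Fm H4"
    and F: "F = {That, El TT} \<or> F = {That, El TT, El BB}" and \<Phi>: "h ` \<Phi> \<subseteq> F"
  shows "h \<psi> \<in> F"
proof -
  obtain \<phi>s where \<phi>s: "set \<phi>s \<subseteq> \<Phi>" and
    v: "PP_valid TYPE(dm_form) (PBigAnd \<phi>s) (PAnd (PBigAnd \<phi>s) \<psi>)"
    using l unfolding pp_leq_def by blast
  from pp_leq_any_type[OF infinite_dm_form v, where 'b = "four hat"] PP_H4 h
  have e: "h (PBigAnd \<phi>s) = h (PAnd (PBigAnd \<phi>s) \<psi>)" unfolding PP_valid_def by blast
  have hc: "h (PAnd \<alpha> \<beta>) = hat_con four_and (h \<alpha>) (h \<beta>)" "h PTop = That" for \<alpha> \<beta>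
    using h by (simp_all add: pp_hom_Fm_iff circ_alg_def DM4_def)
  have F1: "That \<in> F" and F2: "\<forall>x y. x \<in> F \<longrightarrow> y \<in> F \<longrightarrow> hat_con four_and x y \<in> F"
    and F3: "\<forall>x y. hat_con four_and x y \<in> F \<longrightarrow> y \<in> F"
    using F by (elim disjE; simp add: all_hat)+
  have "set \<phi>s \<subseteq> \<Phi> \<Longrightarrow> h (PBigAnd \<phi>s) \<in> F"
    using F1 F2 \<Phi> by (induction \<phi>s) (auto simp: hc)
  then show ?thesis using \<phi>s e F3 by (metis hc(1))
qed

lemma TT0_closed3:
  assumes c: "pp_leq TYPE(dm_form) \<Phi> \<psi>" and \<Phi>: "\<Phi> \<subseteq> TT0"
  shows "\<psi> \<in> TT0"
proof -
  have "G {i} \<psi> \<in> desig (Th (ex i))" for i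
  proof -
    have d: "x \<in> desig (Th (ex i)) \<longleftrightarrow> (\<forall>k. map_hat (ev (ex i k)) x \<in> {That, El TT})" for x
      by (cases x) (auto simp: desig_def Th_def)
    show ?thesis unfolding d
    proof
      fix k
      have "(map_hat (ev (ex i k)) \<circ> G {i}) \<psi> \<in> {That, El TT}"
      proof (rule pp_leq_filter[OF c map_hat_hom[OF G_hom]])
        show "(map_hat (ev (ex i k)) \<circ> G {i}) ` \<Phi> \<subseteq> {That, El TT}"
          using \<Phi> d unfolding TT0_def by fastforce
      qed simp
      then show "map_hat (ev (ex i k)) (G {i} \<psi>) \<in> {That, El TT}" by simp
    qed
  qed
  moreover have "G {} \<psi> \<in> desig Tlp"
  proof -
    have d: "x \<in> desig Tlp \<longleftrightarrow> map_hat (ev lp) x \<in> {That, El TT, El BB}" for x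
      by (cases x) (auto simp: desig_def Tlp_def)
    have "(map_hat (ev lp) \<circ> G {}) \<psi> \<in> {That, El TT, El BB}"
    proof (rule pp_leq_filter[OF c map_hat_hom[OF G_hom]])
      show "(map_hat (ev lp) \<circ> G {}) ` \<Phi> \<subseteq> {That, El TT, El BB}"
        using \<Phi> d unfolding TT0_def by fastforce
    qed simp
    then show ?thesis unfolding d by simp
  qed
  ultimately show ?thesis by (simp add: TT0_def)
qed

lemma \<Delta>_TT0: "\<Delta> \<subseteq> TT0"
proof
  fix \<delta> assume "\<delta> \<in> \<Delta>"
  then consider j where "\<delta> = prem j" | x where "\<delta> = PNeg (PCirc (PVar (2*x+1)))"
    by (auto simp: \<Delta>_def)
  then show "\<delta> \<in> TT0"
  proof cases
    case 1
    have DV: "dm_ev dm_Fm DVar \<phi> = \<phi>" for \<phi> by (induction \<phi>) (simp_all add: dm_Fm_def)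
    have odd: "G S (PVar (2*x+1)) = El (DVar x)" for S x by simp
    have t: "G S (tr (\<gamma> j)) = El (\<gamma> j)" for S
      using tr_hat[OF G_hom odd const_free_\<gamma>] by (simp add: DV)
    have "G {i} (prem j) \<in> desig (Th (ex i))" for i
    proof (cases "i < j")
      case True
      then have "G {i} (prem j) = El (DVar 0)" using prem_hat[OF G_hom, of "{i}" j] by auto
      then show ?thesis by (auto simp: desig_def Th_def ex_def)
    next
      case False
      then have "G {i} (prem j) = El (\<gamma> j)" using prem_hat[OF G_hom, of "{i}" j] t by auto
      moreover have "\<gamma> j \<in> Th (ex i)" using ex_\<gamma>[of j i] False by (auto simp: Th_def)
      ultimately show ?thesis by (auto simp: desig_def)
    qed
    moreover have "G {} (prem j) = El (\<gamma> j)" using prem_hat[OF G_hom, of "{}" j] t by auto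
    moreover have "\<gamma> j \<in> Tlp"
    proof -
      have "const_free \<phi> \<Longrightarrow> ev (\<lambda>x. BB) \<phi> = BB" for \<phi> by (induction \<phi>) (simp_all add: DM4_def)
      then have "ev (\<lambda>x. BB) (\<gamma> j) = BB" using const_free_\<gamma> by blast
      moreover have "minus (ev lp (\<gamma> j)) \<longleftrightarrow> minus (ev (\<lambda>x. BB) (\<gamma> j))"
        unfolding ev_\<gamma> ev_tile by (simp add: lp_def u_def)
      ultimately show ?thesis by (auto simp: Tlp_def minus_def)
    qed
    ultimately show ?thesis using 1 by (auto simp: TT0_def desig_def)
  qed (simp add: TT0_def desig_def)
qed

lemma q_TT0: "PVar 1 \<notin> TT0"
  using DBot_notin(3) by (auto simp: TT0_def desig_def)

definition K :: "pp_form conseq" where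
  "K \<Phi> \<psi> \<longleftrightarrow> (\<forall>T. (\<forall>\<Phi> \<psi>. circ TYPE(dm_form) (gen R1) \<Phi> \<psi> \<or> circ TYPE(dm_form) (gen R2) \<Phi> \<psi> \<or>
      pp_leq TYPE(dm_form) \<Phi> \<psi> \<longrightarrow> \<Phi> \<subseteq> T \<longrightarrow> \<psi> \<in> T) \<longrightarrow> \<Phi> \<subseteq> T \<longrightarrow> \<psi> \<in> T)"

lemma pp_hom_comp:
  "\<sigma> \<in> pp_hom pp_Fm pp_Fm \<Longrightarrow> h \<in> pp_hom pp_Fm A \<Longrightarrow> h \<circ> \<sigma> \<in> pp_hom pp_Fm A"
  unfolding pp_hom_Fm_iff by (simp add: pp_Fm_def)

lemma circ_subs:
  assumes "circ TYPE('a) L \<Phi> \<psi>" "\<sigma> \<in> pp_hom pp_Fm pp_Fm"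
  shows "circ TYPE('a) L (\<sigma> ` \<Phi>) (\<sigma> \<psi>)"
  unfolding circ_def pp_matrix_conseq_def
proof (intro allI impI ballI)
  fix M :: "'a dm_matrix" and h
  assume "nontrivial_model L M" and h: "h \<in> pp_hom pp_Fm (fst (circ_matrix M))"
    "h ` \<sigma> ` \<Phi> \<subseteq> snd (circ_matrix M)"
  then have "pp_matrix_conseq (circ_matrix M) \<Phi> \<psi>" using assms(1) unfolding circ_def by blast
  then have "(h \<circ> \<sigma>) ` \<Phi> \<subseteq> snd (circ_matrix M) \<longrightarrow> (h \<circ> \<sigma>) \<psi> \<in> snd (circ_matrix M)"
    using pp_hom_comp[OF assms(2) h(1)] unfolding pp_matrix_conseq_def by blast
  then show "h (\<sigma> \<psi>) \<in> snd (circ_matrix M)" using h(2) by (simp add: image_comp)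
qed

lemma pp_leq_subs:
  assumes "pp_leq T \<Phi> \<psi>" "\<sigma> \<in> pp_hom pp_Fm pp_Fm"
  shows "pp_leq T (\<sigma> ` \<Phi>) (\<sigma> \<psi>)"
proof -
  obtain \<phi>s where \<phi>s: "set \<phi>s \<subseteq> \<Phi>" "PP_valid T (PBigAnd \<phi>s) (PAnd (PBigAnd \<phi>s) \<psi>)"
    using assms(1) unfolding pp_leq_def by blast
  have s: "\<sigma> (PAnd \<alpha> \<beta>) = PAnd (\<sigma> \<alpha>) (\<sigma> \<beta>)" "\<sigma> PTop = PTop" for \<alpha> \<beta>
    using assms(2) unfolding pp_hom_Fm_iff by (simp_all add: pp_Fm_def)
  have b: "\<sigma> (PBigAnd \<phi>s) = PBigAnd (map \<sigma> \<phi>s)" by (induction \<phi>s) (simp_all add: s)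
  have "PP_valid T (\<sigma> (PBigAnd \<phi>s)) (\<sigma> (PAnd (PBigAnd \<phi>s) \<psi>))"
    unfolding PP_valid_def
  proof (intro allI impI ballI)
    fix A :: "'a pp_alg" and h assume "PP_algebra A" "h \<in> pp_hom pp_Fm A"
    then have "(h \<circ> \<sigma>) (PBigAnd \<phi>s) = (h \<circ> \<sigma>) (PAnd (PBigAnd \<phi>s) \<psi>)"
      using \<phi>s(2) pp_hom_comp[OF assms(2)] unfolding PP_valid_def by blast
    then show "h (\<sigma> (PBigAnd \<phi>s)) = h (\<sigma> (PAnd (PBigAnd \<phi>s) \<psi>))" by simp
  qed
  then show ?thesis unfolding pp_leq_def s b
    by (intro exI[of _ "map \<sigma> \<phi>s"]) (use \<phi>s(1) in auto)
qed

lemma K_logic: "pp_logic K"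
proof -
  define C where "C T \<longleftrightarrow> (\<forall>\<Phi> \<psi>. circ TYPE(dm_form) (gen R1) \<Phi> \<psi> \<or> circ TYPE(dm_form) (gen R2) \<Phi> \<psi> \<or>
      pp_leq TYPE(dm_form) \<Phi> \<psi> \<longrightarrow> \<Phi> \<subseteq> T \<longrightarrow> \<psi> \<in> T)" for T
  have K: "K = (\<lambda>\<Phi> \<psi>. \<forall>T. C T \<longrightarrow> \<Phi> \<subseteq> T \<longrightarrow> \<psi> \<in> T)"
    by (intro ext) (simp add: K_def C_def)
  have "K (\<sigma> ` \<Phi>) (\<sigma> \<psi>)" if \<sigma>: "\<sigma> \<in> pp_hom pp_Fm pp_Fm" and "K \<Phi> \<psi>" for \<sigma> \<Phi> \<psi>
    unfolding K
  proof (intro allI impI)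
    fix T assume T: "C T" "\<sigma> ` \<Phi> \<subseteq> T"
    have "C {\<phi>. \<sigma> \<phi> \<in> T}" unfolding C_def
    proof (intro allI impI)
      fix \<Psi> \<chi> assume a: "circ TYPE(dm_form) (gen R1) \<Psi> \<chi> \<or> circ TYPE(dm_form) (gen R2) \<Psi> \<chi> \<or>
        pp_leq TYPE(dm_form) \<Psi> \<chi>" and "\<Psi> \<subseteq> {\<phi>. \<sigma> \<phi> \<in> T}"
      then have "\<sigma> ` \<Psi> \<subseteq> T" by auto
      moreover have "circ TYPE(dm_form) (gen R1) (\<sigma> ` \<Psi>) (\<sigma> \<chi>) \<or>
        circ TYPE(dm_form) (gen R2) (\<sigma> ` \<Psi>) (\<sigma> \<chi>) \<or> pp_leq TYPE(dm_form) (\<sigma> ` \<Psi>) (\<sigma> \<chi>)"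
        using a circ_subs[OF _ \<sigma>] pp_leq_subs[OF _ \<sigma>] by blast
      ultimately show "\<chi> \<in> {\<phi>. \<sigma> \<phi> \<in> T}" using T(1) unfolding C_def by blast
    qed
    moreover have "\<Phi> \<subseteq> {\<phi>. \<sigma> \<phi> \<in> T}" using T(2) by auto
    ultimately show "\<sigma> \<psi> \<in> T" using \<open>K \<Phi> \<psi>\<close> unfolding K by blast
  qed
  moreover have "consequence_relation K"
    unfolding K by (rule consequence_relation_closed_sets)
  ultimately show ?thesis by (simp add: pp_logic_def)
qed

lemma K_intro:
  assumes "circ TYPE(dm_form) (gen R1) \<Phi> \<psi> \<or> circ TYPE(dm_form) (gen R2) \<Phi> \<psi> \<or>
    pp_leq TYPE(dm_form) \<Phi> \<psi>"
  shows "K \<Phi> \<psi>"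
  unfolding K_def
proof (intro allI impI)
  fix T assume C: "\<forall>\<Phi> \<psi>. circ TYPE(dm_form) (gen R1) \<Phi> \<psi> \<or> circ TYPE(dm_form) (gen R2) \<Phi> \<psi> \<or>
      pp_leq TYPE(dm_form) \<Phi> \<psi> \<longrightarrow> \<Phi> \<subseteq> T \<longrightarrow> \<psi> \<in> T" and T: "\<Phi> \<subseteq> T"
  show "\<psi> \<in> T" by (rule C[rule_format, OF assms T])
qed

lemma K_above: "circ TYPE(dm_form) (gen R1) \<le> K" "circ TYPE(dm_form) (gen R2) \<le> K"
  "pp_leq TYPE(dm_form) \<le> K"
  by (intro le_funI le_boolI K_intro, simp)+

lemma not_K: "\<not> K \<Delta> (PVar 1)"
proof
  assume k: "K \<Delta> (PVar 1)"
  have "PVar 1 \<in> TT0"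
    by (rule k[unfolded K_def, rule_format, OF _ \<Delta>_TT0])
      (elim disjE; rule TT0_closed1 TT0_closed2 TT0_closed3; assumption)
  then show False using q_TT0 by simp
qed

lemma circ_universe:
  assumes "infinite (UNIV :: 'a set)" "infinite (UNIV :: 'b set)"
  shows "circ TYPE('a) L = circ TYPE('b) L"
proof (rule antisym)
  show "circ TYPE('a) L \<le> circ TYPE('b) L"
    using circ_le_any_type[OF assms(1)] by (fastforce simp: circ_def le_fun_def)
  show "circ TYPE('b) L \<le> circ TYPE('a) L"
    using circ_le_any_type[OF assms(2)] by (fastforce simp: circ_def le_fun_def)
qed

lemma pp_leq_universe:
  assumes "infinite (UNIV :: 'a set)" "infinite (UNIV :: 'b set)"
  shows "pp_leq TYPE('a) = pp_leq TYPE('b)"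
  unfolding pp_leq_def[abs_def]
  using pp_leq_any_type[OF assms(1), where 'b = 'b] pp_leq_any_type[OF assms(2), where 'b = 'a]
  by blast

lemma join_eqI:
  assumes "least L j (Upper L {x, y})" "\<And>a b. le L a b \<Longrightarrow> le L b a \<Longrightarrow> a = b"
  shows "x \<squnion>\<^bsub>L\<^esub> y = j"
  unfolding join_def Lattice.sup_def
  by (rule some_equality) (use assms in \<open>auto simp: least_def\<close>)

lemma join_le:
  assumes ex: "\<exists>j. least L j (Upper L {x, y})" and k: "k \<in> Upper L {x, y}"
  shows "le L (x \<squnion>\<^bsub>L\<^esub> y) k"
  unfolding join_def Lattice.sup_def
  using someI_ex[OF ex] k by (auto simp: least_def)

lemma pp_lub_exists:
  "\<exists>j. least (extensions pp_logic L0) j (Upper (extensions pp_logic L0) X)"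
proof -
  let ?E = "extensions pp_logic L0"
  define U where "U = Upper ?E X"
  define j where "j = (\<lambda>\<Phi> \<psi>. \<forall>L\<in>U. L \<Phi> \<psi>)"
  have U: "pp_logic L" "L0 \<le> L" "L1 \<in> X \<inter> carrier ?E \<Longrightarrow> L1 \<le> L" if "L \<in> U" for L L1
    using that by (auto simp: U_def Upper_def extensions_def)
  have jl: "L' \<le> j" if "\<And>L. L \<in> U \<Longrightarrow> L' \<le> L" for L'
    using that by (auto simp: j_def le_fun_def)
  have "consequence_relation j"
  proof -
    have c: "consequence_relation L" if "L \<in> U" for L using U(1)[OF that] by (simp add: pp_logic_def)
    have "\<psi> \<in> \<Phi> \<Longrightarrow> j \<Phi> \<psi>" for \<Phi> \<psi>
      using c unfolding j_def consequence_relation_def by blast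
    moreover have "j \<Phi>' \<psi>" if "j \<Phi> \<psi>" "\<Phi> \<subseteq> \<Phi>'" for \<Phi> \<Phi>' \<psi>
      unfolding j_def
    proof
      fix L assume "L \<in> U"
      then show "L \<Phi>' \<psi>" using c that unfolding j_def consequence_relation_def by metis
    qed
    moreover have "j \<Phi> \<chi>" if "\<forall>\<psi>\<in>\<Psi>. j \<Phi> \<psi>" "j \<Psi> \<chi>" for \<Phi> \<Psi> \<chi>
      unfolding j_def
    proof
      fix L assume L: "L \<in> U"
      then have "\<forall>\<psi>\<in>\<Psi>. L \<Phi> \<psi>" "L \<Psi> \<chi>" using that unfolding j_def by auto
      then show "L \<Phi> \<chi>" using c[OF L] unfolding consequence_relation_def by metis
    qed
    ultimately show ?thesis
      unfolding consequence_relation_def by (intro conjI allI impI) metis+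
  qed
  moreover have "j (\<sigma> ` \<Phi>) (\<sigma> \<psi>)" if "\<sigma> \<in> pp_hom pp_Fm pp_Fm" "j \<Phi> \<psi>" for \<sigma> \<Phi> \<psi>
    using U(1) that unfolding j_def pp_logic_def by blast
  ultimately have "pp_logic j" by (simp add: pp_logic_def)
  then have jc: "j \<in> carrier ?E" using jl[of L0] U(2) by (simp add: extensions_def)
  have "j \<in> U" unfolding U_def Upper_def using jc jl U(3) by (auto simp: extensions_def)
  moreover have "j \<le> L" if "L \<in> U" for L using that by (auto simp: j_def le_fun_def)
  moreover have "U \<subseteq> carrier ?E" by (auto simp: U_def Upper_def)
  ultimately have "least ?E j U" by (auto simp: least_def extensions_def)
  then show ?thesis unfolding U_def by blast
qed

theorem no_lattice_embedding_of_nonfinitary: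
  assumes inf: "infinite (UNIV :: 'a set)"
  shows "\<not> lattice_embedding (extensions dm_logic belnap) (extensions pp_logic (pp_leq TYPE('a)))
           (circ TYPE('a))"
proof
  let ?E = "extensions pp_logic (pp_leq TYPE('a))" and ?S = "extensions dm_logic belnap"
  assume e: "lattice_embedding ?S ?E (circ TYPE('a))"
  note inf' = infinite_dm_form
  have c: "circ TYPE('a) L = circ TYPE(dm_form) L" for L by (rule circ_universe[OF inf inf'])
  have p: "pp_leq TYPE('a) = pp_leq TYPE(dm_form)" by (rule pp_leq_universe[OF inf inf'])
  have S: "gen R \<in> carrier ?S" for R by (simp add: extensions_def gen_logic gen_belnap)
  have "least ?S J (Upper ?S {gen R1, gen R2})"
    unfolding least_def
  proof (intro conjI ballI)
    show "J \<in> Upper ?S {gen R1, gen R2}"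
      using gen_mono[of R1 "R1 \<union> R2"] gen_mono[of R2 "R1 \<union> R2"] S[of "R1 \<union> R2"]
      by (auto simp: Upper_def extensions_def)
    fix L assume "L \<in> Upper ?S {gen R1, gen R2}"
    then have L: "dm_logic L" "belnap \<le> L" "gen R1 \<le> L" "gen R2 \<le> L"
      using S[of R1] S[of R2] by (auto simp: Upper_def extensions_def)
    have "J \<le> L"
      using L(3,4) gen_rule by (intro gen_least[OF L(1,2)]) (auto simp: le_fun_def)
    then show "le ?S J L" by (simp add: extensions_def)
  qed (auto simp: Upper_def)
  then have "gen R1 \<squnion>\<^bsub>?S\<^esub> gen R2 = J"
    by (rule join_eqI) (auto simp: extensions_def)
  then have eq: "circ TYPE('a) J = circ TYPE('a) (gen R1) \<squnion>\<^bsub>?E\<^esub> circ TYPE('a) (gen R2)"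
    using e S[of R1] S[of R2] unfolding lattice_embedding_def by metis
  have "K \<in> Upper ?E {circ TYPE('a) (gen R1), circ TYPE('a) (gen R2)}"
    using K_logic K_above by (auto simp: Upper_def extensions_def c p)
  from join_le[OF pp_lub_exists this] have "circ TYPE('a) J \<le> K"
    unfolding eq by (simp add: extensions_def)
  then show False using circ_J not_K by (auto simp: le_fun_def)
qed

hide_const (open) ev subs J H4 conj_four thy gen adj u tile \<gamma> plus minus good Th prem2 cyc ex R1 R2 lp Tlp Z tr guard prem \<Delta> const_free G desig TT0 K
hide_type (open) rules

end

theory Submission
  imports Defs "HOL-Library.Ramsey"
begin

text \<open>
  A homomorphism into \<open>A\<^sup>\<circ>\<close> decides for each variable whether its value is the new top, the new
  bottom or an element of \<open>A\<close>. Once this pattern is known, every occurrence of \<open>\<circ>\<close> has a known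
  classical value, the new constants can be absorbed, and what remains of a formula is its reduct, a
  formula in the signature of De Morgan algebras that is evaluated in \<open>A\<close>. Hence
  \<open>\<Phi> \<turnstile>\<^sup>\<circ> \<psi>\<close> holds iff for each pattern the reducts of \<open>\<Phi>\<close> entail the reduct of
  \<open>\<psi>\<close> in \<open>\<turnstile>\<close> (\<open>circ_iff_reducts\<close>). This replaces the class of all models by a syntactic
  condition, from which the claims follow.

  Meets are intersections, and a condition quantified over all patterns commutes with them. On
  formulas without \<open>\<circ>\<close> the two logics agree, which gives injectivity (\<open>circ_recovers\<close>). If \<open>\<turnstile>\<close> is finitary, then so is \<open>\<turnstile>\<^sup>\<circ>\<close>, because the
  space of patterns is compact (\<open>finitary_circ\<close>). For joins of finitary logics, finitely many
  premises suffice; a pattern of their variables is described by a formula with classical values, so a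
  derivation in the join can be relativised to each pattern and the conclusion obtained by cases
  (\<open>circ_join_le\<close>).

  By injectivity, continuum many finitary super-Belnap logics are enough for the cardinality claim.
  For a finite loopless graph \<open>H\<close> there is a formula which is satisfiable in the De Morgan algebra of a
  graph \<open>G\<close>, with the top as the only designated element, iff \<open>G\<close> maps homomorphically to \<open>H\<close>. If
  no two graphs of a sequence are related by a homomorphism, then each set of them can be made explosive
  without affecting the others (\<open>explosive_logic_colouring\<close>). Shift graphs provide such a sequence
  (\<open>antichain_graph_hom\<close>): their odd girth grows with the length of the lists, which excludes maps into
  later graphs, and by Ramsey's theorem the number of colours they require grows with the range of the
  entries, which excludes maps into earlier ones.
\<close>

section \<open>Closed sets, meets and joins of logics\<close>

lemma consequence_refl: "consequence_relation L \<Longrightarrow> \<psi> \<in> \<Phi> \<Longrightarrow> L \<Phi> \<psi>"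
  unfolding consequence_relation_def by blast

lemma consequence_mono: "consequence_relation L \<Longrightarrow> L \<Phi> \<psi> \<Longrightarrow> \<Phi> \<subseteq> \<Phi>' \<Longrightarrow> L \<Phi>' \<psi>"
  unfolding consequence_relation_def by metis

lemma consequence_cut:
  "consequence_relation L \<Longrightarrow> (\<And>\<psi>. \<psi> \<in> \<Psi> \<Longrightarrow> L \<Phi> \<psi>) \<Longrightarrow> L \<Psi> \<chi> \<Longrightarrow> L \<Phi> \<chi>"
  unfolding consequence_relation_def by metis

definition closed_under :: "'f conseq \<Rightarrow> 'f set \<Rightarrow> bool" where
  "closed_under L T \<longleftrightarrow> (\<forall>\<Phi> \<psi>. L \<Phi> \<psi> \<longrightarrow> \<Phi> \<subseteq> T \<longrightarrow> \<psi> \<in> T)"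

lemma closed_underD: "closed_under L T \<Longrightarrow> L \<Phi> \<psi> \<Longrightarrow> \<Phi> \<subseteq> T \<Longrightarrow> \<psi> \<in> T"
  unfolding closed_under_def by blast

lemma closed_under_consequences:
  assumes "consequence_relation L" shows "closed_under L {\<chi>. L \<Phi> \<chi>}"
  unfolding closed_under_def using consequence_cut[OF assms] by blast

definition join_logic :: "'f conseq \<Rightarrow> 'f conseq \<Rightarrow> 'f conseq" where
  "join_logic L L' \<Phi> \<psi> \<longleftrightarrow>
     (\<forall>T. closed_under L T \<and> closed_under L' T \<longrightarrow> \<Phi> \<subseteq> T \<longrightarrow> \<psi> \<in> T)"

lemma join_logic_upper: "L \<le> join_logic L L'" "L' \<le> join_logic L L'"
  by (auto simp: join_logic_def closed_under_def)

lemma join_logic_least: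
  assumes "consequence_relation K" "L \<le> K" "L' \<le> K" shows "join_logic L L' \<le> K"
proof (intro le_funI le_boolI)
  fix \<Phi> \<psi> assume j: "join_logic L L' \<Phi> \<psi>"
  have "closed_under M {\<chi>. K \<Phi> \<chi>}" if "M \<le> K" for M
    using closed_under_consequences[OF assms(1), of \<Phi>] that
    unfolding closed_under_def le_fun_def le_bool_def by blast
  moreover have "\<Phi> \<subseteq> {\<chi>. K \<Phi> \<chi>}" using consequence_refl[OF assms(1)] by blast
  ultimately show "K \<Phi> \<psi>" using j assms(2,3) unfolding join_logic_def by blast
qed

lemma closed_under_preimage:
  assumes "dm_logic L" "\<sigma> \<in> dm_hom dm_Fm dm_Fm" "closed_under L T"
  shows "closed_under L (\<sigma> -` T)"
  using assms unfolding closed_under_def dm_logic_def by blast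

lemma dm_logic_join:
  assumes "dm_logic L" "dm_logic L'" shows "dm_logic (join_logic L L')"
proof -
  have "join_logic L L' (\<sigma> ` \<Phi>) (\<sigma> \<psi>)" 
    if "\<sigma> \<in> dm_hom dm_Fm dm_Fm" "join_logic L L' \<Phi> \<psi>" for \<sigma> \<Phi> \<psi>
    unfolding join_logic_def
  proof (intro allI impI)
    fix T assume T: "closed_under L T \<and> closed_under L' T" and "\<sigma> ` \<Phi> \<subseteq> T"
    then have "\<Phi> \<subseteq> \<sigma> -` T" by blast
    moreover have "closed_under L (\<sigma> -` T) \<and> closed_under L' (\<sigma> -` T)"
      using T closed_under_preimage assms that(1) by blast
    ultimately show "\<sigma> \<psi> \<in> T" using that(2) unfolding join_logic_def by blast
  qed
  moreover have "join_logic L L' = (\<lambda>\<Phi> \<psi>. \<forall>T. closed_under L T \<and> closed_under L' T \<longrightarrow> \<Phi> \<subseteq> T \<longrightarrow> \<psi> \<in> T)"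
    by (intro ext) (simp add: join_logic_def)
  ultimately show ?thesis
    using consequence_relation_closed_sets[of "\<lambda>T. closed_under L T \<and> closed_under L' T"]
    by (simp add: dm_logic_def)
qed

lemma finite_premises_common:
  assumes "consequence_relation L" "finite \<Psi>" "\<And>\<psi>. \<psi> \<in> \<Psi> \<Longrightarrow> \<exists>\<Phi>'\<subseteq>\<Phi>. finite \<Phi>' \<and> L \<Phi>' \<psi>"
  shows "\<exists>\<Phi>'\<subseteq>\<Phi>. finite \<Phi>' \<and> (\<forall>\<psi>\<in>\<Psi>. L \<Phi>' \<psi>)"
proof -
  obtain F where F: "\<And>\<psi>. \<psi> \<in> \<Psi> \<Longrightarrow> F \<psi> \<subseteq> \<Phi> \<and> finite (F \<psi>) \<and> L (F \<psi>) \<psi>"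
    using assms(3) by metis
  then have "L (\<Union> (F ` \<Psi>)) \<psi>" if "\<psi> \<in> \<Psi>" for \<psi>
    using that consequence_mono[OF assms(1), of "F \<psi>" \<psi> "\<Union> (F ` \<Psi>)"] by blast
  then show ?thesis using F assms(2) by (intro exI[of _ "\<Union> (F ` \<Psi>)"]) auto
qed

text \<open>What follows from finitely many premises out of \<open>\<Phi>\<close> is closed under both relations,
  because each of their rules uses finitely many premises only.\<close>

lemma join_logic_finitary:
  assumes L: "finitary L" "finitary L'" and J: "consequence_relation (join_logic L L')"
  shows "finitary (join_logic L L')"
  unfolding finitary_def
proof (intro allI impI)
  fix \<Phi> \<psi> assume j: "join_logic L L' \<Phi> \<psi>"
  define T where "T = {\<chi>. \<exists>\<Phi>'\<subseteq>\<Phi>. finite \<Phi>' \<and> join_logic L L' \<Phi>' \<chi>}"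
  have "closed_under M T" if M: "finitary M" "M \<le> join_logic L L'" for M
    unfolding closed_under_def
  proof (intro allI impI)
    fix \<Psi> \<chi> assume "M \<Psi> \<chi>" "\<Psi> \<subseteq> T"
    then obtain \<Psi>' where \<Psi>': "\<Psi>' \<subseteq> \<Psi>" "finite \<Psi>'" "M \<Psi>' \<chi>"
      using M(1) unfolding finitary_def by blast
    have "\<exists>\<Phi>'\<subseteq>\<Phi>. finite \<Phi>' \<and> (\<forall>\<psi>\<in>\<Psi>'. join_logic L L' \<Phi>' \<psi>)"
      by (rule finite_premises_common[OF J \<Psi>'(2)]) (use \<Psi>'(1) \<open>\<Psi> \<subseteq> T\<close> in \<open>auto simp: T_def\<close>)
    then obtain \<Phi>' where \<Phi>': "\<Phi>' \<subseteq> \<Phi>" "finite \<Phi>'" "\<forall>\<psi>\<in>\<Psi>'. join_logic L L' \<Phi>' \<psi>"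
      by blast
    have "join_logic L L' \<Psi>' \<chi>" using M(2) \<Psi>'(3) by (auto simp: le_fun_def)
    have "join_logic L L' \<Phi>' \<chi>"
      by (rule consequence_cut[OF J bspec[OF \<Phi>'(3)]]) (assumption, fact)
    with \<Phi>'(1,2) show "\<chi> \<in> T" unfolding T_def by blast
  qed
  from this[OF L(1) join_logic_upper(1)] this[OF L(2) join_logic_upper(2)]
  have "closed_under L T \<and> closed_under L' T" ..
  moreover have "\<Phi> \<subseteq> T"
  proof
    fix \<phi> assume "\<phi> \<in> \<Phi>"
    moreover have "join_logic L L' {\<phi>} \<phi>" by (rule consequence_refl[OF J]) simp
    ultimately show "\<phi> \<in> T" unfolding T_def by blast
  qed
  ultimately have "\<psi> \<in> T" using j unfolding join_logic_def by blast
  then show "\<exists>\<Phi>'\<subseteq>\<Phi>. finite \<Phi>' \<and> join_logic L L' \<Phi>' \<psi>" unfolding T_def by blast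
qed

lemma dm_logic_inf: "dm_logic L \<Longrightarrow> dm_logic L' \<Longrightarrow> dm_logic (inf L L')"
  unfolding dm_logic_def consequence_relation_def inf_fun_def inf_bool_def
  by (intro conjI allI impI ballI; metis)

lemma finitary_inf:
  assumes "consequence_relation L" "consequence_relation L'" "finitary L" "finitary L'"
  shows "finitary (inf L L')"
  unfolding finitary_def
proof (intro allI impI)
  fix \<Phi> \<psi> assume "(inf L L') \<Phi> \<psi>"
  then have "L \<Phi> \<psi>" "L' \<Phi> \<psi>" by (simp_all add: inf_fun_def)
  from assms(3)[unfolded finitary_def, rule_format, OF this(1)]
    assms(4)[unfolded finitary_def, rule_format, OF this(2)]
  obtain \<Phi>1 \<Phi>2 where "\<Phi>1 \<subseteq> \<Phi>" "finite \<Phi>1" "L \<Phi>1 \<psi>" "\<Phi>2 \<subseteq> \<Phi>" "finite \<Phi>2" "L' \<Phi>2 \<psi>"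
    by blast
  moreover have "L (\<Phi>1 \<union> \<Phi>2) \<psi>" "L' (\<Phi>1 \<union> \<Phi>2) \<psi>"
    by (rule consequence_mono[OF assms(1) \<open>L \<Phi>1 \<psi>\<close>] consequence_mono[OF assms(2) \<open>L' \<Phi>2 \<psi>\<close>]; simp)+
  ultimately show "\<exists>\<Phi>'\<subseteq>\<Phi>. finite \<Phi>' \<and> (inf L L') \<Phi>' \<psi>"
    by (intro exI[of _ "\<Phi>1 \<union> \<Phi>2"]) (simp add: inf_fun_def)
qed

lemma meet_extensions:
  assumes "L \<in> carrier (extensions P L0)" "L' \<in> carrier (extensions P L0)" "P (inf L L')"
  shows "L \<sqinter>\<^bsub>extensions P L0\<^esub> L' = inf L L'"
  unfolding meet_def Lattice.inf_def
proof (rule some_equality)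
  have c: "inf L L' \<in> carrier (extensions P L0)" using assms by (auto simp: extensions_def)
  then show g: "greatest (extensions P L0) (inf L L') (Lower (extensions P L0) {L, L'})"
    using assms unfolding greatest_def Lower_def
    by (fastforce simp: extensions_def le_fun_def le_bool_def)
  fix K assume "greatest (extensions P L0) K (Lower (extensions P L0) {L, L'})"
  with g have "K \<le> inf L L'" "inf L L' \<le> K" by (auto simp: greatest_def extensions_def)
  then show "K = inf L L'" by (rule antisym)
qed

lemma join_extensions:
  assumes "L \<in> carrier (extensions P L0)" "L' \<in> carrier (extensions P L0)"
    and "P (join_logic L L')" "\<And>K. P K \<Longrightarrow> consequence_relation K"
  shows "L \<squnion>\<^bsub>extensions P L0\<^esub> L' = join_logic L L'"
proof (rule join_eqI)
  have "join_logic L L' \<le> K" if "P K" "L \<le> K" "L' \<le> K" for K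
    using join_logic_least[OF assms(4)] that by blast
  moreover have "L0 \<le> join_logic L L'"
    using assms(1) join_logic_upper(1)[of L L'] by (auto simp: extensions_def)
  ultimately show "least (extensions P L0) (join_logic L L') (Upper (extensions P L0) {L, L'})"
    using assms join_logic_upper[of L L'] join_logic_upper[of L' L]
    by (auto simp: least_def Upper_def extensions_def)
qed (auto simp: extensions_def)

section \<open>Compactness\<close>

definition depends_below :: "nat \<Rightarrow> ((nat \<Rightarrow> four) \<Rightarrow> 'b) \<Rightarrow> bool" where
  "depends_below N f \<longleftrightarrow> (\<forall>v w. (\<forall>x<N. v x = w x) \<longrightarrow> f v = f w)"

text \<open>The space of valuations is compact: a decreasing sequence of nonempty sets, each of which
  is described by finitely many coordinates, has a common point. Premises are countable, so it
  suffices to consider an exhaustion of \<open>\<Phi>\<close> by finite sets.\<close>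

lemma valuation_compactness:
  fixes \<Phi> :: "'f :: countable set" and Q :: "'f set \<Rightarrow> (nat \<Rightarrow> four) \<Rightarrow> bool"
  assumes sat: "\<And>F. finite F \<Longrightarrow> F \<subseteq> \<Phi> \<Longrightarrow> \<exists>v. Q F v"
    and anti: "\<And>F F' v. F \<subseteq> F' \<Longrightarrow> Q F' v \<Longrightarrow> Q F v"
    and loc: "\<And>F. finite F \<Longrightarrow> F \<subseteq> \<Phi> \<Longrightarrow> \<exists>N. depends_below N (Q F)"
  shows "\<exists>w. \<forall>F. finite F \<longrightarrow> F \<subseteq> \<Phi> \<longrightarrow> Q F w"
proof -
  define \<Phi>' where "\<Phi>' n = {\<phi> \<in> \<Phi>. to_nat \<phi> < n}" for n
  have fin: "finite (\<Phi>' n)" for n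
  proof (rule finite_imageD)
    show "finite (to_nat ` \<Phi>' n)"
      by (rule finite_subset[of _ "{..<n}"]) (auto simp: \<Phi>'_def)
  qed (rule inj_on_subset[OF inj_to_nat subset_UNIV])
  have "\<exists>v. Q (\<Phi>' n) v" for n by (rule sat[OF fin]) (auto simp: \<Phi>'_def)
  then obtain v where v: "\<And>n. Q (\<Phi>' n) (v n)" by metis
  obtain w where w: "\<And>N. infinite {i \<in> UNIV. \<forall>x<N. v i x = w x}"
    by (rule limit_valuation[OF infinite_UNIV_nat, of v]) (rule that)
  have "Q F w" if F: "finite F" "F \<subseteq> \<Phi>" for F
  proof -
    obtain N where N: "depends_below N (Q F)" using loc[OF F] by blast
    have "\<exists>m. \<forall>\<phi>\<in>F. to_nat \<phi> < m"
      using finite_nat_set_iff_bounded[of "to_nat ` F"] F(1) by auto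
    then obtain m where m: "\<forall>\<phi>\<in>F. to_nat \<phi> < m" by blast
    obtain i where i: "i \<ge> m" "\<forall>x<N. v i x = w x"
      using w[of N] unfolding infinite_nat_iff_unbounded_le by blast
    have "F \<subseteq> \<Phi>' i" using m i(1) F(2) unfolding \<Phi>'_def by fastforce
    then have "Q F (v i)" using anti v by blast
    then show ?thesis using N i(2) unfolding depends_below_def by metis
  qed
  then show ?thesis by blast
qed

lemma depends_below_mono: "depends_below N f \<Longrightarrow> N \<le> M \<Longrightarrow> depends_below M f"
  unfolding depends_below_def by auto

lemma depends_below_finite:
  assumes "finite F" "\<And>\<phi>. \<phi> \<in> F \<Longrightarrow> \<exists>N. depends_below N (f \<phi>)"
  shows "\<exists>N. \<forall>\<phi>\<in>F. depends_below N (f \<phi>)"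
proof -
  obtain n where n: "\<And>\<phi>. \<phi> \<in> F \<Longrightarrow> depends_below (n \<phi>) (f \<phi>)" using assms(2) by metis
  have "n \<phi> \<le> Max (n ` F)" if "\<phi> \<in> F" for \<phi> using that assms(1) by simp
  then show ?thesis using n depends_below_mono by blast
qed

abbreviation ev4 :: "(nat \<Rightarrow> four) \<Rightarrow> dm_form \<Rightarrow> four" where "ev4 \<equiv> dm_ev DM4"

lemma ev4_depends_below: "\<exists>N. depends_below N (\<lambda>v. ev4 v \<phi>)"
  using ev_bounded[of \<phi>] unfolding depends_below_def .

lemma finitary_belnap: "finitary belnap"
  unfolding finitary_def
proof (intro allI impI, rule ccontr)
  fix \<Phi> \<psi> assume b: "belnap \<Phi> \<psi>" and "\<not> (\<exists>\<Phi>'\<subseteq>\<Phi>. finite \<Phi>' \<and> belnap \<Phi>' \<psi>)"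
  define Q where "Q F v \<longleftrightarrow> (\<forall>\<phi>\<in>F. ev4 v \<phi> \<in> {BB, TT}) \<and> ev4 v \<psi> \<notin> {BB, TT}" for F v
  have sat: "\<exists>v. Q F v" if "finite F" "F \<subseteq> \<Phi>" for F
    using \<open>\<not> _\<close> that unfolding belnap_iff Q_def by blast
  have anti: "Q F v" if "F \<subseteq> F'" "Q F' v" for F F' v using that by (auto simp: Q_def)
  have loc: "\<exists>N. depends_below N (Q F)" if "finite F" for F
  proof -
    obtain N where "\<forall>\<phi>\<in>insert \<psi> F. depends_below N (\<lambda>v. ev4 v \<phi>)"
      using depends_below_finite[of "insert \<psi> F" "\<lambda>\<phi> v. ev4 v \<phi>"] ev4_depends_below \<open>finite F\<close>
      by blast
    then have N: "ev4 v \<phi> = ev4 w \<phi>" if "\<forall>x<N. v x = w x" "\<phi> \<in> insert \<psi> F" for v w \<phi>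
      using that unfolding depends_below_def by blast
    have "Q F v = Q F w" if "\<forall>x<N. v x = w x" for v w using N[OF that] by (simp add: Q_def)
    then have "depends_below N (Q F)" unfolding depends_below_def by blast
    then show ?thesis by blast
  qed
  have "\<exists>w. \<forall>F. finite F \<longrightarrow> F \<subseteq> \<Phi> \<longrightarrow> Q F w"
    by (rule valuation_compactness) (rule sat anti loc; assumption)+
  then obtain w where w: "\<And>F. finite F \<Longrightarrow> F \<subseteq> \<Phi> \<Longrightarrow> Q F w" by blast
  have "ev4 w \<phi> \<in> {BB, TT}" if "\<phi> \<in> \<Phi>" for \<phi> using w[of "{\<phi>}"] that by (simp add: Q_def)
  moreover have "ev4 w \<psi> \<notin> {BB, TT}" using w[of "{}"] by (simp add: Q_def)
  ultimately show False using b unfolding belnap_iff by blast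
qed

section \<open>Patterns of classical values\<close>

text \<open>A pattern prescribes which variables take the new top, which the new bottom, and which take
  a value in the original algebra. It is coded by a map into the four-element type so that the
  compactness of valuations applies; \<^const>\<open>NN\<close> and \<^const>\<open>BB\<close> both leave the variable alone.\<close>

definition place :: "(nat \<Rightarrow> four) \<Rightarrow> nat \<Rightarrow> dm_form hat" where
  "place v x = (case v x of FF \<Rightarrow> Fhat | TT \<Rightarrow> That | _ \<Rightarrow> El (DVar x))"

primrec hatval :: "(nat \<Rightarrow> four) \<Rightarrow> pp_form \<Rightarrow> dm_form hat" where
  "hatval v (PVar x) = place v x"
| "hatval v (PAnd \<phi> \<psi>) = hat_con DAnd (hatval v \<phi>) (hatval v \<psi>)"
| "hatval v (POr \<phi> \<psi>) = hat_dis DOr (hatval v \<phi>) (hatval v \<psi>)"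
| "hatval v (PNeg \<phi>) = hat_neg DNeg (hatval v \<phi>)"
| "hatval v PTop = That"
| "hatval v PBot = Fhat"
| "hatval v (PCirc \<phi>) = hat_cir (hatval v \<phi>)"

primrec unhat :: "dm_form hat \<Rightarrow> dm_form" where
  "unhat (El \<chi>) = \<chi>"
| "unhat Fhat = DBot"
| "unhat That = DTop"

definition reduct :: "(nat \<Rightarrow> four) \<Rightarrow> pp_form \<Rightarrow> dm_form" where
  "reduct v \<phi> = unhat (hatval v \<phi>)"

primrec translate :: "dm_form \<Rightarrow> pp_form" where
  "translate (DVar x) = PVar x"
| "translate (DAnd \<phi> \<psi>) = PAnd (translate \<phi>) (translate \<psi>)"
| "translate (DOr \<phi> \<psi>) = POr (translate \<phi>) (translate \<psi>)"
| "translate (DNeg \<phi>) = PNeg (translate \<phi>)"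
| "translate DTop = PTop"
| "translate DBot = PBot"

definition super_belnap :: "dm_form conseq \<Rightarrow> bool" where
  "super_belnap L \<longleftrightarrow> dm_logic L \<and> belnap \<le> L"

lemma super_belnapD:
  assumes "super_belnap L"
  shows "consequence_relation L" "belnap \<Phi> \<psi> \<Longrightarrow> L \<Phi> \<psi>"
    "\<sigma> \<in> dm_hom dm_Fm dm_Fm \<Longrightarrow> L \<Phi> \<psi> \<Longrightarrow> L (\<sigma> ` \<Phi>) (\<sigma> \<psi>)"
  using assms by (auto simp: super_belnap_def dm_logic_def le_fun_def)

lemma super_belnap_Top: "super_belnap L \<Longrightarrow> L \<Phi> DTop"
  by (rule super_belnapD(2)) (simp_all add: belnap_iff DM4_def)

lemma super_belnap_Bot: "super_belnap L \<Longrightarrow> DBot \<in> \<Phi> \<Longrightarrow> L \<Phi> \<psi>"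
  by (rule super_belnapD(2)) (auto simp: belnap_iff DM4_def)

lemma hatval_hom: "hatval v \<in> pp_hom pp_Fm (circ_alg dm_Fm)"
proof -
  have "x \<in> carrier (circ_alg dm_Fm)" for x by (cases x) (auto simp: circ_alg_def dm_Fm_def)
  then show ?thesis by (simp add: pp_hom_Fm_iff) (simp add: circ_alg_def dm_Fm_def)
qed

lemma theory_model:
  assumes "super_belnap L" "closed_under L T" "T \<noteq> UNIV"
  shows "nontrivial_model L (dm_Fm, T)"
proof -
  have "L \<le> dm_matrix_conseq (dm_Fm, T)"
  proof (intro le_funI le_boolI)
    fix \<Phi> \<psi> assume "L \<Phi> \<psi>"
    then show "dm_matrix_conseq (dm_Fm, T) \<Phi> \<psi>"
      using super_belnapD(3)[OF assms(1)] closed_underD[OF assms(2)]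
      unfolding dm_matrix_conseq_def fst_conv snd_conv by blast
  qed
  then show ?thesis using assms(3) dm_algebra_Fm by (auto simp: nontrivial_model_def dm_Fm_def)
qed

text \<open>In a homomorphism into \<open>A\<^sup>\<circ>\<close>, the pattern determines which subformulas are classical; what
  remains of the others is a formula without \<open>\<circ>\<close>, evaluated in \<open>A\<close>.\<close>

lemma hom_factors_through_pattern:
  assumes h: "h \<in> pp_hom pp_Fm (circ_alg A)"
    and v: "\<And>x. v x = (case h (PVar x) of Fhat \<Rightarrow> FF | That \<Rightarrow> TT | El a \<Rightarrow> BB)"
    and w: "\<And>x a. h (PVar x) = El a \<Longrightarrow> w x = a"
  shows "h \<phi> = map_hat (dm_ev A w) (hatval v \<phi>)"
proof (induction \<phi>)
  case (PVar x)
  then show ?case using v[of x] w[of x] by (cases "h (PVar x)") (simp_all add: place_def)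
next
  case (PAnd \<phi> \<psi>)
  then show ?case using h by (cases "hatval v \<phi>"; cases "hatval v \<psi>") (simp_all add: pp_hom_Fm_iff circ_alg_def)
next
  case (POr \<phi> \<psi>)
  then show ?case using h by (cases "hatval v \<phi>"; cases "hatval v \<psi>") (simp_all add: pp_hom_Fm_iff circ_alg_def)
next
  case (PNeg \<phi>)
  then show ?case using h by (cases "hatval v \<phi>") (simp_all add: pp_hom_Fm_iff circ_alg_def)
next
  case (PCirc \<phi>)
  then show ?case using h by (cases "hatval v \<phi>") (simp_all add: pp_hom_Fm_iff circ_alg_def)
qed (use h in \<open>simp_all add: pp_hom_Fm_iff circ_alg_def\<close>)

text \<open>A countermodel factors through its pattern. Conversely, a consistent theory of \<open>L\<close> is a
  non-trivial model, and since it contains \<open>\<top>\<close> but not \<open>\<bottom>\<close>, it contains \<open>reduct v \<phi>\<close> iff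
  \<open>hatval v \<phi>\<close> is designated. An inconsistent theory contains every reduct and refutes
  nothing.\<close>

lemma circ_iff_reducts:
  assumes inf: "infinite (UNIV :: 'a set)" and L: "super_belnap L"
  shows "circ TYPE('a) L \<Phi> \<psi> \<longleftrightarrow> (\<forall>v. L (reduct v ` \<Phi>) (reduct v \<psi>))"
proof (intro iffI allI)
  fix v assume c: "circ TYPE('a) L \<Phi> \<psi>"
  define T where "T = {\<chi>. L (reduct v ` \<Phi>) \<chi>}"
  have T: "closed_under L T"
    unfolding T_def by (rule closed_under_consequences[OF super_belnapD(1)[OF L]])
  show "L (reduct v ` \<Phi>) (reduct v \<psi>)"
  proof (cases "T = UNIV")
    case False
    then have "nontrivial_model L (dm_Fm, T)" by (rule theory_model[OF L T])
    from circ_le_any_type[OF inf this] c have m: "pp_matrix_conseq (circ_matrix (dm_Fm, T)) \<Phi> \<psi>"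
      unfolding le_fun_def le_bool_def by blast
    have "DBot \<notin> T"
    proof
      assume "DBot \<in> T"
      then have "\<chi> \<in> T" for \<chi>
        using closed_underD[OF T super_belnap_Bot[OF L], of "{DBot}" \<chi>] by simp
      with False show False by blast
    qed
    moreover have "DTop \<in> T" unfolding T_def using super_belnap_Top[OF L] by simp
    ultimately have des: "hatval v \<phi> \<in> El ` T \<union> {That} \<longleftrightarrow> reduct v \<phi> \<in> T" for \<phi>
      by (cases "hatval v \<phi>") (auto simp: reduct_def)
    have "reduct v \<phi> \<in> T" if "\<phi> \<in> \<Phi>" for \<phi>
      unfolding T_def using that consequence_refl[OF super_belnapD(1)[OF L]] by blast
    then have "hatval v ` \<Phi> \<subseteq> El ` T \<union> {That}" using des by blast
    then have "hatval v \<psi> \<in> El ` T \<union> {That}"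
      using m hatval_hom[of v] unfolding pp_matrix_conseq_def circ_matrix_def fst_conv snd_conv
      by blast
    then show ?thesis using des by (simp add: T_def)
  qed (auto simp: T_def)
next
  assume r: "\<forall>v. L (reduct v ` \<Phi>) (reduct v \<psi>)"
  show "circ TYPE('a) L \<Phi> \<psi>"
    unfolding circ_def pp_matrix_conseq_def
  proof (intro allI impI ballI)
    fix M :: "'a dm_matrix" and h
    assume M: "nontrivial_model L M" and h: "h \<in> pp_hom pp_Fm (fst (circ_matrix M))"
      and h\<Phi>: "h ` \<Phi> \<subseteq> snd (circ_matrix M)"
    obtain A D where MAD: "M = (A, D)" by (cases M)
    have A: "dm_algebra A" "D \<subseteq> carrier A" "D \<noteq> carrier A" "L \<le> dm_matrix_conseq (A, D)"
      using M by (auto simp: nontrivial_model_def MAD)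
    have h: "h \<in> pp_hom pp_Fm (circ_alg A)" using h by (simp add: circ_matrix_def MAD)
    define v where "v x = (case h (PVar x) of Fhat \<Rightarrow> FF | That \<Rightarrow> TT | El a \<Rightarrow> BB)" for x
    define w where "w x = (case h (PVar x) of El a \<Rightarrow> a | _ \<Rightarrow> tru A)" for x
    have hf: "h \<phi> = map_hat (dm_ev A w) (hatval v \<phi>)" for \<phi>
      by (rule hom_factors_through_pattern[OF h]) (simp_all add: v_def w_def)
    have "w x \<in> carrier A" for x
    proof -
      have "h (PVar x) \<in> El ` carrier A \<union> {Fhat, That}"
        using h by (simp add: pp_hom_Fm_iff circ_alg_def)
      then show ?thesis using A(1) by (auto simp: w_def dm_algebra_def)
    qed
    then have w: "dm_ev A w \<in> dm_hom dm_Fm A" using dm_ev_hom[OF A(1)] by blast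
    have D: "g \<chi> \<in> D" if "L \<Gamma> \<chi>" "g ` \<Gamma> \<subseteq> D" "g \<in> dm_hom dm_Fm A" for \<Gamma> \<chi> g
    proof -
      have "dm_matrix_conseq (A, D) \<Gamma> \<chi>" using A(4) that(1) by (auto simp: le_fun_def)
      then show ?thesis using that(2,3) unfolding dm_matrix_conseq_def by simp
    qed
    have "tru A \<in> D" using D[of "{}" DTop "dm_ev A w"] super_belnap_Top[OF L] w by simp
    moreover have "fls A \<notin> D"
    proof
      assume f: "fls A \<in> D"
      have "a \<in> D" if "a \<in> carrier A" for a
      proof -
        have "dm_ev A (\<lambda>_. a) \<in> dm_hom dm_Fm A" using that by (intro dm_ev_hom[OF A(1)]) auto
        then show "a \<in> D"
          using D[of "{DBot}" "DVar 0" "dm_ev A (\<lambda>_. a)"] super_belnap_Bot[OF L] f by simp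
      qed
      with A(2,3) show False by blast
    qed
    ultimately have des: "h \<phi> \<in> snd (circ_matrix M) \<longleftrightarrow> dm_ev A w (reduct v \<phi>) \<in> D" for \<phi>
      unfolding hf by (cases "hatval v \<phi>") (auto simp: reduct_def circ_matrix_def MAD)
    have "dm_ev A w ` reduct v ` \<Phi> \<subseteq> D" using h\<Phi> des by blast
    then have "dm_ev A w (reduct v \<psi>) \<in> D" using D[OF r[rule_format, of v]] w by blast
    then show "h \<psi> \<in> snd (circ_matrix M)" unfolding des .
  qed
qed

section \<open>The image of a super-Belnap logic\<close>

lemma circ_mono:
  assumes inf: "infinite (UNIV :: 'a set)" and "super_belnap L" "super_belnap L'" "L \<le> L'"
  shows "circ TYPE('a) L \<le> circ TYPE('a) L'"
  using assms(4) by (auto simp: circ_iff_reducts[OF inf] assms(2,3) le_fun_def)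

lemma circ_pp_logic:
  assumes inf: "infinite (UNIV :: 'a set)" and L: "super_belnap L" shows "pp_logic (circ TYPE('a) L)"
proof -
  note cr = super_belnapD(1)[OF L]
  have "consequence_relation (circ TYPE('a) L)"
    unfolding consequence_relation_def circ_iff_reducts[OF inf L]
  proof (intro conjI allI impI)
    show "L (reduct v ` \<Phi>) (reduct v \<psi>)" if "\<psi> \<in> \<Phi>" for v \<Phi> \<psi>
      by (rule consequence_refl[OF cr]) (use that in blast)
    show "L (reduct v ` \<Phi>') (reduct v \<psi>)"
      if "(\<forall>v. L (reduct v ` \<Phi>) (reduct v \<psi>)) \<and> \<Phi> \<subseteq> \<Phi>'" for v \<Phi> \<Phi>' \<psi>
      by (rule consequence_mono[OF cr, of "reduct v ` \<Phi>"]) (use that in blast)+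
    show "L (reduct v ` \<Phi>) (reduct v \<chi>)"
      if "(\<forall>\<psi>\<in>\<Psi>. \<forall>v. L (reduct v ` \<Phi>) (reduct v \<psi>)) \<and> (\<forall>v. L (reduct v ` \<Psi>) (reduct v \<chi>))"
      for v \<Phi> \<Psi> \<chi>
      by (rule consequence_cut[OF cr, of "reduct v ` \<Psi>"]) (use that in blast)+
  qed
  then show ?thesis unfolding pp_logic_def using circ_subs by blast
qed

text \<open>A pattern followed by a valuation is a homomorphism into the six-element algebra
  \<open>DM\<^sub>4\<^sup>\<circ>\<close>, where the values that stand for a designated reduct form a lattice filter.\<close>

lemma pp_leq_le_circ:
  assumes inf: "infinite (UNIV :: 'a set)" and L: "super_belnap L" shows "pp_leq TYPE('a) \<le> circ TYPE('a) L"
proof (intro le_funI le_boolI)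
  fix \<Phi> \<psi> assume "pp_leq TYPE('a) \<Phi> \<psi>"
  then have p: "pp_leq TYPE(dm_form) \<Phi> \<psi>" using pp_leq_universe[OF inf infinite_dm_form] by simp
  have "belnap (reduct v ` \<Phi>) (reduct v \<psi>)" for v
    unfolding belnap_iff
  proof (intro allI impI)
    fix w assume r: "\<forall>\<chi>\<in>reduct v ` \<Phi>. ev4 w \<chi> \<in> {BB, TT}"
    have des: "map_hat (ev4 w) (hatval v \<phi>) \<in> {That, El TT, El BB} \<longleftrightarrow> ev4 w (reduct v \<phi>) \<in> {BB, TT}" for \<phi>
      by (cases "hatval v \<phi>") (auto simp: reduct_def DM4_def)
    have "(map_hat (ev4 w) \<circ> hatval v) \<psi> \<in> {That, El TT, El BB}"
    proof (rule pp_leq_filter[OF p map_hat_hom[OF hatval_hom]])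
      show "(map_hat (ev4 w) \<circ> hatval v) ` \<Phi> \<subseteq> {That, El TT, El BB}"
        unfolding image_subset_iff comp_apply des using r by blast
    qed simp
    then show "ev4 w (reduct v \<psi>) \<in> {BB, TT}" unfolding comp_apply des .
  qed
  then show "circ TYPE('a) L \<Phi> \<psi>"
    unfolding circ_iff_reducts[OF inf L] using super_belnapD(2)[OF L] by blast
qed

lemma circ_inf:
  assumes inf: "infinite (UNIV :: 'a set)" and "super_belnap L" "super_belnap L'" "super_belnap (inf L L')"
  shows "circ TYPE('a) (inf L L') = inf (circ TYPE('a) L) (circ TYPE('a) L')"
  unfolding inf_fun_def[of "circ TYPE('a) L"]
  by (intro ext) (auto simp: circ_iff_reducts[OF inf assms(2)] circ_iff_reducts[OF inf assms(3)]
      circ_iff_reducts[OF inf assms(4)])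

subsection \<open>Recovering a logic from its image\<close>

lemma reduct_translate:
  "ev4 w (reduct v (translate \<chi>)) = ev4 (\<lambda>x. ev4 w (unhat (place v x))) \<chi>"
proof (induction \<chi>)
  case (DAnd \<phi> \<psi>)
  moreover have "four_and x FF = FF" "four_and FF x = FF" "four_and x TT = x" for x by (cases x; simp)+
  ultimately show ?case
    by (cases "hatval v (translate \<phi>)"; cases "hatval v (translate \<psi>)") (auto simp: reduct_def DM4_def)
next
  case (DOr \<phi> \<psi>)
  moreover have "four_or x FF = x" "four_or TT x = TT" "four_or x TT = TT" for x by (cases x; simp)+
  ultimately show ?case
    by (cases "hatval v (translate \<phi>)"; cases "hatval v (translate \<psi>)") (auto simp: reduct_def DM4_def)
next
  case (DNeg \<phi>)
  then show ?case by (cases "hatval v (translate \<phi>)") (auto simp: reduct_def DM4_def)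
qed (simp_all add: reduct_def DM4_def)

lemma equivalent_replacement:
  assumes L: "super_belnap L" and eq: "\<And>w \<chi>. ev4 w (f \<chi>) = ev4 w (g \<chi>)" and r: "L (f ` \<Gamma>) (f \<chi>)"
  shows "L (g ` \<Gamma>) (g \<chi>)"
proof -
  note cr = super_belnapD(1)[OF L]
  have "L (g ` \<Gamma>) \<phi>" if "\<phi> \<in> f ` \<Gamma>" for \<phi>
    by (rule super_belnapD(2)[OF L]) (use that eq in \<open>auto simp: belnap_iff\<close>)
  then have "L (g ` \<Gamma>) (f \<chi>)" using r by (rule consequence_cut[OF cr])
  moreover have "L {f \<chi>} (g \<chi>)"
    by (rule super_belnapD(2)[OF L]) (simp add: belnap_iff eq)
  ultimately show ?thesis using consequence_cut[OF cr, of "{f \<chi>}"] by blast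
qed

text \<open>Under a pattern, a translated formula is equivalent to a substitution instance of the
  original one.\<close>

lemma reduct_translate_conseq:
  assumes L: "super_belnap L" and r: "L \<Gamma> \<chi>"
  shows "L ((\<lambda>\<gamma>. reduct v (translate \<gamma>)) ` \<Gamma>) (reduct v (translate \<chi>))"
proof -
  define \<sigma> where "\<sigma> = dm_ev dm_Fm (\<lambda>x. unhat (place v x))"
  have \<sigma>: "\<sigma> \<in> dm_hom dm_Fm dm_Fm"
    unfolding \<sigma>_def by (rule dm_ev_hom[OF dm_algebra_Fm]) (simp add: dm_Fm_def)
  have "ev4 w (\<sigma> \<chi>) = ev4 w (reduct v (translate \<chi>))" for w \<chi>
    using ev_subs[OF \<sigma>, of w \<chi>] by (simp add: reduct_translate) (simp add: \<sigma>_def)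
  then show ?thesis
    by (rule equivalent_replacement[OF L]) (rule super_belnapD(3)[OF L \<sigma> r])
qed

text \<open>Under the pattern without classical variables the reduct of a translation is equivalent to
  the original formula; under the others the rule turns into one of its substitution instances.\<close>

lemma circ_recovers:
  assumes inf: "infinite (UNIV :: 'a set)" and L: "super_belnap L"
  shows "circ TYPE('a) L (translate ` \<Gamma>) (translate \<chi>) \<longleftrightarrow> L \<Gamma> \<chi>"
proof
  assume c: "circ TYPE('a) L (translate ` \<Gamma>) (translate \<chi>)"
  define r where "r \<gamma> = reduct (\<lambda>_. BB) (translate \<gamma>)" for \<gamma>
  have "L (r ` \<Gamma>) (r \<chi>)"
    using c[unfolded circ_iff_reducts[OF inf L], rule_format, of "\<lambda>_. BB"]
    by (simp add: r_def image_image)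
  moreover have "ev4 w (r \<chi>) = ev4 w (id \<chi>)" for w \<chi>
    by (simp add: r_def reduct_translate place_def)
  ultimately have "L (id ` \<Gamma>) (id \<chi>)" by (rule equivalent_replacement[OF L, rotated])
  then show "L \<Gamma> \<chi>" by simp
next
  assume "L \<Gamma> \<chi>"
  then show "circ TYPE('a) L (translate ` \<Gamma>) (translate \<chi>)"
    unfolding circ_iff_reducts[OF inf L] using reduct_translate_conseq[OF L]
    by (simp add: image_image)
qed

subsection \<open>Finitarity\<close>

lemma hatval_depends_below: "\<exists>N. depends_below N (\<lambda>v. hatval v \<phi>)"
proof (induction \<phi>)
  case (PVar x)
  show ?case by (rule exI[of _ "Suc x"]) (simp add: depends_below_def place_def)
next
  case (PAnd \<phi> \<psi>)
  then obtain N M where "depends_below N (\<lambda>v. hatval v \<phi>)" "depends_below M (\<lambda>v. hatval v \<psi>)" by blast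
  then show ?case
    by (intro exI[of _ "max N M"]) (auto simp: depends_below_def intro!: arg_cong2[of _ _ _ _ "hat_con DAnd"])
next
  case (POr \<phi> \<psi>)
  then obtain N M where "depends_below N (\<lambda>v. hatval v \<phi>)" "depends_below M (\<lambda>v. hatval v \<psi>)" by blast
  then show ?case
    by (intro exI[of _ "max N M"]) (auto simp: depends_below_def intro!: arg_cong2[of _ _ _ _ "hat_dis DOr"])
next
  case (PNeg \<phi>)
  then show ?case by (auto simp: depends_below_def) metis
next
  case (PCirc \<phi>)
  then show ?case by (auto simp: depends_below_def) metis
qed (auto simp: depends_below_def)

lemma reducts_depend_below:
  assumes "finite F"
  shows "\<exists>N. \<forall>v w \<phi>. (\<forall>x<N. v x = w x) \<longrightarrow> \<phi> \<in> F \<longrightarrow> reduct v \<phi> = reduct w \<phi>"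
proof -
  obtain N where "\<forall>\<phi>\<in>F. depends_below N (\<lambda>v. hatval v \<phi>)"
    using depends_below_finite[of F "\<lambda>\<phi> v. hatval v \<phi>"] hatval_depends_below assms by blast
  then have "reduct v \<phi> = reduct w \<phi>" if "\<forall>x<N. v x = w x" "\<phi> \<in> F" for v w \<phi>
    using that unfolding depends_below_def reduct_def by metis
  then show ?thesis by blast
qed

text \<open>If no finite set of premises suffices, each of them is refuted under some pattern. By
  compactness one pattern serves for all of them, and there the reduct of \<open>\<psi>\<close> follows in \<open>L\<close>
  from all reducts of premises but from no finitely many.\<close>

lemma finitary_circ:
  assumes inf: "infinite (UNIV :: 'a set)" and L: "super_belnap L" and fin: "finitary L"
  shows "finitary (circ TYPE('a) L)"
  unfolding finitary_def
proof (intro allI impI, rule ccontr)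
  fix \<Phi> \<psi> assume c: "circ TYPE('a) L \<Phi> \<psi>" and n: "\<not> (\<exists>\<Phi>'\<subseteq>\<Phi>. finite \<Phi>' \<and> circ TYPE('a) L \<Phi>' \<psi>)"
  note cr = super_belnapD(1)[OF L]
  define Q where "Q F v \<longleftrightarrow> \<not> L (reduct v ` F) (reduct v \<psi>)" for F v
  have sat: "\<exists>v. Q F v" if "finite F" "F \<subseteq> \<Phi>" for F
    using n that unfolding circ_iff_reducts[OF inf L] Q_def by blast
  have anti: "Q F v" if "F \<subseteq> F'" "Q F' v" for F F' v
    using that(2) consequence_mono[OF cr _ image_mono[OF that(1)]] unfolding Q_def by blast
  have loc: "\<exists>N. depends_below N (Q F)" if F: "finite F" for F
  proof -
    obtain N where N: "\<And>v w \<phi>. \<forall>x<N. v x = w x \<Longrightarrow> \<phi> \<in> insert \<psi> F \<Longrightarrow> reduct v \<phi> = reduct w \<phi>"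
      using reducts_depend_below[of "insert \<psi> F"] F by (meson finite_insert)
    have "Q F v = Q F w" if "\<forall>x<N. v x = w x" for v w
    proof -
      have "reduct v ` F = reduct w ` F" "reduct v \<psi> = reduct w \<psi>"
        using N[OF that] by (auto intro!: image_cong)
      then show ?thesis by (simp add: Q_def)
    qed
    then show ?thesis unfolding depends_below_def by blast
  qed
  have "\<exists>w. \<forall>F. finite F \<longrightarrow> F \<subseteq> \<Phi> \<longrightarrow> Q F w"
    by (rule valuation_compactness) (rule sat anti loc; assumption)+
  then obtain w where w: "\<And>F. finite F \<Longrightarrow> F \<subseteq> \<Phi> \<Longrightarrow> Q F w" by blast
  have "L (reduct w ` \<Phi>) (reduct w \<psi>)" using c unfolding circ_iff_reducts[OF inf L] by blast
  then obtain \<Gamma> where \<Gamma>: "\<Gamma> \<subseteq> reduct w ` \<Phi>" "finite \<Gamma>" "L \<Gamma> (reduct w \<psi>)"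
    using fin unfolding finitary_def by blast
  then obtain F where "F \<subseteq> \<Phi>" "finite F" "\<Gamma> = reduct w ` F" by (meson finite_subset_image)
  with w[of F] \<Gamma>(3) show False by (simp add: Q_def)
qed

subsection \<open>Joins\<close>

text \<open>A formula that is the classical truth unless the first \<open>N\<close> variables behave as the pattern
  \<open>v\<close> says, in which case it is the classical falsity: so \<open>mismatch v N \<or> \<phi>\<close> is \<open>\<phi>\<close> relativised to
  the pattern.\<close>

primrec mismatch :: "(nat \<Rightarrow> four) \<Rightarrow> nat \<Rightarrow> pp_form" where
  "mismatch v 0 = PBot"
| "mismatch v (Suc x) = POr (mismatch v x) (PNeg
     (case v x of FF \<Rightarrow> PAnd (PCirc (PVar x)) (PNeg (PVar x))
        | TT \<Rightarrow> PAnd (PCirc (PVar x)) (PVar x) | _ \<Rightarrow> PNeg (PCirc (PVar x))))"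

lemma hatval_mismatch:
  "hatval w (mismatch v N) = (if \<forall>x<N. place v x = place w x then Fhat else That)"
proof (induction N)
  case (Suc N)
  then show ?case
    by (cases "v N"; cases "w N") (auto simp: less_Suc_eq place_def)
qed simp

lemma reduct_mismatch:
  "reduct w (POr (mismatch v N) \<phi>) = (if \<forall>x<N. place v x = place w x then reduct w \<phi> else DTop)"
proof (cases "\<forall>x<N. place v x = place w x")
  case True
  then have "hatval w (mismatch v N) = Fhat" by (simp add: hatval_mismatch)
  then show ?thesis using True by (cases "hatval w \<phi>") (simp_all add: reduct_def)
next
  case False
  then have "hatval w (mismatch v N) = That" by (simp only: hatval_mismatch if_False)
  then show ?thesis unfolding if_not_P[OF False] by (simp add: reduct_def)
qed

lemma hatval_translate_reduct: "hatval v (translate (reduct v \<phi>)) = hatval v \<phi>"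
  unfolding reduct_def
proof (induction \<phi>)
  case (PVar x)
  show ?case by (cases "v x") (simp_all add: place_def)
next
  case (PAnd \<phi> \<psi>)
  then show ?case by (cases "hatval v \<phi>"; cases "hatval v \<psi>") simp_all
next
  case (POr \<phi> \<psi>)
  then show ?case by (cases "hatval v \<phi>"; cases "hatval v \<psi>") simp_all
next
  case (PNeg \<phi>)
  then show ?case by (cases "hatval v \<phi>") simp_all
next
  case (PCirc \<phi>)
  then show ?case by (cases "hatval v \<phi>") simp_all
qed simp_all

lemma hatval_place_cong:
  assumes "depends_below N (\<lambda>v. hatval v \<phi>)" "\<forall>x<N. place v x = place w x"
  shows "hatval v \<phi> = hatval w \<phi>"
proof -
  have h: "hatval v \<phi> = hatval v' \<phi>" if "\<And>x. place v x = place v' x" for v v'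
    by (induction \<phi>) (simp_all add: that)
  have "place v x = place (\<lambda>x. if x < N then w x else v x) x" for x using assms(2) by (simp add: place_def)
  then have "hatval v \<phi> = hatval (\<lambda>x. if x < N then w x else v x) \<phi>" by (rule h)
  also have "\<dots> = hatval w \<phi>" using assms(1) by (simp add: depends_below_def)
  finally show ?thesis .
qed

text \<open>A rule of \<open>L\<close>, translated and relativised to a pattern, is a rule of \<open>L\<^sup>\<circ>\<close>: under matching
  patterns it becomes a substitution instance of the rule, under all others its conclusion is
  \<open>\<top>\<close>.\<close>

lemma closed_under_relativised:
  assumes inf: "infinite (UNIV :: 'a set)" and L: "super_belnap L" and T: "closed_under (circ TYPE('a) L) T"
  shows "closed_under L {\<chi>. POr (mismatch v N) (translate \<chi>) \<in> T}"
  unfolding closed_under_def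
proof (intro allI impI)
  fix \<Gamma> \<chi> assume l: "L \<Gamma> \<chi>" and \<Gamma>: "\<Gamma> \<subseteq> {\<chi>. POr (mismatch v N) (translate \<chi>) \<in> T}"
  define g where "g \<chi> = POr (mismatch v N) (translate \<chi>)" for \<chi>
  have "circ TYPE('a) L (g ` \<Gamma>) (g \<chi>)"
    unfolding circ_iff_reducts[OF inf L]
  proof
    fix w
    show "L (reduct w ` g ` \<Gamma>) (reduct w (g \<chi>))"
    proof (cases "\<forall>x<N. place v x = place w x")
      case True
      then have "reduct w (g \<chi>) = reduct w (translate \<chi>)" for \<chi> by (simp add: g_def reduct_mismatch)
      then show ?thesis using reduct_translate_conseq[OF L l, of w] by (simp add: image_image)
    next
      case False
      then have "reduct w (g \<chi>) = DTop" by (simp only: g_def reduct_mismatch if_False)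
      then show ?thesis using super_belnap_Top[OF L] by simp
    qed
  qed
  then have "g \<chi> \<in> T" by (rule closed_underD[OF T]) (use \<Gamma> in \<open>auto simp: g_def\<close>)
  then show "\<chi> \<in> {\<chi>. POr (mismatch v N) (translate \<chi>) \<in> T}" by (simp add: g_def)
qed

text \<open>A derivation in the join of \<open>L\<close> and \<open>L'\<close> can be carried out under each pattern of the
  variables of \<open>\<Phi>\<close> and \<open>\<psi>\<close> separately, and \<open>\<psi>\<close> follows by cases. A single formula
  describes the pattern because these variables are finitely many.\<close>

lemma circ_join_le:
  assumes inf: "infinite (UNIV :: 'a set)" and L: "super_belnap L" "super_belnap L'" "super_belnap (join_logic L L')"
    and fin: "finitary (join_logic L L')"
  shows "circ TYPE('a) (join_logic L L') \<le> join_logic (circ TYPE('a) L) (circ TYPE('a) L')"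
proof (intro le_funI le_boolI)
  fix \<Phi>0 \<psi> assume "circ TYPE('a) (join_logic L L') \<Phi>0 \<psi>"
  then have "\<exists>\<Phi>\<subseteq>\<Phi>0. finite \<Phi> \<and> circ TYPE('a) (join_logic L L') \<Phi> \<psi>"
    using finitary_circ[OF inf L(3) fin] unfolding finitary_def by simp
  then obtain \<Phi> where \<Phi>: "\<Phi> \<subseteq> \<Phi>0" "finite \<Phi>" and c: "circ TYPE('a) (join_logic L L') \<Phi> \<psi>"
    by (elim exE conjE) (rule that)
  show "join_logic (circ TYPE('a) L) (circ TYPE('a) L') \<Phi>0 \<psi>"
    unfolding join_logic_def
  proof (intro allI impI)
    fix T assume T: "closed_under (circ TYPE('a) L) T \<and> closed_under (circ TYPE('a) L') T"
      and "\<Phi>0 \<subseteq> T"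
    then have \<Phi>T: "\<Phi> \<subseteq> T" using \<Phi>(1) by blast
    note T1 = conjunct1[OF T]
    obtain N where N: "\<forall>\<phi>\<in>insert \<psi> \<Phi>. depends_below N (\<lambda>v. hatval v \<phi>)"
      using depends_below_finite[of "insert \<psi> \<Phi>" "\<lambda>\<phi> v. hatval v \<phi>", OF _ hatval_depends_below] \<Phi>(2)
      by auto
    define g where "g v \<phi> = POr (mismatch v N) (translate (reduct v \<phi>))" for v \<phi>
    have rg: "reduct w (g v \<phi>) = (if \<forall>x<N. place v x = place w x then reduct w \<phi> else DTop)"
      if \<phi>: "\<phi> \<in> insert \<psi> \<Phi>" for v w \<phi>
    proof (cases "\<forall>x<N. place v x = place w x")
      case True
      with N \<phi> have "hatval v \<phi> = hatval w \<phi>" by (intro hatval_place_cong[of N]) blast+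
      then have "reduct v \<phi> = reduct w \<phi>" by (simp add: reduct_def)
      then show ?thesis using True hatval_translate_reduct[of w \<phi>] by (simp add: g_def reduct_mismatch reduct_def[of w])
    qed (simp only: g_def reduct_mismatch if_False)
    have "g v \<psi> \<in> T" for v
    proof -
      define U where "U = {\<chi>. POr (mismatch v N) (translate \<chi>) \<in> T}"
      have "reduct v ` \<Phi> \<subseteq> U"
      proof safe
        fix \<phi> assume \<phi>: "\<phi> \<in> \<Phi>"
        have "L (reduct w ` {\<phi>}) (reduct w (g v \<phi>))" for w
          using rg[of \<phi> w v] \<phi> super_belnap_Top[OF L(1)] consequence_refl[OF super_belnapD(1)[OF L(1)]]
          by (cases "\<forall>x<N. place v x = place w x") auto
        then have "circ TYPE('a) L {\<phi>} (g v \<phi>)" unfolding circ_iff_reducts[OF inf L(1)] by blast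
        then have "g v \<phi> \<in> T" by (rule closed_underD[OF T1]) (use \<phi> \<Phi>T in blast)
        then show "reduct v \<phi> \<in> U" by (simp add: U_def g_def)
      qed
      moreover have "closed_under L U \<and> closed_under L' U"
        unfolding U_def using closed_under_relativised[OF inf L(1)] closed_under_relativised[OF inf L(2)] T
        by simp
      moreover have "join_logic L L' (reduct v ` \<Phi>) (reduct v \<psi>)"
        using c unfolding circ_iff_reducts[OF inf L(3)] by simp
      ultimately have "reduct v \<psi> \<in> U" unfolding join_logic_def by simp
      then show ?thesis by (simp add: U_def g_def)
    qed
    moreover have "circ TYPE('a) L (range (\<lambda>v. g v \<psi>)) \<psi>"
      unfolding circ_iff_reducts[OF inf L(1)]
    proof
      fix w
      have "reduct w (g w \<psi>) = reduct w \<psi>" using rg[of \<psi> w w] by simp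
      then have "reduct w \<psi> \<in> reduct w ` range (\<lambda>v. g v \<psi>)" by (metis image_eqI rangeI)
      then show "L (reduct w ` range (\<lambda>v. g v \<psi>)) (reduct w \<psi>)"
        by (rule consequence_refl[OF super_belnapD(1)[OF L(1)]])
    qed
    ultimately show "\<psi> \<in> T" by (intro closed_underD[OF T1, of "range (\<lambda>v. g v \<psi>)"]) auto
  qed
qed

section \<open>Super-Belnap logics from graphs\<close>

text \<open>Graphs are given by their edges, so that every vertex has a neighbour. The colouring formula
  of a graph needs one to be positively true at the vertex.\<close>

definition graph_hom :: "('v \<times> 'v) set \<Rightarrow> ('w \<times> 'w) set \<Rightarrow> ('v \<Rightarrow> 'w) \<Rightarrow> bool" where
  "graph_hom E H f \<longleftrightarrow> (\<forall>k k'. (k, k') \<in> E \<longrightarrow> (f k, f k') \<in> H)"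

definition list_of :: "'v set \<Rightarrow> 'v list" where
  "list_of A = (SOME xs. set xs = A)"

lemma set_list_of: "finite A \<Longrightarrow> set (list_of A) = A"
  unfolding list_of_def by (rule someI_ex) (rule finite_list)

text \<open>The variables are colours, and the formula for \<open>c\<close> says that the colour \<open>c\<close> occurs and only
  colours adjacent to \<open>c\<close> may occur besides. Without a loop at \<open>c\<close>, the formula for \<open>c\<close>
  excludes \<open>c\<close> itself, but negation exchanges the positive and the negative side of a value, so
  that the two requirements concern different sides.\<close>

definition vertex_formula :: "('v :: countable \<times> 'v) set \<Rightarrow> 'v \<Rightarrow> dm_form" where
  "vertex_formula E c = foldr DAnd
     (map (\<lambda>d. DNeg (DVar (to_nat d))) (list_of {d \<in> Domain E. (c, d) \<notin> E})) (DVar (to_nat c))"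

definition colouring_formula :: "('v :: countable \<times> 'v) set \<Rightarrow> dm_form" where
  "colouring_formula E = foldr DOr (map (vertex_formula E) (list_of (Domain E))) DBot"

lemma finite_Domain: "finite E \<Longrightarrow> finite (Domain E)"
  by (simp add: Domain_fst)

lemma pm_vertex_formula:
  assumes "finite E"
  shows "Defs.plus (ev4 v (vertex_formula E c)) \<longleftrightarrow>
      Defs.plus (v (to_nat c)) \<and> (\<forall>d\<in>Domain E. (c, d) \<notin> E \<longrightarrow> \<not> Defs.minus (v (to_nat d)))"
    "Defs.minus (ev4 v (vertex_formula E c)) \<longleftrightarrow>
      Defs.minus (v (to_nat c)) \<and> (\<forall>d\<in>Domain E. (c, d) \<notin> E \<longrightarrow> \<not> Defs.plus (v (to_nat d)))"
  unfolding vertex_formula_def pm_foldr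
  by (auto simp: set_list_of finite_Domain[OF assms] ev_simps(3) pm_four simp del: dm_ev.simps(4))

lemma pm_colouring_formula:
  assumes "finite E"
  shows "Defs.plus (ev4 v (colouring_formula E)) \<longleftrightarrow> (\<exists>c\<in>Domain E. Defs.plus (ev4 v (vertex_formula E c)))"
    "Defs.minus (ev4 v (colouring_formula E)) \<longleftrightarrow> (\<exists>c\<in>Domain E. Defs.minus (ev4 v (vertex_formula E c)))"
  unfolding colouring_formula_def pm_foldr
  by (auto simp: set_list_of finite_Domain[OF assms] ev_simps(5) pm_four simp del: dm_ev.simps)

text \<open>A value has a positive side, true for \<^const>\<open>TT\<close> and \<^const>\<open>NN\<close>, and a negative side, true for
  \<^const>\<open>TT\<close> and \<^const>\<open>BB\<close>. The vertices of a graph serve as the points of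
  a frame with an involution: each has both sides, and an edge puts the negative side of one end below the positive
  side of the other.\<close>

definition compatible :: "('v \<times> 'v) set \<Rightarrow> ('v \<Rightarrow> nat \<Rightarrow> four) \<Rightarrow> bool" where
  "compatible E e \<longleftrightarrow> (\<forall>(k, k')\<in>E. \<forall>x. Defs.minus (e k x) \<longrightarrow> Defs.plus (e k' x))"

lemma compatible_ev4:
  assumes "compatible E e" "sym E" "(k, k') \<in> E" "Defs.minus (ev4 (e k) \<phi>)"
  shows "Defs.plus (ev4 (e k') \<phi>)"
proof -
  have "(Defs.minus (ev4 (e k) \<phi>) \<longrightarrow> Defs.plus (ev4 (e k') \<phi>)) \<and> (Defs.minus (ev4 (e k') \<phi>) \<longrightarrow> Defs.plus (ev4 (e k) \<phi>))"
  proof (induction \<phi>)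
    case (DVar x)
    then show ?case using assms(1,3) symD[OF assms(2,3)] by (auto simp: compatible_def)
  qed (auto simp: ev_simps pm_four simp del: dm_ev.simps)
  then show ?thesis using assms(4) by blast
qed

text \<open>At \<open>k\<close>, the negative side of a true colouring formula selects a colour. If two ends of an
  edge had colours that are not adjacent, the colour of one end would be positively true
  at the other end by compatibility, but excluded there by the colour of that end.\<close>

lemma graph_hom_if_coloured:
  assumes e: "compatible E e" "sym E" and H: "finite H" "sym H"
    and col: "\<And>k. k \<in> Domain E \<Longrightarrow> ev4 (e k) (colouring_formula H) = TT"
  shows "\<exists>f. graph_hom E H f"
proof -
  have "\<exists>c\<in>Domain H. Defs.minus (ev4 (e k) (vertex_formula H c))" if "k \<in> Domain E" for k
    using col[OF that] unfolding TT_iff pm_colouring_formula[OF H(1)] by blast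
  then obtain f where f: "\<And>k. k \<in> Domain E \<Longrightarrow> f k \<in> Domain H"
    "\<And>k. k \<in> Domain E \<Longrightarrow> Defs.minus (ev4 (e k) (vertex_formula H (f k)))" by metis
  have "(f k, f k') \<in> H" if kk: "(k, k') \<in> E" for k k'
  proof (rule ccontr)
    assume n: "(f k, f k') \<notin> H"
    have k: "k \<in> Domain E" "k' \<in> Domain E" using kk symD[OF e(2) kk] by blast+
    have "Defs.minus (e k (to_nat (f k)))"
      using f(2)[OF k(1)] unfolding pm_vertex_formula[OF H(1)] by blast
    then have "Defs.plus (e k' (to_nat (f k)))" using e(1) kk unfolding compatible_def by blast
    moreover have "(f k', f k) \<notin> H" using n H(2) by (meson symD)
    ultimately show False
      using f(2)[OF k(2)] f(1)[OF k(1)] unfolding pm_vertex_formula[OF H(1)] by blast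
  qed
  then show ?thesis unfolding graph_hom_def by blast
qed

text \<open>Every vertex is its own colour. This holds on the negative side only; on the positive side
  the colours of the neighbours hold, as compatibility demands.\<close>

definition canonical_valuation :: "('v :: countable \<times> 'v) set \<Rightarrow> 'v \<Rightarrow> nat \<Rightarrow> four" where
  "canonical_valuation E k x =
     (if x = to_nat k then BB else if \<exists>c. x = to_nat c \<and> (c, k) \<in> E then NN else FF)"

lemma pm_canonical_valuation:
  assumes "irrefl E"
  shows "Defs.plus (canonical_valuation E k (to_nat c)) \<longleftrightarrow> (c, k) \<in> E"
    "Defs.minus (canonical_valuation E k (to_nat c)) \<longleftrightarrow> c = k"
    "Defs.minus (canonical_valuation E k x) \<Longrightarrow> x = to_nat k"
  using assms by (auto simp: canonical_valuation_def pm_four irrefl_def split: if_splits)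

lemma canonical_valuation_compatible:
  assumes "sym E" "irrefl E" shows "compatible E (canonical_valuation E)"
  unfolding compatible_def
proof (intro ballI, clarify)
  fix k k' x assume k: "(k, k') \<in> E" and "Defs.minus (canonical_valuation E k x)"
  then have "x = to_nat k" by (auto dest: pm_canonical_valuation(3)[OF assms(2)])
  then show "Defs.plus (canonical_valuation E k' x)"
    using k by (simp add: pm_canonical_valuation[OF assms(2)])
qed

lemma canonical_valuation_colouring:
  assumes E: "finite E" "sym E" "irrefl E" and k: "k \<in> Domain E"
  shows "ev4 (canonical_valuation E k) (colouring_formula E) = TT"
proof -
  obtain c where c: "(k, c) \<in> E" using k by blast
  have "Defs.plus (ev4 (canonical_valuation E k) (vertex_formula E c))"
    using symD[OF E(2) c] by (simp add: pm_vertex_formula[OF E(1)] pm_canonical_valuation[OF E(3)]) blast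
  moreover have "Defs.minus (ev4 (canonical_valuation E k) (vertex_formula E k))"
    using E(2) by (simp add: pm_vertex_formula[OF E(1)] pm_canonical_valuation[OF E(3)]) (meson symD)
  moreover have "c \<in> Domain E" using symD[OF E(2) c] by blast
  ultimately show ?thesis unfolding TT_iff pm_colouring_formula[OF E(1)] using k by blast
qed

lemma belnap_colouring_instance:
  assumes E: "finite E" "sym E" "irrefl E" and H: "finite H" "sym H"
    and \<sigma>: "\<sigma> \<in> dm_hom dm_Fm dm_Fm" and b: "belnap {colouring_formula E} (\<sigma> (colouring_formula H))"
  shows "\<exists>f. graph_hom E H f"
proof (rule graph_hom_if_coloured[OF _ E(2) H])
  let ?e = "canonical_valuation E"
  define e where "e k x = ev4 (?e k) (\<sigma> (DVar x))" for k x
  show "compatible E e"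
    using compatible_ev4[OF canonical_valuation_compatible[OF E(2,3)] E(2)]
    unfolding compatible_def e_def by blast
  fix k assume "k \<in> Domain E"
  then have "ev4 (?e k) (\<sigma> (colouring_formula H)) = TT"
    by (intro belnap_TT[OF b]) (simp add: canonical_valuation_colouring[OF E])
  moreover have "ev4 (?e k) (\<sigma> (colouring_formula H)) = ev4 (e k) (colouring_formula H)"
    using ev_subs[OF \<sigma>, of "?e k" "colouring_formula H"] unfolding e_def .
  ultimately show "ev4 (e k) (colouring_formula H) = TT" by simp
qed

definition refutable :: "dm_form set \<Rightarrow> dm_form set \<Rightarrow> bool" where
  "refutable X \<Phi> \<longleftrightarrow> (\<exists>\<chi>\<in>X. \<exists>\<sigma>\<in>dm_hom dm_Fm dm_Fm. belnap \<Phi> (\<sigma> \<chi>))"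

text \<open>The least super-Belnap logic in which every formula of \<open>X\<close> is explosive. A cut with an
  explosive step is explosive as it stands, so no closure is required.\<close>

definition explosive_logic :: "dm_form set \<Rightarrow> dm_form conseq" where
  "explosive_logic X \<Phi> \<psi> \<longleftrightarrow> belnap \<Phi> \<psi> \<or> refutable X \<Phi>"

lemma super_belnap_belnap: "super_belnap belnap"
proof -
  have "consequence_relation belnap"
    unfolding consequence_relation_def belnap_iff by (intro conjI allI impI; blast)
  then show ?thesis unfolding super_belnap_def dm_logic_def using belnap_subs by blast
qed

lemma refutable_cut:
  assumes "\<And>\<psi>. \<psi> \<in> \<Psi> \<Longrightarrow> belnap \<Phi> \<psi>" "refutable X \<Psi>" shows "refutable X \<Phi>"
proof -
  obtain \<chi> \<sigma> where "\<chi> \<in> X" "\<sigma> \<in> dm_hom dm_Fm dm_Fm" "belnap \<Psi> (\<sigma> \<chi>)"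
    using assms(2) unfolding refutable_def by blast
  moreover have "belnap \<Phi> (\<sigma> \<chi>)"
    by (rule consequence_cut[OF super_belnapD(1)[OF super_belnap_belnap] assms(1)]) (assumption, fact)
  ultimately show ?thesis unfolding refutable_def by blast
qed

lemma super_belnap_explosive: "super_belnap (explosive_logic X)"
proof -
  note cr = super_belnapD(1)[OF super_belnap_belnap]
  have "consequence_relation (explosive_logic X)"
    unfolding consequence_relation_def
  proof (intro conjI allI impI)
    show "explosive_logic X \<Phi> \<psi>" if "\<psi> \<in> \<Phi>" for \<Phi> \<psi>
      using consequence_refl[OF cr that] by (simp add: explosive_logic_def)
    show "explosive_logic X \<Phi>' \<psi>" if "explosive_logic X \<Phi> \<psi> \<and> \<Phi> \<subseteq> \<Phi>'" for \<Phi> \<Phi>' \<psi>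
      using that consequence_mono[OF cr, of \<Phi> _ \<Phi>'] unfolding explosive_logic_def refutable_def by blast
    show "explosive_logic X \<Phi> \<chi>"
      if h: "(\<forall>\<psi>\<in>\<Psi>. explosive_logic X \<Phi> \<psi>) \<and> explosive_logic X \<Psi> \<chi>" for \<Phi> \<Psi> \<chi>
    proof (cases "refutable X \<Phi>")
      case False
      then have b: "\<And>\<psi>. \<psi> \<in> \<Psi> \<Longrightarrow> belnap \<Phi> \<psi>" using h by (auto simp: explosive_logic_def)
      then show ?thesis
        using h consequence_cut[OF cr b, of \<Psi> \<chi>] refutable_cut[OF b, of \<Psi> X] False
        by (auto simp: explosive_logic_def)
    qed (simp add: explosive_logic_def)
  qed
  moreover have "explosive_logic X (\<sigma> ` \<Phi>) (\<sigma> \<psi>)"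
    if \<sigma>: "\<sigma> \<in> dm_hom dm_Fm dm_Fm" and "explosive_logic X \<Phi> \<psi>" for \<sigma> \<Phi> \<psi>
  proof -
    have "refutable X (\<sigma> ` \<Phi>)" if r: "refutable X \<Phi>"
    proof -
      obtain \<chi> \<tau> where \<chi>: "\<chi> \<in> X" "\<tau> \<in> dm_hom dm_Fm dm_Fm" "belnap \<Phi> (\<tau> \<chi>)"
        using r unfolding refutable_def by blast
      have "belnap (\<sigma> ` \<Phi>) ((\<sigma> \<circ> \<tau>) \<chi>)" using belnap_subs[OF \<chi>(3) \<sigma>] by simp
      then show ?thesis unfolding refutable_def using \<chi>(1) subs_comp[OF \<sigma> \<chi>(2)] by blast
    qed
    then show ?thesis using belnap_subs[OF _ \<sigma>] that(2) unfolding explosive_logic_def by blast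
  qed
  moreover have "belnap \<le> explosive_logic X" by (auto simp: explosive_logic_def)
  ultimately show ?thesis unfolding super_belnap_def dm_logic_def by blast
qed

lemma finitary_explosive: "finitary (explosive_logic X)"
  unfolding finitary_def
proof (intro allI impI)
  fix \<Phi> \<psi> assume "explosive_logic X \<Phi> \<psi>"
  then obtain \<chi> where \<chi>: "belnap \<Phi> \<chi>" "\<And>\<Phi>'. belnap \<Phi>' \<chi> \<Longrightarrow> explosive_logic X \<Phi>' \<psi>"
    unfolding explosive_logic_def refutable_def by blast
  then show "\<exists>\<Phi>'\<subseteq>\<Phi>. finite \<Phi>' \<and> explosive_logic X \<Phi>' \<psi>"
    using finitary_belnap[unfolded finitary_def, rule_format, OF \<chi>(1)] by blast
qed

lemma explosive_logic_colouring:
  assumes E: "finite E" "sym E" "irrefl E" "E \<noteq> {}"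
    and F: "\<And>H. H \<in> F \<Longrightarrow> finite H \<and> sym H"
    and anti: "\<And>H f. H \<in> F \<Longrightarrow> graph_hom E H f \<Longrightarrow> H = E"
  shows "explosive_logic (colouring_formula ` F) {colouring_formula E} DBot \<longleftrightarrow> E \<in> F"
proof
  assume "explosive_logic (colouring_formula ` F) {colouring_formula E} DBot"
  moreover have "\<not> belnap {colouring_formula E} DBot"
  proof
    assume b: "belnap {colouring_formula E} DBot"
    obtain k where "k \<in> Domain E" using E(4) by auto
    then have "ev4 (canonical_valuation E k) DBot = TT"
      by (intro belnap_TT[OF b]) (simp add: canonical_valuation_colouring[OF E(1-3)])
    then show False by (simp add: DM4_def)
  qed
  ultimately have "refutable (colouring_formula ` F) {colouring_formula E}"
    by (simp add: explosive_logic_def)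
  then obtain H \<sigma> where H: "H \<in> F" "\<sigma> \<in> dm_hom dm_Fm dm_Fm"
    "belnap {colouring_formula E} (\<sigma> (colouring_formula H))"
    unfolding refutable_def by blast
  then obtain f where "graph_hom E H f"
    using belnap_colouring_instance[OF E(1-3) _ _ H(2,3)] F by blast
  then show "E \<in> F" using anti H(1) by blast
next
  assume "E \<in> F"
  moreover have "id \<in> dm_hom dm_Fm dm_Fm" unfolding dm_hom_Fm_iff by (simp add: dm_Fm_def)
  moreover have "belnap {colouring_formula E} (id (colouring_formula E))" by (simp add: belnap_iff)
  ultimately show "explosive_logic (colouring_formula ` F) {colouring_formula E} DBot"
    unfolding explosive_logic_def refutable_def by blast
qed

section \<open>Shift graphs\<close>

definition shift_vertices :: "nat \<Rightarrow> nat \<Rightarrow> nat list set" where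
  "shift_vertices k n = {xs. set xs \<subseteq> {..<n} \<and> length xs = k \<and> strict_sorted xs}"

definition shifted :: "nat list \<Rightarrow> nat list \<Rightarrow> bool" where
  "shifted xs ys \<longleftrightarrow> (\<forall>i. Suc i < length xs \<longrightarrow> ys ! i = xs ! Suc i)"

definition shift_graph :: "nat \<Rightarrow> nat \<Rightarrow> (nat list \<times> nat list) set" where
  "shift_graph k n = {(xs, ys). xs \<in> shift_vertices k n \<and> ys \<in> shift_vertices k n \<and>
     (shifted xs ys \<or> shifted ys xs)}"

lemma finite_shift_vertices: "finite (shift_vertices k n)"
  unfolding shift_vertices_def
  by (rule finite_subset[OF _ finite_lists_length_eq[of "{..<n}" k]]) auto

lemma card_shift_vertices: "card (shift_vertices k n) \<le> n ^ k"
proof -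
  have "shift_vertices k n \<subseteq> {xs. set xs \<subseteq> {..<n} \<and> length xs = k}"
    by (auto simp: shift_vertices_def)
  then have "card (shift_vertices k n) \<le> card {xs. set xs \<subseteq> {..<n} \<and> length xs = k}"
    by (intro card_mono finite_lists_length_eq) simp
  then show ?thesis by (simp add: card_lists_length_eq)
qed

lemma finite_shift_graph: "finite (shift_graph k n)"
  by (rule finite_subset[of _ "shift_vertices k n \<times> shift_vertices k n"])
    (auto simp: shift_graph_def finite_shift_vertices)

lemma sym_shift_graph: "sym (shift_graph k n)"
  by (auto simp: shift_graph_def intro: symI)

lemma irrefl_shift_graph:
  assumes "k \<ge> 2" shows "irrefl (shift_graph k n)"
proof (rule irreflI)
  fix xs show "(xs, xs) \<notin> shift_graph k n"
  proof
    assume "(xs, xs) \<in> shift_graph k n"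
    then have xs: "length xs = k" "strict_sorted xs" "shifted xs xs"
      by (auto simp: shift_graph_def shift_vertices_def)
    have "xs ! 0 < xs ! Suc 0" by (rule sorted_wrt_nth_less[OF xs(2)]) (use xs(1) assms in auto)
    moreover have "xs ! 0 = xs ! Suc 0" using xs(1,3) assms by (simp add: shifted_def)
    ultimately show False by simp
  qed
qed

lemma shift_graph_mono: "n \<le> m \<Longrightarrow> shift_graph k n \<subseteq> shift_graph k m"
  by (fastforce simp: shift_graph_def shift_vertices_def)

text \<open>Along a short walk the entry in the middle of the list stays within it, moving one place
  per step. In a closed walk it returns to its place because the entries are distinct; so the
  length is even.\<close>

lemma shift_graph_no_short_odd_walk:
  assumes w: "\<And>t. t < l \<Longrightarrow> (w t, w (Suc t)) \<in> shift_graph k n" and closed: "w l = w 0"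
    and l: "odd l" "2 * l < k"
  shows False
proof -
  have "\<exists>s\<in>{1, -1 :: int}. \<forall>i j. i < k \<longrightarrow> j < k \<longrightarrow> int i = int j + s \<longrightarrow> w (Suc t) ! j = w t ! i"
    if t: "t < l" for t
  proof -
    have len: "length (w t) = k" "length (w (Suc t)) = k"
      using w[OF t] by (auto simp: shift_graph_def shift_vertices_def)
    consider "shifted (w t) (w (Suc t))" | "shifted (w (Suc t)) (w t)"
      using w[OF t] by (auto simp: shift_graph_def)
    then show ?thesis
    proof cases
      case 1
      have "w (Suc t) ! j = w t ! i" if "i < k" "j < k" "int i = int j + 1" for i j
      proof -
        have "i = Suc j" using that(3) by linarith
        then show ?thesis using 1 that(1) len by (simp add: shifted_def)
      qed
      then show ?thesis by blast
    next
      case 2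
      have "w (Suc t) ! j = w t ! i" if "i < k" "j < k" "int i = int j + -1" for i j
      proof -
        have "j = Suc i" using that(3) by linarith
        then show ?thesis using 2 that(2) len by (simp add: shifted_def)
      qed
      then show ?thesis by blast
    qed
  qed
  then obtain s where s: "\<And>t. t < l \<Longrightarrow> s t \<in> {1, -1 :: int}"
    and step: "\<And>t i j. t < l \<Longrightarrow> i < k \<Longrightarrow> j < k \<Longrightarrow> int i = int j + s t \<Longrightarrow> w (Suc t) ! j = w t ! i"
    by metis
  define P where "P t = (\<Sum>u<t. s u)" for t
  have P: "\<bar>P t\<bar> \<le> int t \<and> (odd (P t) \<longleftrightarrow> odd t)" if "t \<le> l" for t
    using that
  proof (induction t)
    case (Suc t)
    then show ?case using s[of t] by (auto simp: P_def)
  qed (simp add: P_def)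
  have "w t ! nat (int l - P t) = w 0 ! l" if "t \<le> l" for t
    using that
  proof (induction t)
    case (Suc t)
    have b: "\<bar>P t\<bar> \<le> int l" "\<bar>P (Suc t)\<bar> \<le> int l" using P[of t] P[of "Suc t"] Suc.prems by auto
    have "P (Suc t) = P t + s t" by (simp add: P_def)
    then have "w (Suc t) ! nat (int l - P (Suc t)) = w t ! nat (int l - P t)"
      using b l(2) Suc.prems by (intro step) auto
    then show ?case using Suc by simp
  qed (simp add: P_def)
  from this[of l] have "w 0 ! nat (int l - P l) = w 0 ! l" using closed by simp
  moreover have "distinct (w 0)" "length (w 0) = k"
    using w[of 0] l(1) by (auto simp: shift_graph_def shift_vertices_def strict_sorted_iff odd_pos)
  moreover have "nat (int l - P l) < k" "l < k" using P[of l] l(2) by auto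
  ultimately have "nat (int l - P l) = l" using nth_eq_iff_index_eq by blast
  then have "P l = 0" using P[of l] l(1) by (cases "l = 0") auto
  then show False using P[of l] l(1) by simp
qed

text \<open>Shifting \<open>0, \<dots>, k-1\<close> upwards \<open>k+1\<close> times leads to \<open>k+1, \<dots>, 2k\<close>. On the way back the
  number \<open>k\<close> is left out, which saves one step.\<close>

lemma shift_graph_odd_walk:
  assumes "2 * k < n"
  shows "\<exists>w. w (2*k+1) = w 0 \<and> (\<forall>t<2*k+1. (w t, w (Suc t)) \<in> shift_graph k n)"
proof -
  define up where "up t = map (\<lambda>i. t + i) [0..<k]" for t
  define down where "down p = map (\<lambda>i. if p + i < k then p + i else Suc (p + i)) [0..<k]" for p
  define w where "w t = (if t \<le> k then up t else down (2*k+1-t))" for t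
  have up: "up t \<in> shift_vertices k n" if "t \<le> k + 1" for t
    using that assms by (auto simp: up_def shift_vertices_def sorted_wrt_iff_nth_less)
  have down: "down p \<in> shift_vertices k n" if "p \<le> k" for p
    using that assms by (auto simp: down_def shift_vertices_def sorted_wrt_iff_nth_less)
  have turn: "down k = up (k + 1)" by (simp add: up_def down_def)
  have "down 0 = up 0" by (rule nth_equalityI) (simp_all add: up_def down_def)
  then have "w (2*k+1) = w 0" by (simp add: w_def)
  moreover have "(w t, w (Suc t)) \<in> shift_graph k n" if t: "t < 2*k+1" for t
  proof (cases "t \<le> k")
    case True
    have "w (Suc t) = up (Suc t)"
    proof (cases "t = k")
      case True
      then show ?thesis using turn by (simp add: w_def)
    next
      case False
      then show ?thesis using \<open>t \<le> k\<close> by (simp add: w_def)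
    qed
    moreover have "shifted (up t) (up (Suc t))" by (simp add: shifted_def up_def)
    ultimately show ?thesis using True up by (simp add: shift_graph_def w_def)
  next
    case False
    define p where "p = 2*k - t"
    have p: "2*k+1-t = Suc p" "2*k+1 - Suc t = p" "Suc p \<le> k"
      using False t by (auto simp: p_def)
    have "w t = down (Suc p)" "w (Suc t) = down p" using False p by (simp_all add: w_def)
    moreover have "shifted (down p) (down (Suc p))" by (simp add: shifted_def down_def)
    ultimately show ?thesis using p down by (simp add: shift_graph_def)
  qed
  ultimately show ?thesis by blast
qed

definition arrows :: "nat \<Rightarrow> nat \<Rightarrow> nat \<Rightarrow> bool" where
  "arrows k q n \<longleftrightarrow> (\<forall>c. (\<forall>xs\<in>shift_vertices k n. c xs < q) \<longrightarrow>
     (\<exists>xs ys. (xs, ys) \<in> shift_graph k n \<and> c xs = c ys))"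

lemma arrows_mono:
  assumes "arrows k q n" "n \<le> m" shows "arrows k q m"
proof -
  have "shift_vertices k n \<subseteq> shift_vertices k m" using assms(2) by (auto simp: shift_vertices_def)
  then show ?thesis using assms(1) shift_graph_mono[OF assms(2), of k] unfolding arrows_def by (meson subsetD)
qed

text \<open>Ramsey's theorem gives \<open>k+1\<close> numbers all of whose \<open>k\<close>-subsets have the same colour; the
  one without the last number and the one without the first are adjacent.\<close>

lemma shift_graph_arrows: "\<exists>n. arrows k q n"
proof -
  obtain n :: nat where n: "partn_lst {..<n} (replicate q (Suc k)) k" using ramsey_full by blast
  have "\<exists>xs ys. (xs, ys) \<in> shift_graph k n \<and> c xs = c ys"
    if c: "\<forall>xs\<in>shift_vertices k n. c xs < q" for c
  proof -
    define f where "f X = c (sorted_list_of_set X)" for X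
    have "f \<in> nsets {..<n} k \<rightarrow> {..<q}"
      using c by (auto simp: f_def nsets_def shift_vertices_def)
    from partn_lstE[OF n this] obtain i H where i: "i < q" "H \<in> nsets {..<n} (replicate q (Suc k) ! i)"
      "f ` nsets H k \<subseteq> {i}" by auto
    then have H: "H \<subseteq> {..<n}" "finite H" "card H = Suc k" by (auto simp: nsets_def)
    define zs where "zs = sorted_list_of_set H"
    have zs: "length zs = Suc k" "strict_sorted zs" "set zs = H" using H by (simp_all add: zs_def)
    have mono: "xs \<in> shift_vertices k n \<and> c xs = i"
      if xs: "strict_sorted xs" "set xs \<subseteq> H" "length xs = k" for xs
    proof -
      have "card (set xs) = k" using xs by (auto simp: strict_sorted_iff distinct_card)
      then have "set xs \<in> nsets H k" using xs by (simp add: nsets_def)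
      then have "f (set xs) = i" using i(3) by blast
      moreover have "sorted_list_of_set (set xs) = xs"
        using xs(1) by (simp add: strict_sorted_iff sorted_list_of_set.idem_if_sorted_distinct)
      ultimately show ?thesis using xs H(1) by (auto simp: f_def shift_vertices_def)
    qed
    have "take k zs \<in> shift_vertices k n \<and> c (take k zs) = i"
      using zs by (intro mono) (auto simp: sorted_wrt_take dest: in_set_takeD)
    moreover have "drop 1 zs \<in> shift_vertices k n \<and> c (drop 1 zs) = i"
      using zs by (intro mono) (auto simp: sorted_wrt_drop dest: in_set_dropD)
    moreover have "shifted (take k zs) (drop 1 zs)" using zs(1) by (simp add: shifted_def)
    ultimately have "(take k zs, drop 1 zs) \<in> shift_graph k n \<and> c (take k zs) = c (drop 1 zs)"
      by (simp add: shift_graph_def)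
    then show ?thesis by blast
  qed
  then show ?thesis unfolding arrows_def by blast
qed

text \<open>The factor \<open>7\<close> makes \<open>2 * (2 * k + 1)\<close> smaller than the next length whenever \<open>k\<close> is one of
  the lengths, so a closed walk of odd length \<open>2 * k + 1\<close> has no image in a later graph. The range
  of the entries is chosen large enough for Ramsey's theorem with as many colours as the preceding
  graph may have vertices.\<close>

definition list_length :: "nat \<Rightarrow> nat" where "list_length i = 7 ^ Suc i"

primrec range_bound :: "nat \<Rightarrow> nat" where
  "range_bound 0 = 2 * list_length 0 + 1"
| "range_bound (Suc i) = (SOME n. range_bound i \<le> n \<and> 2 * list_length (Suc i) < n \<and>
     arrows (list_length (Suc i)) (range_bound i ^ list_length i) n)"

definition antichain_graph :: "nat \<Rightarrow> (nat list \<times> nat list) set" where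
  "antichain_graph i = shift_graph (list_length i) (range_bound i)"

lemma range_bound_Suc:
  "range_bound i \<le> range_bound (Suc i)" "2 * list_length (Suc i) < range_bound (Suc i)"
  "arrows (list_length (Suc i)) (range_bound i ^ list_length i) (range_bound (Suc i))"
proof -
  obtain n where n: "arrows (list_length (Suc i)) (range_bound i ^ list_length i) n"
    using shift_graph_arrows by blast
  define m where "m = n + range_bound i + 2 * list_length (Suc i) + 1"
  have "range_bound i \<le> m \<and> 2 * list_length (Suc i) < m \<and>
     arrows (list_length (Suc i)) (range_bound i ^ list_length i) m"
    using arrows_mono[OF n, of m] by (simp add: m_def)
  from someI[of "\<lambda>n. range_bound i \<le> n \<and> 2 * list_length (Suc i) < n \<and>
     arrows (list_length (Suc i)) (range_bound i ^ list_length i) n", OF this]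
  show "range_bound i \<le> range_bound (Suc i)" "2 * list_length (Suc i) < range_bound (Suc i)"
    "arrows (list_length (Suc i)) (range_bound i ^ list_length i) (range_bound (Suc i))"
    by simp_all
qed

lemma range_bound_large: "2 * list_length i < range_bound i"
  using range_bound_Suc(2) by (cases i) simp_all

lemma antichain_graph_props:
  "finite (antichain_graph i)" "sym (antichain_graph i)" "irrefl (antichain_graph i)"
  "antichain_graph i \<noteq> {}"
proof -
  have "(1::nat) \<le> 7 ^ i" by simp
  then have "2 \<le> list_length i" unfolding list_length_def power_Suc by linarith
  then show "irrefl (antichain_graph i)"
    unfolding antichain_graph_def by (rule irrefl_shift_graph)
  show "antichain_graph i \<noteq> {}"
    unfolding antichain_graph_def using shift_graph_odd_walk[OF range_bound_large[of i]] by fastforce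
qed (simp_all add: antichain_graph_def finite_shift_graph sym_shift_graph)

text \<open>The graphs have both growing odd girth and growing chromatic number. The former excludes
  homomorphisms into later graphs, the latter into earlier ones.\<close>

lemma antichain_graph_hom:
  assumes hom: "graph_hom (antichain_graph i) (antichain_graph j) f" shows "i = j"
proof (rule ccontr)
  assume "i \<noteq> j"
  then consider "i < j" | "j < i" by linarith
  then show False
  proof cases
    case 1
    obtain w where w: "w (2 * list_length i + 1) = w 0"
      "\<And>t. t < 2 * list_length i + 1 \<Longrightarrow> (w t, w (Suc t)) \<in> antichain_graph i"
      using shift_graph_odd_walk[OF range_bound_large[of i]] unfolding antichain_graph_def by blast
    have walk: "(f (w t), f (w (Suc t))) \<in> shift_graph (list_length j) (range_bound j)"
      if "t < 2 * list_length i + 1" for t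
      using hom w(2)[OF that] unfolding graph_hom_def antichain_graph_def by blast
    have short: "2 * (2 * list_length i + 1) < list_length j"
    proof -
      have "(7::nat) ^ Suc (Suc i) \<le> 7 ^ Suc j" using 1 by (intro power_increasing) simp_all
      then have "7 * list_length i \<le> list_length j" by (simp add: list_length_def)
      moreover have "1 \<le> list_length i" by (simp add: list_length_def)
      ultimately show ?thesis by simp
    qed
    show False
      by (rule shift_graph_no_short_odd_walk[of "2 * list_length i + 1" "\<lambda>t. f (w t)", OF walk])
        (use w(1) short in simp_all)
  next
    case 2
    then obtain m where m: "i = Suc m" "j \<le> m" by (cases i) auto
    define V where "V = shift_vertices (list_length j) (range_bound j)"
    define q where "q = range_bound m ^ list_length m"
    have bounds: "range_bound j \<le> range_bound m" "list_length j \<le> list_length m"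
      using m(2) lift_Suc_mono_le[of range_bound, OF range_bound_Suc(1)]
      by (auto simp: list_length_def intro!: power_increasing)
    have "range_bound m > 0" using range_bound_large[of m] by simp
    then have q: "q > 0" by (simp add: q_def)
    have "card V \<le> range_bound j ^ list_length j" unfolding V_def by (rule card_shift_vertices)
    also have "\<dots> \<le> range_bound m ^ list_length j" using bounds by (intro power_mono) simp_all
    also have "\<dots> \<le> q" unfolding q_def
      using bounds \<open>range_bound m > 0\<close> by (intro power_increasing) simp_all
    finally have cardV: "card V \<le> q" .
    have "finite V" unfolding V_def by (rule finite_shift_vertices)
    then obtain g where g: "bij_betw g V {0..<card V}" using ex_bij_betw_finite_nat by blast
    define c where "c xs = (if f xs \<in> V then g (f xs) else 0)" for xs
    have "g zs < q" if "zs \<in> V" for zs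
      using bij_betw_apply[OF g that] cardV by simp
    then have "c xs < q" for xs using q by (simp add: c_def)
    then obtain xs ys where e: "(xs, ys) \<in> antichain_graph i" "c xs = c ys"
      using range_bound_Suc(3)[of m] unfolding arrows_def antichain_graph_def m(1) q_def[symmetric] by blast
    then have fe: "(f xs, f ys) \<in> antichain_graph j" using hom unfolding graph_hom_def by blast
    then have "f xs \<in> V" "f ys \<in> V" by (auto simp: antichain_graph_def shift_graph_def V_def)
    then have "f xs = f ys" using e(2) bij_betw_imp_inj_on[OF g] by (simp add: c_def inj_on_eq_iff)
    then show False using fe antichain_graph_props(3)[of j] by (simp add: irrefl_def)
  qed
qed

definition graph_logic :: "nat set \<Rightarrow> dm_form conseq" where
  "graph_logic S = explosive_logic (colouring_formula ` antichain_graph ` S)"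

lemma graph_logic_iff: "graph_logic S {colouring_formula (antichain_graph i)} DBot \<longleftrightarrow> i \<in> S"
proof -
  have "graph_hom (antichain_graph i) (antichain_graph i) id" for i by (simp add: graph_hom_def)
  then have inj: "antichain_graph i = antichain_graph j \<Longrightarrow> i = j" for i j
    using antichain_graph_hom by metis
  have "graph_logic S {colouring_formula (antichain_graph i)} DBot \<longleftrightarrow>
      antichain_graph i \<in> antichain_graph ` S"
    unfolding graph_logic_def
    by (rule explosive_logic_colouring[OF antichain_graph_props])
      (auto simp: antichain_graph_props dest: antichain_graph_hom)
  then show ?thesis using inj by blast
qed

lemma inj_graph_logic: "inj graph_logic"
proof (rule injI)
  fix S S' assume "graph_logic S = graph_logic S'"
  then have "i \<in> S \<longleftrightarrow> i \<in> S'" for i using graph_logic_iff[of S i] graph_logic_iff[of S' i] by simp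
  then show "S = S'" by blast
qed

lemma real_lepoll_nat_sets: "(UNIV :: real set) \<lesssim> (UNIV :: nat set set)"
proof -
  define cut where "cut x = to_nat ` {q :: rat. of_rat q < x}" for x :: real
  have "inj cut"
  proof (rule linorder_injI)
    fix x y :: real assume "x < y"
    then obtain q where q: "x < of_rat q" "of_rat q < y" using of_rat_dense by blast
    then have "to_nat q \<in> cut y" "to_nat q \<notin> cut x" by (auto simp: cut_def)
    then show "cut x \<noteq> cut y" by blast
  qed
  then show ?thesis unfolding lepoll_def by blast
qed

section \<open>The embedding\<close>

lemma carrier_super_belnap:
  "L \<in> carrier (extensions dm_logic belnap) \<longleftrightarrow> super_belnap L"
  "L \<in> carrier (fin_extensions dm_logic belnap) \<longleftrightarrow> super_belnap L \<and> finitary L"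
  by (auto simp: extensions_def fin_extensions_def super_belnap_def)

lemma circ_carrier:
  assumes "infinite (UNIV :: 'a set)" "super_belnap L"
  shows "circ TYPE('a) L \<in> carrier (extensions pp_logic (pp_leq TYPE('a)))"
    "finitary L \<Longrightarrow> circ TYPE('a) L \<in> carrier (fin_extensions pp_logic (pp_leq TYPE('a)))"
  using circ_pp_logic[OF assms] pp_leq_le_circ[OF assms] finitary_circ[OF assms]
  by (simp_all add: extensions_def fin_extensions_def)

lemma super_belnap_inf: "super_belnap L \<Longrightarrow> super_belnap L' \<Longrightarrow> super_belnap (inf L L')"
  unfolding super_belnap_def by (simp add: dm_logic_inf)

lemma super_belnap_join:
  "super_belnap L \<Longrightarrow> super_belnap L' \<Longrightarrow> super_belnap (join_logic L L')"
  unfolding super_belnap_def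
  using dm_logic_join[of L L'] order_trans[OF _ join_logic_upper(1)[of L L']] by blast

lemma inj_on_circ:
  assumes "infinite (UNIV :: 'a set)" shows "inj_on (circ TYPE('a)) {L. super_belnap L}"
proof (rule inj_onI)
  fix L L' assume L: "L \<in> {L. super_belnap L}" "L' \<in> {L. super_belnap L}"
    and eq: "circ TYPE('a) L = circ TYPE('a) L'"
  have "L \<Gamma> \<chi> = L' \<Gamma> \<chi>" for \<Gamma> \<chi>
    using circ_recovers[OF assms, of L \<Gamma> \<chi>] circ_recovers[OF assms, of L' \<Gamma> \<chi>] L eq by simp
  then show "L = L'" by blast
qed

lemma circ_join:
  assumes inf: "infinite (UNIV :: 'a set)"
    and L: "super_belnap L" "super_belnap L'" "finitary L" "finitary L'"
  shows "circ TYPE('a) (join_logic L L') = join_logic (circ TYPE('a) L) (circ TYPE('a) L')"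
proof (rule antisym)
  note J = super_belnap_join[OF L(1,2)]
  show "circ TYPE('a) (join_logic L L') \<le> join_logic (circ TYPE('a) L) (circ TYPE('a) L')"
    by (rule circ_join_le[OF inf L(1,2) J join_logic_finitary[OF L(3,4) super_belnapD(1)[OF J]]])
  show "join_logic (circ TYPE('a) L) (circ TYPE('a) L') \<le> circ TYPE('a) (join_logic L L')"
    using circ_pp_logic[OF inf J] circ_mono[OF inf _ J] L(1,2) join_logic_upper[of L L'] join_logic_upper[of L' L]
    by (intro join_logic_least) (simp_all add: pp_logic_def)
qed

lemma circ_meet:
  assumes inf: "infinite (UNIV :: 'a set)" and L: "super_belnap L" "super_belnap L'"
  shows "circ TYPE('a) (L \<sqinter>\<^bsub>extensions dm_logic belnap\<^esub> L') =
    circ TYPE('a) L \<sqinter>\<^bsub>extensions pp_logic (pp_leq TYPE('a))\<^esub> circ TYPE('a) L'"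
proof -
  note I = super_belnap_inf[OF L]
  have "L \<sqinter>\<^bsub>extensions dm_logic belnap\<^esub> L' = inf L L'"
    using L I by (intro meet_extensions) (simp_all add: carrier_super_belnap super_belnap_def)
  moreover have "circ TYPE('a) L \<sqinter>\<^bsub>extensions pp_logic (pp_leq TYPE('a))\<^esub> circ TYPE('a) L' =
      inf (circ TYPE('a) L) (circ TYPE('a) L')"
    by (intro meet_extensions circ_carrier[OF inf] L)
      (simp add: circ_inf[OF inf L I, symmetric] circ_pp_logic[OF inf I])
  ultimately show ?thesis using circ_inf[OF inf L I] by simp
qed

lemma circ_fin_meet:
  assumes inf: "infinite (UNIV :: 'a set)"
    and L: "super_belnap L" "super_belnap L'" "finitary L" "finitary L'"
  shows "circ TYPE('a) (L \<sqinter>\<^bsub>fin_extensions dm_logic belnap\<^esub> L') =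
    circ TYPE('a) L \<sqinter>\<^bsub>fin_extensions pp_logic (pp_leq TYPE('a))\<^esub> circ TYPE('a) L'"
proof -
  note I = super_belnap_inf[OF L(1,2)]
  have f: "finitary (inf L L')"
    by (rule finitary_inf[OF super_belnapD(1)[OF L(1)] super_belnapD(1)[OF L(2)] L(3,4)])
  have "L \<sqinter>\<^bsub>fin_extensions dm_logic belnap\<^esub> L' = inf L L'"
    unfolding fin_extensions_def
    by (rule meet_extensions) (use L I f in \<open>simp_all add: extensions_def super_belnap_def\<close>)
  moreover have "circ TYPE('a) L \<sqinter>\<^bsub>fin_extensions pp_logic (pp_leq TYPE('a))\<^esub> circ TYPE('a) L' =
      inf (circ TYPE('a) L) (circ TYPE('a) L')"
    unfolding fin_extensions_def
    by (rule meet_extensions)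
      (use circ_carrier(2)[OF inf L(1,3)] circ_carrier(2)[OF inf L(2,4)]
        circ_pp_logic[OF inf I] finitary_circ[OF inf I f] in
        \<open>simp_all add: fin_extensions_def circ_inf[OF inf L(1,2) I]\<close>)
  ultimately show ?thesis using circ_inf[OF inf L(1,2) I] by simp
qed

lemma circ_fin_join:
  assumes inf: "infinite (UNIV :: 'a set)"
    and L: "super_belnap L" "super_belnap L'" "finitary L" "finitary L'"
  shows "circ TYPE('a) (L \<squnion>\<^bsub>fin_extensions dm_logic belnap\<^esub> L') =
    circ TYPE('a) L \<squnion>\<^bsub>fin_extensions pp_logic (pp_leq TYPE('a))\<^esub> circ TYPE('a) L'"
proof -
  note J = super_belnap_join[OF L(1,2)]
  have f: "finitary (join_logic L L')"
    by (rule join_logic_finitary[OF L(3,4) super_belnapD(1)[OF J]])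
  have "L \<squnion>\<^bsub>fin_extensions dm_logic belnap\<^esub> L' = join_logic L L'"
    unfolding fin_extensions_def
    by (rule join_extensions)
      (use L J f in \<open>simp_all add: extensions_def super_belnap_def dm_logic_def\<close>)
  moreover have "circ TYPE('a) L \<squnion>\<^bsub>fin_extensions pp_logic (pp_leq TYPE('a))\<^esub> circ TYPE('a) L' =
      join_logic (circ TYPE('a) L) (circ TYPE('a) L')"
    unfolding fin_extensions_def
    by (rule join_extensions)
      (use circ_carrier(2)[OF inf L(1,3)] circ_carrier(2)[OF inf L(2,4)]
        circ_pp_logic[OF inf J] finitary_circ[OF inf J f] in
        \<open>simp_all add: fin_extensions_def circ_join[OF inf L] pp_logic_def\<close>)
  ultimately show ?thesis using circ_join[OF inf L] by simp
qed

theorem corollary3p24: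
  assumes "infinite (UNIV :: 'a set)"
  shows "lattice_embedding (fin_extensions dm_logic belnap)
           (fin_extensions pp_logic (pp_leq TYPE('a))) (circ TYPE('a)) \<and>
         meet_embedding (extensions dm_logic belnap)
           (extensions pp_logic (pp_leq TYPE('a))) (circ TYPE('a)) \<and>
         (UNIV :: real set) \<lesssim> carrier (fin_extensions pp_logic (pp_leq TYPE('a)))"
proof (intro conjI)
  show "lattice_embedding (fin_extensions dm_logic belnap)
      (fin_extensions pp_logic (pp_leq TYPE('a))) (circ TYPE('a))"
    unfolding lattice_embedding_def
    using circ_carrier(2)[OF assms] circ_fin_meet[OF assms] circ_fin_join[OF assms]
    by (auto simp: carrier_super_belnap intro!: inj_on_subset[OF inj_on_circ[OF assms]])
  show "meet_embedding (extensions dm_logic belnap)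
      (extensions pp_logic (pp_leq TYPE('a))) (circ TYPE('a))"
    unfolding meet_embedding_def
    using circ_carrier(1)[OF assms] circ_meet[OF assms]
    by (auto simp: carrier_super_belnap intro!: inj_on_subset[OF inj_on_circ[OF assms]])
  have g: "super_belnap (graph_logic S) \<and> finitary (graph_logic S)" for S
    unfolding graph_logic_def by (simp add: super_belnap_explosive finitary_explosive)
  have "inj (circ TYPE('a) \<circ> graph_logic)"
    by (rule comp_inj_on[OF inj_graph_logic inj_on_subset[OF inj_on_circ[OF assms]]]) (use g in auto)
  moreover have "range (circ TYPE('a) \<circ> graph_logic) \<subseteq>
      carrier (fin_extensions pp_logic (pp_leq TYPE('a)))"
    using g circ_carrier(2)[OF assms] by auto
  ultimately have "(UNIV :: nat set set) \<lesssim> carrier (fin_extensions pp_logic (pp_leq TYPE('a)))"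
    unfolding lepoll_def by blast
  then show "(UNIV :: real set) \<lesssim> carrier (fin_extensions pp_logic (pp_leq TYPE('a)))"
    by (rule lepoll_trans[OF real_lepoll_nat_sets])
qed

end
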